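(* Let $\gamma\in(0,1/2)$, and for $t>0$ let $|\mathcal Z_t|$ denote the Lebesgue measure of $\mathcal Z_t:=\{s\in[0,t]:Y_s=0\}$, where $Y$ is the canonical process. (a) For any $t>0$ and $\epsilon>0$, for all sufficiently small $\delta>0$, $$\mathbb P\big(|\mathcal Z_t|<(1-2\epsilon)t\big)<\epsilon$$ for any $\mathbb P\in\mathscr M_{\gamma,\delta}(0)$. (b) For any $t>0$, $\delta>0$ and $\mathbb P\in\mathscr M_{\gamma,\delta}(0)$, $|\mathcal Z_t|>0$ $\mathbb P$-a.s.
   Context: Let $\mathbb R_+=[0,\infty)$ and let $\Omega=C(\mathbb R_+,\mathbb R)$ be the space of continuous paths with its Borel $\sigma$-algebra $\mathcal B(\Omega)$ (locally uniform convergence), with coordinate maps $Y_t(\omega)=\omega(t)$. For $\delta>0$ set $M_t:=Y_t-Y_0-\delta t$ and $I_t:=\frac12\int_0^tY_s^{2\gamma}\,ds$ (with $y^{2\gamma}:=0$ for $y<0$). Given a probability measure $\mathbb P$ on $(\Omega,\mathcal B(\Omega))$, $(\mathscr F_t)_{t\ge0}$ denotes the $\mathbb P$-completed, right-continuous filtration generated by $Y$. Class $\mathscr M_{\gamma,\delta}$: $\mathbb P\in\mathscr M_{\gamma,\delta}$ if (i) $\mathbb P(Y_t\ge0\ \forall t\ge0)=1$; and (ii) under $\mathbb P$, $M=(M_t)_{t\ge0}$ is a continuous $(\mathscr F_t)$-local martingale whose quadratic variation $\langle M\rangle$ satisfies $\mathbb P(\langle M\rangle_t-\langle M\rangle_s\ge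 I_t-I_s\ \forall\,t\ge s\ge0)=1$. For $x\ge0$, $\mathbb P\in\mathscr M_{\gamma,\delta}(x)$ means $\mathbb P\in\mathscr M_{\gamma,\delta}$ and $\mathbb P(Y_0=x)=1$. *)

theory Defs
  imports "HOL-Probability.Probability"
begin

section \<open>The space of continuous paths\<close>

typedef path = "{f :: real \<Rightarrow> real. f \<in> extensional {0..} \<and> continuous_on {0..} f}"
  morphisms path_at Abs_path
  by (intro exI[of _ "restrict (\<lambda>_. 0) {0..}"])
     (auto intro: continuous_on_eq[OF continuous_on_const])

abbreviation Y :: "real \<Rightarrow> path \<Rightarrow> real" where
  "Y t \<omega> \<equiv> path_at \<omega> t"

lemma continuous_on_path: "continuous_on {0..} (\<lambda>t. Y t \<omega>)"
  using path_at[of \<omega>] by simp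

text \<open>The topology of locally uniform convergence: every compact subset of the half-line lies
  in some interval \<open>[0,T]\<close>, so these uniform balls form neighbourhood bases. The type is a
  topological space, so \<open>borel :: path measure\<close> carries the Borel \<open>\<sigma>\<close>-algebra of path space.\<close>

instantiation path :: topological_space
begin

definition open_path :: "path set \<Rightarrow> bool" where
  "open_path U \<longleftrightarrow> (\<forall>\<omega>\<in>U. \<exists>T\<ge>0. \<exists>e>0. \<forall>\<omega>'. (\<forall>s\<in>{0..T}. \<bar>Y s \<omega>' - Y s \<omega>\<bar> < e) \<longrightarrow> \<omega>' \<in> U)"

instance
proof
  show "open (UNIV :: path set)"
    by (auto simp: open_path_def intro!: exI[of _ 0] exI[of _ 1])
next
  fix U V :: "path set"
  assume U: "open U" and V: "open V"
  show "open (U \<inter> V)"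
    unfolding open_path_def
  proof
    fix \<omega> assume w: "\<omega> \<in> U \<inter> V"
    obtain T e where 1: "T \<ge> 0" "e > 0" "\<And>\<omega>'. (\<forall>s\<in>{0..T}. \<bar>Y s \<omega>' - Y s \<omega>\<bar> < e) \<Longrightarrow> \<omega>' \<in> U"
      using U w unfolding open_path_def by (meson IntD1)
    obtain T' e' where 2: "T' \<ge> 0" "e' > 0"
      "\<And>\<omega>'. (\<forall>s\<in>{0..T'}. \<bar>Y s \<omega>' - Y s \<omega>\<bar> < e') \<Longrightarrow> \<omega>' \<in> V"
      using V w unfolding open_path_def by (meson IntD2)
    have "\<omega>' \<in> U \<inter> V" if "\<forall>s\<in>{0..max T T'}. \<bar>Y s \<omega>' - Y s \<omega>\<bar> < min e e'" for \<omega>'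
      using that by (auto intro!: 1(3) 2(3))
    then show "\<exists>T\<ge>0. \<exists>e>0. \<forall>\<omega>'. (\<forall>s\<in>{0..T}. \<bar>Y s \<omega>' - Y s \<omega>\<bar> < e) \<longrightarrow> \<omega>' \<in> U \<inter> V"
      using 1 2 by (intro exI[of _ "max T T'"] exI[of _ "min e e'"] conjI) auto
  qed
next
  fix K :: "path set set"
  assume "\<forall>U\<in>K. open U"
  then show "open (\<Union>K)"
    unfolding open_path_def by (meson Union_iff)
qed

end

section \<open>Local martingales\<close>

text \<open>Filtrations are families of measures indexed by real times; only times \<open>t \<ge> 0\<close> matter, and
  only the \<open>\<sigma>\<close>-algebras of these measures do.\<close>

definition adapted :: "(real \<Rightarrow> 'a measure) \<Rightarrow> (real \<Rightarrow> 'a \<Rightarrow> real) \<Rightarrow> bool" where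
  "adapted F X \<longleftrightarrow> (\<forall>t\<ge>0. X t \<in> borel_measurable (F t))"

definition martingale :: "'a measure \<Rightarrow> (real \<Rightarrow> 'a measure) \<Rightarrow> (real \<Rightarrow> 'a \<Rightarrow> real) \<Rightarrow> bool" where
  "martingale Q F X \<longleftrightarrow>
     (\<forall>t\<ge>0. subalgebra Q (F t)) \<and> adapted F X \<and> (\<forall>t\<ge>0. integrable Q (X t)) \<and>
     (\<forall>s t. 0 \<le> s \<longrightarrow> s \<le> t \<longrightarrow> (AE \<omega> in Q. real_cond_exp Q (F s) (X t) \<omega> = X s \<omega>))"

text \<open>The library's \<open>stopping_time\<close> takes values in the time index type; here stopping times
  may be infinite while times are real.\<close>

definition ext_stopping_time :: "(real \<Rightarrow> 'a measure) \<Rightarrow> ('a \<Rightarrow> ennreal) \<Rightarrow> bool" where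
  "ext_stopping_time F \<tau> \<longleftrightarrow> (\<forall>t\<ge>0. Measurable.pred (F t) (\<lambda>\<omega>. \<tau> \<omega> \<le> ennreal t))"

definition stopped :: "(real \<Rightarrow> 'a \<Rightarrow> real) \<Rightarrow> ('a \<Rightarrow> ennreal) \<Rightarrow> real \<Rightarrow> 'a \<Rightarrow> real" where
  "stopped X \<tau> t \<omega> = X (enn2real (min (ennreal t) (\<tau> \<omega>))) \<omega>"

definition local_martingale :: "'a measure \<Rightarrow> (real \<Rightarrow> 'a measure) \<Rightarrow> (real \<Rightarrow> 'a \<Rightarrow> real) \<Rightarrow> bool" where
  "local_martingale Q F X \<longleftrightarrow> adapted F X \<and>
     (\<exists>\<tau> :: nat \<Rightarrow> 'a \<Rightarrow> ennreal.
        (\<forall>n. ext_stopping_time F (\<tau> n)) \<and>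
        (AE \<omega> in Q. incseq (\<lambda>n. \<tau> n \<omega>) \<and> (\<lambda>n. \<tau> n \<omega>) \<longlonglongrightarrow> \<infinity>) \<and>
        (\<forall>n. martingale Q F (\<lambda>t \<omega>. stopped X (\<tau> n) t \<omega> - X 0 \<omega>)))"

definition continuous_local_martingale ::
  "'a measure \<Rightarrow> (real \<Rightarrow> 'a measure) \<Rightarrow> (real \<Rightarrow> 'a \<Rightarrow> real) \<Rightarrow> bool" where
  "continuous_local_martingale Q F X \<longleftrightarrow>
     local_martingale Q F X \<and> (AE \<omega> in Q. continuous_on {0..} (\<lambda>t. X t \<omega>))"

text \<open>\<open>A\<close> is (a version of) the quadratic variation \<open>\<langle>X\<rangle>\<close> of the continuous local martingale \<open>X\<close>:
  the continuous increasing adapted process, unique up to indistinguishability, which starts at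
  \<open>0\<close> and makes \<open>X\<^sup>2 - \<langle>X\<rangle>\<close> a local martingale.\<close>

definition quadratic_variation ::
  "'a measure \<Rightarrow> (real \<Rightarrow> 'a measure) \<Rightarrow> (real \<Rightarrow> 'a \<Rightarrow> real) \<Rightarrow> (real \<Rightarrow> 'a \<Rightarrow> real) \<Rightarrow> bool" where
  "quadratic_variation Q F X A \<longleftrightarrow> adapted F A \<and>
     (AE \<omega> in Q. A 0 \<omega> = 0 \<and> mono_on {0..} (\<lambda>t. A t \<omega>) \<and> continuous_on {0..} (\<lambda>t. A t \<omega>)) \<and>
     local_martingale Q F (\<lambda>t \<omega>. (X t \<omega>)\<^sup>2 - A t \<omega>)"

section \<open>The class of laws\<close>

definition completed_filtration :: "path measure \<Rightarrow> real \<Rightarrow> path measure" where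
  "completed_filtration P t = sigma UNIV
     ({Y s -` B | s B. s \<in> {0..t} \<and> B \<in> sets borel} \<union> null_sets (completion P))"

definition usual_filtration :: "path measure \<Rightarrow> real \<Rightarrow> path measure" where
  "usual_filtration P t = sigma UNIV (\<Inter>u\<in>{t<..}. sets (completed_filtration P u))"

definition M_proc :: "real \<Rightarrow> real \<Rightarrow> path \<Rightarrow> real" where
  "M_proc \<delta> t \<omega> = Y t \<omega> - Y 0 \<omega> - \<delta> * t"

text \<open>The case distinction is needed because \<open>powr\<close> does not vanish at negative arguments.\<close>

definition I_proc :: "real \<Rightarrow> real \<Rightarrow> path \<Rightarrow> real" where
  "I_proc \<gamma> t \<omega> =
     1/2 * (LINT s:{0..t}|lborel. if Y s \<omega> < 0 then 0 else Y s \<omega> powr (2 * \<gamma>))"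

text \<open>Null events are understood with respect to the completion of \<open>P\<close>, on which the completed
  filtration lives.\<close>

definition M_class :: "real \<Rightarrow> real \<Rightarrow> path measure set" where
  "M_class \<gamma> \<delta> = {P. prob_space P \<and> sets P = sets borel \<and>
     (AE \<omega> in P. \<forall>t\<ge>0. Y t \<omega> \<ge> 0) \<and>
     continuous_local_martingale (completion P) (usual_filtration P) (M_proc \<delta>) \<and>
     (\<exists>A. quadratic_variation (completion P) (usual_filtration P) (M_proc \<delta>) A \<and>
        (AE \<omega> in completion P. \<forall>s t. 0 \<le> s \<longrightarrow> s \<le> t \<longrightarrow>
           A t \<omega> - A s \<omega> \<ge> I_proc \<gamma> t \<omega> - I_proc \<gamma> s \<omega>))}"

definition M_class_from :: "real \<Rightarrow> real \<Rightarrow> real \<Rightarrow> path measure set" where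
  "M_class_from \<gamma> \<delta> x = {P \<in> M_class \<gamma> \<delta>. AE \<omega> in P. Y 0 \<omega> = x}"

definition zero_set :: "real \<Rightarrow> path \<Rightarrow> real set" where
  "zero_set t \<omega> = {s \<in> {0..t}. Y s \<omega> = 0}"

section \<open>Measurability of the zero time\<close>

text \<open>The Lebesgue measure of the zero set is upper semicontinuous in the path, hence the events
  it defines are Borel.\<close>

lemma open_measure_zero_set_less: "open {\<omega>. measure lborel (zero_set t \<omega>) < c}"
  unfolding open_path_def
proof
  fix \<omega> assume w: "\<omega> \<in> {\<omega>. measure lborel (zero_set t \<omega>) < c}"
  define C where "C n = {s \<in> {0..t}. \<bar>Y s \<omega>\<bar> \<le> 1 / real (Suc n)}" for n
  have cont: "continuous_on {0..t} (\<lambda>s. Y s \<omega>)" for \<omega>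
    by (rule continuous_on_subset[OF continuous_on_path]) auto
  have clC: "closed (C n)" for n
    unfolding C_def by (intro continuous_on_closed_Collect_le continuous_intros cont) auto
  have C_sub: "C n \<subseteq> {0..t}" for n by (auto simp: C_def)
  have fin: "emeasure lborel S \<noteq> \<infinity>" if "S \<subseteq> {0..t}" for S :: "real set"
    using emeasure_mono[OF that, of lborel] by (auto simp: top_unique emeasure_lborel_Icc_eq)
  have "(\<lambda>n. measure lborel (C n)) \<longlonglongrightarrow> measure lborel (\<Inter>n. C n)"
  proof (rule Lim_measure_decseq)
    show "range C \<subseteq> sets lborel" using clC by auto
    have "1 / real (Suc n) \<le> 1 / real (Suc m)" if "m \<le> n" for m n
      using that by (simp add: frac_le)
    then show "decseq C" unfolding decseq_def C_def by fastforce
    show "emeasure lborel (C n) \<noteq> \<infinity>" for n using fin[OF C_sub] .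
  qed
  moreover have "(\<Inter>n. C n) = zero_set t \<omega>"
  proof -
    have "x = 0" if "\<And>n. \<bar>x\<bar> \<le> 1 / real (Suc n)" for x :: real
    proof (rule ccontr)
      assume "x \<noteq> 0"
      then obtain n where "inverse (real (Suc n)) < \<bar>x\<bar>" using reals_Archimedean[of "\<bar>x\<bar>"] by auto
      with that[of n] show False by (simp add: inverse_eq_divide)
    qed
    then show ?thesis unfolding C_def zero_set_def by auto
  qed
  ultimately have "eventually (\<lambda>n. measure lborel (C n) < c) sequentially"
    using w by (auto intro: order_tendstoD)
  then obtain n where n: "measure lborel (C n) < c" by (auto simp: eventually_sequentially)
  have "\<omega>' \<in> {\<omega>. measure lborel (zero_set t \<omega>) < c}"
    if *: "\<forall>s\<in>{0..max 0 t}. \<bar>Y s \<omega>' - Y s \<omega>\<bar> < 1 / real (Suc n)" for \<omega>'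
  proof -
    have "zero_set t \<omega>' \<subseteq> C n"
    proof
      fix s assume s: "s \<in> zero_set t \<omega>'"
      then have "s \<in> {0..max 0 t}" by (auto simp: zero_set_def)
      then have "\<bar>Y s \<omega>' - Y s \<omega>\<bar> < 1 / real (Suc n)" using * by blast
      moreover have "Y s \<omega>' = 0" "s \<in> {0..t}" using s by (auto simp: zero_set_def)
      ultimately show "s \<in> C n" unfolding C_def by simp
    qed
    moreover have "emeasure lborel (C n) < top"
      using fin[of "C n"] C_sub[of n] by (simp add: less_top)
    ultimately have "measure lborel (zero_set t \<omega>') \<le> measure lborel (C n)"
      unfolding measure_def using clC[of n] by (intro enn2real_mono emeasure_mono) auto
    with n show ?thesis by simp
  qed
  then show "\<exists>T\<ge>0. \<exists>e>0. \<forall>\<omega>'. (\<forall>s\<in>{0..T}. \<bar>Y s \<omega>' - Y s \<omega>\<bar> < e) \<longrightarrow>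
      \<omega>' \<in> {\<omega>. measure lborel (zero_set t \<omega>) < c}"
    by (intro exI[of _ "max 0 t"] exI[of _ "1 / real (Suc n)"] conjI) auto
qed

end

theory Submission
  imports Defs
begin

text \<open>Let \<open>f(y) = y\<^bsup>2-2\<gamma>\<^esup> / ((1-2\<gamma>)(2-2\<gamma>))\<close>, so that \<open>f''(y) = y\<^bsup>-2\<gamma>\<^esup>\<close>. Since \<open>f' \<ge> 0\<close> and
  \<open>d\<langle>M\<rangle> \<ge> Y\<^bsup>2\<gamma>\<^esup>/2 dt\<close>, Ito's formula bounds a quarter of the expected time spent off zero before the
  hitting time \<open>T\<close> of a level \<open>K\<close> by the expectation of \<open>f(Y)\<close> at time \<open>t \<and> T\<close>, hence by a multiple of
  \<open>K\<^bsup>1-2\<gamma>\<^esup>\<close> times the expectation of \<open>Y\<close> at time \<open>t \<and> T\<close>, which is at most \<open>\<delta>t\<close>. The latter also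
  gives \<open>P(T \<le> t) \<le> \<delta>t/K\<close>. Part (a) is the case \<open>K = 1\<close>; for (b), choose \<open>K\<close> small and then a time
  small compared with \<open>K/\<delta>\<close>. Ito's formula is needed only as an inequality, which follows by summing
  second order Taylor expansions of the smoothed function with \<open>f''(y) = (y+h)\<^bsup>-2\<gamma>\<^esup>\<close> over a time grid
  and letting first the mesh and then \<open>h\<close> tend to zero.\<close>

section \<open>Stopped paths and uniform integrability\<close>

text \<open>The exponent of f is chosen so that f'' cancels the lower bound on the speed of the
  bracket: f''(Y) d<M> is at least half of dt while Y > 0, so control of f(Y) becomes control of the
  time off zero. The obstacle is that f'' is infinite at 0, exactly where the path starts; hence the
  shift by h. Moreover <M> is known only through the local martingales M and M^2 - <M>, each with
  its own localizing sequence, and their stopped versions are integrable but perhaps unbounded.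
  Optional stopping is therefore proved by uniform integrability; afterwards M is bounded up to the
  level K, and the localizing times enter only through the probability that they fall before t. The
  occupation bound is linear in t, so Markov's inequality at the level 2 \<epsilon> t gives an error
  free of t. This lets (b) fix K first and shrink the time afterwards, the zero set being increasing
  in t.\<close>

abbreviation cap :: "('a \<Rightarrow> ennreal) \<Rightarrow> real \<Rightarrow> 'a \<Rightarrow> real" where
  "cap \<rho> t \<omega> \<equiv> enn2real (min (ennreal t) (\<rho> \<omega>))"

text \<open>The minimum with the finite time t is taken before \<open>enn2real\<close>, so the
  convention that \<open>enn2real\<close> sends infinity to 0 never interferes, and these two cases
  cover every argument about the minimum of t and \<rho>.\<close>

lemma cap_cases:
  assumes "0 \<le> t"
  obtains "ennreal t < \<rho> \<omega>" "cap \<rho> t \<omega> = t"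
    | r where "\<rho> \<omega> = ennreal r" "0 \<le> r" "r \<le> t" "cap \<rho> t \<omega> = r"
proof (cases "ennreal t < \<rho> \<omega>")
  case True
  then show thesis using that(1) assms by (simp add: min_def less_imp_le)
next
  case False
  then obtain r where "\<rho> \<omega> = ennreal r" "0 \<le> r"
    by (cases "\<rho> \<omega>") (auto simp: top_unique)
  then show thesis using that(2)[of r] False assms by (auto simp: min_def not_less)
qed

lemma cap_bounds:
  assumes "0 \<le> t"
  shows "0 \<le> cap \<rho> t \<omega>" "cap \<rho> t \<omega> \<le> t"
  using assms by (cases rule: cap_cases[OF assms, of \<rho> \<omega>]; simp)+

lemma cap_eq: "0 \<le> t \<Longrightarrow> ennreal t \<le> \<rho> \<omega> \<Longrightarrow> cap \<rho> t \<omega> = t"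
  by (simp add: min_def)

text \<open>Stopping at a later time \<tau> is invisible once time has been cut off at \<rho>; so
  optional stopping at \<rho> can be performed on the process stopped at \<tau> and read off for the
  original one.\<close>

lemma cap_cap:
  assumes "0 \<le> t" "\<rho> \<omega> \<le> \<tau> \<omega>"
  shows "cap \<tau> (cap \<rho> t \<omega>) \<omega> = cap \<rho> t \<omega>"
proof -
  have "ennreal (cap \<rho> t \<omega>) \<le> \<tau> \<omega>"
  proof (cases rule: cap_cases[OF assms(1), of \<rho> \<omega>])
    case 1 then show ?thesis using assms(2) by (metis less_imp_le order_trans)
  next
    case (2 r) then show ?thesis using assms(2) by simp
  qed
  then show ?thesis using cap_bounds(1)[OF assms(1), of \<rho> \<omega>] by (intro cap_eq) auto
qed

lemma cap_mono:
  assumes "0 \<le> s" "s \<le> t"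
  shows "cap \<rho> s \<omega> \<le> cap \<rho> t \<omega>" "cap \<rho> t \<omega> - cap \<rho> s \<omega> \<le> t - s"
proof -
  have t: "0 \<le> t" using assms by simp
  have "cap \<rho> s \<omega> \<le> cap \<rho> t \<omega> \<and> cap \<rho> t \<omega> - cap \<rho> s \<omega> \<le> t - s"
    by (cases rule: cap_cases[OF assms(1), of \<rho> \<omega>]; cases rule: cap_cases[OF t, of \<rho> \<omega>])
      (use assms in \<open>auto simp: ennreal_less_iff\<close>)
  then show "cap \<rho> s \<omega> \<le> cap \<rho> t \<omega>" "cap \<rho> t \<omega> - cap \<rho> s \<omega> \<le> t - s" by auto
qed

lemma continuous_on_cap: "continuous_on {0..} (\<lambda>t. cap \<rho> t \<omega>)"
proof (rule continuous_on_eq)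
  show "continuous_on {0..} (\<lambda>t. if \<rho> \<omega> = \<infinity> then t else min t (enn2real (\<rho> \<omega>)))"
    by (cases "\<rho> \<omega> = \<infinity>") (auto intro!: continuous_intros)
  fix t :: real assume "t \<in> {0..}"
  then have t: "0 \<le> t" by simp
  show "(if \<rho> \<omega> = \<infinity> then t else min t (enn2real (\<rho> \<omega>))) = cap \<rho> t \<omega>"
  proof (cases "\<rho> \<omega>")
    case (real r)
    then show ?thesis using t by (simp add: min_def)
  next
    case top
    then show ?thesis using t by simp
  qed
qed

lemma continuous_on_stopped:
  assumes "continuous_on {0..} (\<lambda>t. X t \<omega>)"
  shows "continuous_on {0..} (\<lambda>t. stopped X \<tau> t \<omega>)"
  unfolding stopped_def
  by (rule continuous_on_compose2[OF assms continuous_on_cap]) (auto intro!: enn2real_nonneg)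

text \<open>Discrete stopping: a condition that is never regained once lost holds on an initial
  segment of the indices, and the filtered sum telescopes to the value at the first failure. The
  index N is the same for all \<phi>, so several functions of one path can be stopped
  together.\<close>

lemma telescope_prefix:
  fixes G :: "nat \<Rightarrow> bool"
  assumes "\<And>i j. i \<le> j \<Longrightarrow> G j \<Longrightarrow> G i"
  shows "\<exists>N\<le>n. (\<forall>i<n. G i \<longleftrightarrow> i < N) \<and>
    (\<forall>\<phi> :: nat \<Rightarrow> real. (\<Sum>i<n. if G i then \<phi> (Suc i) - \<phi> i else 0) = \<phi> N - \<phi> 0)"
proof -
  have "\<exists>N\<le>n. (\<forall>i<n. G i \<longleftrightarrow> i < N)"
  proof (induction n)
    case 0 then show ?case by auto
  next
    case (Suc n)
    then obtain N where N: "N \<le> n" "\<forall>i<n. G i \<longleftrightarrow> i < N" by auto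
    show ?case
    proof (cases "G n")
      case True
      then have "\<forall>i<Suc n. G i" using assms[of _ n] by (auto simp: less_Suc_eq_le)
      then show ?thesis by auto
    next
      case False
      then have "\<forall>i<Suc n. G i \<longleftrightarrow> i < N" using N by (auto simp: less_Suc_eq)
      then show ?thesis using N(1) by (intro exI[of _ N]) auto
    qed
  qed
  then obtain N where N: "N \<le> n" "\<And>i. i < n \<Longrightarrow> G i \<longleftrightarrow> i < N" by auto
  have "(\<Sum>i<n. if G i then \<phi> (Suc i) - \<phi> i else 0) = \<phi> N - \<phi> 0" for \<phi> :: "nat \<Rightarrow> real"
  proof -
    have "(\<Sum>i<n. if G i then \<phi> (Suc i) - \<phi> i else 0) = (\<Sum>i<n. if i < N then \<phi> (Suc i) - \<phi> i else 0)"
      by (rule sum.cong) (use N in auto)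
    also have "\<dots> = (\<Sum>i<N. \<phi> (Suc i) - \<phi> i)"
      using N(1) by (subst sum.inter_restrict[symmetric, where A="{..<n}" and B="{..<N}", simplified])
        (auto intro!: sum.cong)
    also have "\<dots> = \<phi> N - \<phi> 0" by (rule sum_lessThan_telescope)
    finally show ?thesis .
  qed
  then show ?thesis using N by (intro exI[of _ N] conjI) auto
qed

text \<open>The distance from x to the interval [-c, c]. Uniform integrability is usually phrased
  with \<bar>x\<bar> cut down to \<bar>x\<bar> > c, but that function jumps at c and is not
  convex.\<close>

definition overshoot :: "real \<Rightarrow> real \<Rightarrow> real" where
  "overshoot c x = max (\<bar>x\<bar> - c) 0"

lemma borel_measurable_overshoot [measurable]: "overshoot c \<in> borel_measurable borel"
  unfolding overshoot_def by measurable

lemma tendsto_overshoot: "x \<longlonglongrightarrow> y \<Longrightarrow> (\<lambda>n. overshoot c (x n)) \<longlonglongrightarrow> overshoot c y"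
  unfolding overshoot_def by (intro tendsto_intros)

text \<open>The slope is bounded by 1 and depends on x alone, so along a martingale it is an
  admissible weight for the increment that follows x.\<close>

lemma overshoot_subgradient:
  "overshoot c y \<ge> overshoot c x + (if x > c then 1 else if x < - c then -1 else 0) * (y - x)"
  if "0 \<le> c"
  using that unfolding overshoot_def by (auto simp: max_def abs_if)

lemma (in finite_measure) integrable_overshoot:
  assumes "integrable M f" "0 \<le> c"
  shows "integrable M (\<lambda>x. overshoot c (f x))"
proof (rule Bochner_Integration.integrable_bound[OF assms(1)])
  have [measurable]: "f \<in> borel_measurable M" using assms by auto
  show "(\<lambda>x. overshoot c (f x)) \<in> borel_measurable M" by measurable
  show "AE x in M. norm (overshoot c (f x)) \<le> norm (f x)"
    using assms(2) by (auto simp: overshoot_def)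
qed

text \<open>Vitali's convergence theorem. Uniform integrability is expressed by overshoots because these are
  convex functions, whose expectations along a martingale are bounded by the terminal one.\<close>

lemma (in finite_measure) integral_tendsto_uniform_overshoot:
  fixes Z :: "nat \<Rightarrow> 'a \<Rightarrow> real"
  assumes Zn: "\<And>n. integrable M (Z n)"
    and lim: "\<And>x. x \<in> space M \<Longrightarrow> (\<lambda>n. Z n x) \<longlonglongrightarrow> Z' x"
    and e: "\<And>n c. 0 \<le> c \<Longrightarrow> (\<integral>x. overshoot c (Z n x) \<partial>M) \<le> e c"
    and e0: "(\<lambda>k. e (real k)) \<longlonglongrightarrow> 0"
    and g: "g \<in> borel_measurable M" "\<And>x. x \<in> space M \<Longrightarrow> \<bar>g x\<bar> \<le> B"
  shows "integrable M Z'" "(\<lambda>n. \<integral>x. g x * Z n x \<partial>M) \<longlonglongrightarrow> (\<integral>x. g x * Z' x \<partial>M)"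
proof -
  have [measurable]: "Z n \<in> borel_measurable M" for n using Zn by auto
  have Zm[measurable]: "Z' \<in> borel_measurable M"
    by (rule borel_measurable_LIMSEQ_real[where u=Z]) (use lim in auto)
  note [measurable] = g(1)
  have ov0: "0 \<le> overshoot c x" for c x by (simp add: overshoot_def)
  \<comment> \<open>Fatou's lemma hands the overshoot bounds on to the limit.\<close>
  have nn: "(\<integral>\<^sup>+x. ennreal (overshoot c (Z' x)) \<partial>M) \<le> ennreal (e c)" if c: "0 \<le> c" for c
  proof -
    have "(\<integral>\<^sup>+x. ennreal (overshoot c (Z' x)) \<partial>M)
        = (\<integral>\<^sup>+x. liminf (\<lambda>n. ennreal (overshoot c (Z n x))) \<partial>M)"
    proof (rule nn_integral_cong)
      fix x assume "x \<in> space M"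
      then have "(\<lambda>n. ennreal (overshoot c (Z n x))) \<longlonglongrightarrow> ennreal (overshoot c (Z' x))"
        by (intro tendsto_ennrealI tendsto_overshoot lim)
      then show "ennreal (overshoot c (Z' x)) = liminf (\<lambda>n. ennreal (overshoot c (Z n x)))"
        by (metis lim_imp_Liminf sequentially_bot)
    qed
    also have "\<dots> \<le> liminf (\<lambda>n. \<integral>\<^sup>+x. ennreal (overshoot c (Z n x)) \<partial>M)"
      by (rule nn_integral_liminf) measurable
    also have "\<dots> \<le> liminf (\<lambda>n::nat. ennreal (e c))"
    proof (rule Liminf_mono, rule always_eventually, rule allI)
      fix n
      have "(\<integral>\<^sup>+x. ennreal (overshoot c (Z n x)) \<partial>M) = ennreal (\<integral>x. overshoot c (Z n x) \<partial>M)"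
        by (rule nn_integral_eq_integral[OF integrable_overshoot[OF Zn c]]) (simp add: ov0)
      also have "\<dots> \<le> ennreal (e c)" using e[OF c] by (rule ennreal_leI)
      finally show "(\<integral>\<^sup>+x. ennreal (overshoot c (Z n x)) \<partial>M) \<le> ennreal (e c)" .
    qed
    also have "\<dots> = ennreal (e c)" by (simp add: Liminf_const)
    finally show ?thesis .
  qed
  \<comment> \<open>At level 0 the overshoot is the absolute value, so the bound with c = 0 is an L1
    bound.\<close>
  show int: "integrable M Z'"
  proof (rule integrableI_bounded)
    have "(\<integral>\<^sup>+x. ennreal (norm (Z' x)) \<partial>M) = (\<integral>\<^sup>+x. ennreal (overshoot 0 (Z' x)) \<partial>M)"
      by (simp add: overshoot_def)
    also have "\<dots> < \<infinity>" using nn[of 0] by (simp add: ennreal_less_top le_less_trans)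
    finally show "(\<integral>\<^sup>+x. ennreal (norm (Z' x)) \<partial>M) < \<infinity>" .
  qed measurable
  have e': "(\<integral>x. overshoot c (Z' x) \<partial>M) \<le> e c" if c: "0 \<le> c" for c
  proof -
    have "ennreal (\<integral>x. overshoot c (Z' x) \<partial>M) \<le> ennreal (e c)"
      using nn[OF c] nn_integral_eq_integral[OF integrable_overshoot[OF int c]] by (simp add: ov0)
    moreover have "0 \<le> e c"
      using order_trans[OF Bochner_Integration.integral_nonneg e[OF c, of 0]] by (simp add: ov0)
    ultimately show ?thesis by simp
  qed
  \<comment> \<open>Each function splits into its clipped part, to which dominated convergence
    applies, and a remainder whose modulus is exactly the overshoot.\<close>
  define clip where "clip c x = max (-c) (min c x)" for c x :: real
  have [measurable]: "clip c \<in> borel_measurable borel" for c unfolding clip_def by measurable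
  have clip: "\<bar>x - clip c x\<bar> = overshoot c x" if "0 \<le> c" for c x
    using that by (auto simp: clip_def overshoot_def max_def min_def abs_if)
  have clipb: "\<bar>clip c x\<bar> \<le> c" if "0 \<le> c" for c x
    using that by (auto simp: clip_def max_def min_def abs_if)
  have gi: "integrable M (\<lambda>x. g x * f x)" if "integrable M f" for f
  proof (rule Bochner_Integration.integrable_bound[of _ "\<lambda>x. B * f x"])
    have [measurable]: "f \<in> borel_measurable M" using that by auto
    show "(\<lambda>x. g x * f x) \<in> borel_measurable M" by measurable
    show "AE x in M. norm (g x * f x) \<le> norm (B * f x)"
    proof (rule AE_I2)
      fix x assume "x \<in> space M"
      then have "\<bar>g x\<bar> \<le> \<bar>B\<bar>" using g(2)[of x] by simp
      then show "norm (g x * f x) \<le> norm (B * f x)" by (simp add: abs_mult mult_right_mono)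
    qed
  qed (use that in auto)
  have iclip: "integrable M (\<lambda>x. clip c (f x))" if "0 \<le> c" "f \<in> borel_measurable M" for c f
    using that by (intro integrable_const_bound[where B=c]) (auto simp: clipb)
  have close: "\<bar>(\<integral>x. g x * f x \<partial>M) - (\<integral>x. g x * clip c (f x) \<partial>M)\<bar> \<le> \<bar>B\<bar> * (\<integral>x. overshoot c (f x) \<partial>M)"
    if f: "integrable M f" and c: "0 \<le> c" for f c
  proof -
    have [measurable]: "f \<in> borel_measurable M" using f by auto
    have "(\<integral>x. g x * f x \<partial>M) - (\<integral>x. g x * clip c (f x) \<partial>M) = (\<integral>x. g x * (f x - clip c (f x)) \<partial>M)"
      using gi[OF f] gi[OF iclip[OF c, of f]] by (simp add: right_diff_distrib)
    also have "\<bar>\<dots>\<bar> \<le> (\<integral>x. \<bar>B\<bar> * overshoot c (f x) \<partial>M)"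
    proof (rule integral_abs_bound[THEN order_trans], rule integral_mono')
      show "integrable M (\<lambda>x. \<bar>B\<bar> * overshoot c (f x))" using integrable_overshoot[OF f c] by simp
      fix x assume "x \<in> space M"
      then have "\<bar>g x\<bar> \<le> \<bar>B\<bar>" using g(2)[of x] by simp
      then show "\<bar>g x * (f x - clip c (f x))\<bar> \<le> \<bar>B\<bar> * overshoot c (f x)"
        using clip[OF c, of "f x"] by (simp add: abs_mult mult_right_mono)
      show "0 \<le> \<bar>B\<bar> * overshoot c (f x)" by (simp add: ov0)
    qed
    finally show ?thesis by simp
  qed
  show "(\<lambda>n. \<integral>x. g x * Z n x \<partial>M) \<longlonglongrightarrow> (\<integral>x. g x * Z' x \<partial>M)"
  proof (rule LIMSEQ_I)
    fix r :: real assume r: "r > 0"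
    have "(\<lambda>k. \<bar>B\<bar> * e (real k)) \<longlonglongrightarrow> \<bar>B\<bar> * 0" by (intro tendsto_intros e0)
    then have "eventually (\<lambda>k. \<bar>B\<bar> * e (real k) < r / 3) sequentially"
      using r by (intro order_tendstoD) auto
    then obtain k where k: "\<bar>B\<bar> * e (real k) < r / 3" by (auto simp: eventually_sequentially)
    let ?c = "real k"
    have "(\<lambda>n. \<integral>x. g x * clip ?c (Z n x) \<partial>M) \<longlonglongrightarrow> (\<integral>x. g x * clip ?c (Z' x) \<partial>M)"
    proof (rule integral_dominated_convergence[where w="\<lambda>_. \<bar>B\<bar> * ?c"])
      show "AE x in M. (\<lambda>n. g x * clip ?c (Z n x)) \<longlonglongrightarrow> g x * clip ?c (Z' x)"
        unfolding clip_def by (intro AE_I2 tendsto_intros lim)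
      show "AE x in M. norm (g x * clip ?c (Z n x)) \<le> \<bar>B\<bar> * ?c" for n
      proof (rule AE_I2)
        fix x assume "x \<in> space M"
        then have "\<bar>g x\<bar> \<le> \<bar>B\<bar>" using g(2)[of x] by simp
        then show "norm (g x * clip ?c (Z n x)) \<le> \<bar>B\<bar> * ?c"
          using clipb[of ?c "Z n x"] by (simp add: abs_mult mult_mono)
      qed
    qed auto
    from LIMSEQ_D[OF this, of "r/3"] r obtain n0 where n0: "\<And>n. n \<ge> n0 \<Longrightarrow>
      \<bar>(\<integral>x. g x * clip ?c (Z n x) \<partial>M) - (\<integral>x. g x * clip ?c (Z' x) \<partial>M)\<bar> < r/3" by auto
    have "\<bar>(\<integral>x. g x * Z n x \<partial>M) - (\<integral>x. g x * Z' x \<partial>M)\<bar> < r" if n: "n \<ge> n0" for n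
    proof -
      have "\<bar>B\<bar> * (\<integral>x. overshoot ?c (Z n x) \<partial>M) < r/3" "\<bar>B\<bar> * (\<integral>x. overshoot ?c (Z' x) \<partial>M) < r/3"
        using k mult_left_mono[OF e[of ?c n], of "\<bar>B\<bar>"] mult_left_mono[OF e'[of ?c], of "\<bar>B\<bar>"] by auto
      then show ?thesis
        using n0[OF n] close[OF Zn[of n] of_nat_0_le_iff[of k]] close[OF int of_nat_0_le_iff[of k]] by linarith
    qed
    then show "\<exists>no. \<forall>n\<ge>no. norm ((\<integral>x. g x * Z n x \<partial>M) - (\<integral>x. g x * Z' x \<partial>M)) < r" by auto
  qed
qed

section \<open>Optional stopping for continuous martingales\<close>

locale filtered_prob = prob_space Q for Q :: "'a measure" +
  fixes F :: "real \<Rightarrow> 'a measure"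
  assumes subalg: "0 \<le> t \<Longrightarrow> subalgebra Q (F t)"
    and sets_mono: "0 \<le> s \<Longrightarrow> s \<le> t \<Longrightarrow> sets (F s) \<subseteq> sets (F t)"
begin

lemma space_F: "0 \<le> t \<Longrightarrow> space (F t) = space Q"
  using subalg unfolding subalgebra_def by auto

lemma measurable_F_mono: "f \<in> measurable (F s) N \<Longrightarrow> 0 \<le> s \<Longrightarrow> s \<le> t \<Longrightarrow> f \<in> measurable (F t) N"
  by (rule measurable_from_subalg[of "F t" "F s"]) (auto simp: subalgebra_def space_F sets_mono)

lemma measurable_F_Q: "f \<in> measurable (F s) N \<Longrightarrow> 0 \<le> s \<Longrightarrow> f \<in> measurable Q N"
  by (rule measurable_from_subalg[OF subalg])

lemma stopping_time_less:
  assumes "ext_stopping_time F \<rho>" "0 \<le> s"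
  shows "Measurable.pred (F s) (\<lambda>\<omega>. ennreal s < \<rho> \<omega>)"
proof -
  have "Measurable.pred (F s) (\<lambda>\<omega>. \<not> \<rho> \<omega> \<le> ennreal s)"
    using assms unfolding ext_stopping_time_def by (intro pred_intros_logic) auto
  then show ?thesis by (simp add: not_le)
qed

lemma stopping_time_event:
  assumes "ext_stopping_time F \<tau>" "0 \<le> t"
  shows "{\<omega>\<in>space Q. \<tau> \<omega> \<le> ennreal t} \<in> sets Q"
proof -
  have "Measurable.pred (F t) (\<lambda>\<omega>. \<tau> \<omega> \<le> ennreal t)" using assms by (auto simp: ext_stopping_time_def)
  from measurable_F_Q[OF this assms(2)] show ?thesis by (simp add: pred_def)
qed

lemma stopping_time_measurable:
  assumes "ext_stopping_time F \<tau>"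
  shows "\<tau> \<in> borel_measurable Q"
proof (rule borel_measurableI_le)
  fix a show "{x \<in> space Q. \<tau> x \<le> a} \<in> sets Q"
    by (cases a) (use stopping_time_event[OF assms] in auto)
qed

lemma integrable_bounded_mult:
  fixes f g :: "'a \<Rightarrow> real"
  assumes "integrable Q f" "g \<in> borel_measurable Q" "\<And>\<omega>. \<omega> \<in> space Q \<Longrightarrow> \<bar>g \<omega>\<bar> \<le> B"
  shows "integrable Q (\<lambda>\<omega>. g \<omega> * f \<omega>)"
proof (rule Bochner_Integration.integrable_bound[of _ "\<lambda>x. B * f x"])
  show "AE x in Q. norm (g x * f x) \<le> norm (B * f x)"
  proof (rule AE_I2)
    fix x assume "x \<in> space Q"
    then have "\<bar>g x\<bar> \<le> \<bar>B\<bar>" using assms(3)[of x] by simp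
    then show "norm (g x * f x) \<le> norm (B * f x)" by (simp add: abs_mult mult_right_mono)
  qed
qed (use assms in auto)

lemma martingaleD:
  assumes "martingale Q F X" "0 \<le> t"
  shows "integrable Q (X t)" "X t \<in> borel_measurable (F t)" "X t \<in> borel_measurable Q"
  using assms unfolding martingale_def adapted_def by auto

text \<open>The weight g is pulled into the conditional expectation. The stopping argument uses the
  martingale property only in this form, as orthogonality of increments to bounded functions of the
  past.\<close>

lemma martingale_increment:
  assumes X: "martingale Q F X" and st: "0 \<le> s" "s \<le> t"
    and g: "g \<in> borel_measurable (F s)" "\<And>\<omega>. \<omega> \<in> space Q \<Longrightarrow> \<bar>g \<omega>\<bar> \<le> B"
  shows "integrable Q (\<lambda>\<omega>. g \<omega> * (X t \<omega> - X s \<omega>))" "(\<integral>\<omega>. g \<omega> * (X t \<omega> - X s \<omega>) \<partial>Q) = 0"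
proof -
  interpret S: finite_measure_subalgebra Q "F s"
    by unfold_locales (use subalg st in auto)
  have gQ[measurable]: "g \<in> borel_measurable Q" using measurable_F_Q[OF g(1) st(1)] .
  have t: "0 \<le> t" using st by simp
  note it = martingaleD[OF X t] and ms = martingaleD[OF X st(1)]
  note [measurable] = it(3) ms(3)
  have igt: "integrable Q (\<lambda>\<omega>. g \<omega> * X t \<omega>)" by (rule integrable_bounded_mult[OF it(1) gQ g(2)])
  have igs: "integrable Q (\<lambda>\<omega>. g \<omega> * X s \<omega>)" by (rule integrable_bounded_mult[OF ms(1) gQ g(2)])
  show "integrable Q (\<lambda>\<omega>. g \<omega> * (X t \<omega> - X s \<omega>))"
    using igt igs by (simp add: right_diff_distrib)
  have "AE \<omega> in Q. real_cond_exp Q (F s) (X t) \<omega> = X s \<omega>"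
    using X st unfolding martingale_def by auto
  then have "(\<integral>\<omega>. g \<omega> * real_cond_exp Q (F s) (X t) \<omega> \<partial>Q) = (\<integral>\<omega>. g \<omega> * X s \<omega> \<partial>Q)"
    by (intro integral_cong_AE) auto
  then have "(\<integral>\<omega>. g \<omega> * X t \<omega> \<partial>Q) = (\<integral>\<omega>. g \<omega> * X s \<omega> \<partial>Q)"
    using S.real_cond_exp_intg(2)[OF igt g(1) it(3)] by simp
  then show "(\<integral>\<omega>. g \<omega> * (X t \<omega> - X s \<omega>) \<partial>Q) = 0"
    using igt igs by (simp add: right_diff_distrib)
qed

text \<open>Conditional Jensen inequality by hand: the subgradient at X s, switched off outside R,
  is a bounded weight known at time s. Its product with the increment has mean zero and lies below
  the increment of the convex function.\<close>

lemma martingale_overshoot_increment: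
  assumes X: "martingale Q F X" and st: "0 \<le> s" "s \<le> t" and c: "0 \<le> c"
    and R: "Measurable.pred (F s) R"
  shows "0 \<le> (\<integral>\<omega>. (if R \<omega> then overshoot c (X t \<omega>) - overshoot c (X s \<omega>) else 0) \<partial>Q)"
proof -
  have t: "0 \<le> t" using st by simp
  note it = martingaleD[OF X t] and ms = martingaleD[OF X st(1)]
  note [measurable] = it(3) ms(3)
  define g where "g \<omega> = (if R \<omega> then if X s \<omega> > c then 1 else if X s \<omega> < - c then -1 else 0 else (0::real))" for \<omega>
  have [measurable]: "R \<in> measurable (F s) (count_space UNIV)" "X s \<in> borel_measurable (F s)"
    using R ms by auto
  have g: "g \<in> borel_measurable (F s)" unfolding g_def by measurable
  have RQ[measurable]: "Measurable.pred Q R" using measurable_F_Q[OF R st(1)] .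
  have gb: "\<bar>g \<omega>\<bar> \<le> 1" for \<omega> by (simp add: g_def)
  have "0 = (\<integral>\<omega>. g \<omega> * (X t \<omega> - X s \<omega>) \<partial>Q)" using martingale_increment(2)[OF X st g gb] by simp
  also have "\<dots> \<le> (\<integral>\<omega>. (if R \<omega> then overshoot c (X t \<omega>) - overshoot c (X s \<omega>) else 0) \<partial>Q)"
  proof (rule integral_mono[OF martingale_increment(1)[OF X st g gb]])
    have "integrable Q (\<lambda>\<omega>. (if R \<omega> then 1 else 0) * (overshoot c (X t \<omega>) - overshoot c (X s \<omega>)))"
      by (rule integrable_bounded_mult[where B=1])
        (auto intro!: Bochner_Integration.integrable_diff integrable_overshoot it ms c)
    then show "integrable Q (\<lambda>\<omega>. if R \<omega> then overshoot c (X t \<omega>) - overshoot c (X s \<omega>) else 0)"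
      by (rule Bochner_Integration.integrable_cong[OF refl, THEN iffD1, rotated]) auto
    show "g \<omega> * (X t \<omega> - X s \<omega>) \<le> (if R \<omega> then overshoot c (X t \<omega>) - overshoot c (X s \<omega>) else 0)" for \<omega>
      using overshoot_subgradient[OF c, of "X s \<omega>" "X t \<omega>"] by (auto simp: g_def c)
  qed
  finally show ?thesis .
qed

text \<open>Stopping is first done on a time grid, where it is a finite sum of weighted increments,
  and continuity moves the stopped grid time to the true one. The overshoots of the grid values are
  dominated in mean by those of X t, which allows Vitali's theorem. Only the event s < \<rho> is
  considered because on it X s is still unstopped and the increment has a weight known at time
  s.\<close>

theorem optional_stopping:
  assumes X: "martingale Q F X" and st: "0 \<le> s" "s \<le> t"
    and cont: "\<And>\<omega>. \<omega> \<in> space Q \<Longrightarrow> continuous_on {0..} (\<lambda>t. X t \<omega>)"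
    and \<rho>: "ext_stopping_time F \<rho>"
    and g: "g \<in> borel_measurable (F s)" "\<And>\<omega>. \<omega> \<in> space Q \<Longrightarrow> \<bar>g \<omega>\<bar> \<le> B"
  shows "integrable Q (\<lambda>\<omega>. if ennreal s < \<rho> \<omega> then X (cap \<rho> t \<omega>) \<omega> - X s \<omega> else 0)" (is "integrable Q ?D")
    and "(\<integral>\<omega>. g \<omega> * (if ennreal s < \<rho> \<omega> then X (cap \<rho> t \<omega>) \<omega> - X s \<omega> else 0) \<partial>Q) = 0"
proof -
  have t: "0 \<le> t" using st by simp
  define u where "u n i = s + (t - s) * real i / real (Suc n)" for n i
  have u0: "u n 0 = s" and uS: "u n (Suc n) = t" for n by (simp_all add: u_def)
  have u_mono: "u n i \<le> u n j" if "i \<le> j" for n i j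
    unfolding u_def using that st by (intro add_left_mono divide_right_mono mult_left_mono) auto
  have u_nn: "0 \<le> u n i" for n i using u_mono[of 0 i n] u0[of n] st by simp
  have u_step: "u n (Suc i) - u n i = (t - s) / real (Suc n)" for n i
    by (simp add: u_def field_simps del: of_nat_Suc) (simp add: algebra_simps)
  have u_le: "u n i \<le> t" if "i \<le> Suc n" for n i using u_mono[OF that, of n] uS by simp
  have less[measurable]: "Measurable.pred (F (u n i)) (\<lambda>\<omega>. ennreal (u n i) < \<rho> \<omega>)" for n i
    by (rule stopping_time_less[OF \<rho> u_nn])
  have lessQ[measurable]: "Measurable.pred Q (\<lambda>\<omega>. ennreal (u n i) < \<rho> \<omega>)" for n i
    using measurable_F_Q[OF less u_nn] .
  have XQ[measurable]: "X (u n i) \<in> borel_measurable Q" for n i using martingaleD(3)[OF X u_nn] .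
  have Xi: "integrable Q (X (u n i))" for n i using martingaleD(1)[OF X u_nn] .
  \<comment> \<open>Z n is X at the first grid point not before \<rho>, or at t if there is
    none.\<close>
  define Z where "Z n \<omega> = X s \<omega> + (\<Sum>i<Suc n. if ennreal (u n i) < \<rho> \<omega> then X (u n (Suc i)) \<omega> - X (u n i) \<omega> else 0)" for n \<omega>
  define Z' where "Z' \<omega> = (if ennreal s < \<rho> \<omega> then X (cap \<rho> t \<omega>) \<omega> else X s \<omega>)" for \<omega>
  have Zstop: "\<exists>N\<le>Suc n. (\<forall>i<Suc n. ennreal (u n i) < \<rho> \<omega> \<longleftrightarrow> i < N) \<and> Z n \<omega> = X (u n N) \<omega> \<and>
     (\<forall>c. (\<Sum>i<Suc n. if \<not> ennreal (u n i) < \<rho> \<omega> then overshoot c (X (u n (Suc i)) \<omega>) - overshoot c (X (u n i) \<omega>) else 0)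
       = overshoot c (X t \<omega>) - overshoot c (Z n \<omega>))" for n \<omega>
  proof -
    have "ennreal (u n i) < \<rho> \<omega>" if "i \<le> j" "ennreal (u n j) < \<rho> \<omega>" for i j
      using ennreal_leI[OF u_mono[OF that(1)]] that(2) by (rule le_less_trans)
    then have "\<exists>N\<le>Suc n. (\<forall>i<Suc n. (ennreal (u n i) < \<rho> \<omega>) = (i < N)) \<and>
       (\<forall>\<phi> :: nat \<Rightarrow> real. (\<Sum>i<Suc n. if ennreal (u n i) < \<rho> \<omega> then \<phi> (Suc i) - \<phi> i else 0) = \<phi> N - \<phi> 0)"
      by (rule telescope_prefix)
    then obtain N where N: "N \<le> Suc n" "\<forall>i<Suc n. (ennreal (u n i) < \<rho> \<omega>) = (i < N)"
      and tel': "\<forall>\<phi> :: nat \<Rightarrow> real. (\<Sum>i<Suc n. if ennreal (u n i) < \<rho> \<omega> then \<phi> (Suc i) - \<phi> i else 0) = \<phi> N - \<phi> 0"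
      by (elim exE conjE) (rule that)
    note tel = tel'[rule_format]
    have Z: "Z n \<omega> = X (u n N) \<omega>" unfolding Z_def
      using tel[of "\<lambda>i. X (u n i) \<omega>"] by (simp add: u0 del: sum.lessThan_Suc)
    have "(\<Sum>i<Suc n. if \<not> ennreal (u n i) < \<rho> \<omega> then overshoot c (X (u n (Suc i)) \<omega>) - overshoot c (X (u n i) \<omega>) else 0)
       = overshoot c (X t \<omega>) - overshoot c (Z n \<omega>)" for c
    proof -
      let ?\<phi> = "\<lambda>i. overshoot c (X (u n i) \<omega>)"
      have "(\<Sum>i<Suc n. if \<not> ennreal (u n i) < \<rho> \<omega> then ?\<phi> (Suc i) - ?\<phi> i else 0)
        = (\<Sum>i<Suc n. (?\<phi> (Suc i) - ?\<phi> i) - (if ennreal (u n i) < \<rho> \<omega> then ?\<phi> (Suc i) - ?\<phi> i else 0))"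
        by (rule sum.cong) auto
      also have "\<dots> = (\<Sum>i<Suc n. ?\<phi> (Suc i) - ?\<phi> i) - (?\<phi> N - ?\<phi> 0)"
        unfolding sum_subtractf[of "\<lambda>i. ?\<phi> (Suc i) - ?\<phi> i"] tel[of ?\<phi>] ..
      also have "\<dots> = (?\<phi> (Suc n) - ?\<phi> 0) - (?\<phi> N - ?\<phi> 0)"
        unfolding sum_lessThan_telescope[of ?\<phi>] ..
      finally show ?thesis by (simp add: uS Z del: sum.lessThan_Suc)
    qed
    then show ?thesis using N Z by blast
  qed
  have Zint: "integrable Q (Z n)" for n
  proof -
    have "integrable Q (\<lambda>\<omega>. X s \<omega> + (\<Sum>i<Suc n. (if ennreal (u n i) < \<rho> \<omega> then 1 else 0) * (X (u n (Suc i)) \<omega> - X (u n i) \<omega>)))"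
      by (intro Bochner_Integration.integrable_add Bochner_Integration.integrable_sum integrable_bounded_mult[where B=1]
          martingaleD(1)[OF X] Bochner_Integration.integrable_diff Xi st) auto
    moreover have "Z n = (\<lambda>\<omega>. X s \<omega> + (\<Sum>i<Suc n. (if ennreal (u n i) < \<rho> \<omega> then 1 else 0) * (X (u n (Suc i)) \<omega> - X (u n i) \<omega>)))"
      unfolding Z_def by (intro ext arg_cong2[where f="(+)"] sum.cong) auto
    ultimately show ?thesis by simp
  qed
  have lim: "(\<lambda>n. Z n \<omega>) \<longlonglongrightarrow> Z' \<omega>" if w: "\<omega> \<in> space Q" for \<omega>
  proof -
    have "\<forall>n. \<exists>N\<le>Suc n. (\<forall>i<Suc n. ennreal (u n i) < \<rho> \<omega> \<longleftrightarrow> i < N) \<and> Z n \<omega> = X (u n N) \<omega>"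
      using Zstop[of _ \<omega>] by blast
    then obtain N where N: "\<And>n. N n \<le> Suc n" "\<And>n i. i < Suc n \<Longrightarrow> ennreal (u n i) < \<rho> \<omega> \<longleftrightarrow> i < N n"
      and Z: "\<And>n. Z n \<omega> = X (u n (N n)) \<omega>" by metis
    show ?thesis
    proof (cases "ennreal s < \<rho> \<omega>")
      case False
      then have "N n = 0" for n using N(2)[of 0 n] u0[of n] by simp
      then show ?thesis using False Z u0 by (simp add: Z'_def)
    next
      case True
      \<comment> \<open>With N n = m + 1, the grid point m lies before \<rho> and the next one does
        not, unless it is t itself; so the minimum of t and \<rho> lies in this cell of the
        grid.\<close>
      have close: "\<bar>u n (N n) - cap \<rho> t \<omega>\<bar> \<le> (t - s) / real (Suc n)" for n
      proof -
        have "N n \<noteq> 0" using True N(2)[of 0 n] u0[of n] by auto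
        then obtain m where m: "N n = Suc m" by (cases "N n") auto
        have "m < Suc n" using N(1)[of n] m by simp
        then have lm: "ennreal (u n m) < \<rho> \<omega>" using N(2)[of m n] m by simp
        have lo: "u n m \<le> cap \<rho> t \<omega>"
        proof (cases rule: cap_cases[OF t, of \<rho> \<omega>])
          case 1 then show ?thesis using u_le[of m n] \<open>m < Suc n\<close> by simp
        next
          case (2 r) then show ?thesis using lm u_nn[of n m] by (simp add: ennreal_less_iff)
        qed
        have hi: "cap \<rho> t \<omega> \<le> u n (N n)"
        proof (cases "N n = Suc n")
          case True then show ?thesis using uS[of n] cap_bounds(2)[OF t, of \<rho> \<omega>] by simp
        next
          case False
          then have "N n < Suc n" using N(1)[of n] by simp
          then have le: "\<rho> \<omega> \<le> ennreal (u n (N n))" using N(2)[of "N n" n] by (simp add: not_less)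
          show ?thesis
          proof (cases rule: cap_cases[OF t, of \<rho> \<omega>])
            case 1
            then have "ennreal t < ennreal (u n (N n))" using le by order
            then show ?thesis using u_le[OF N(1)[of n]] t by (simp add: ennreal_less_iff)
          next
            case (2 r) then show ?thesis using le u_nn[of n "N n"] by simp
          qed
        qed
        show ?thesis using lo hi u_step[of n m] m by simp
      qed
      have "(\<lambda>n. (t - s) / real (Suc n)) \<longlonglongrightarrow> 0"
        using tendsto_mult[OF tendsto_const[of "t - s"] LIMSEQ_inverse_real_of_nat] by (simp add: divide_inverse)
      then have "(\<lambda>n. u n (N n) - cap \<rho> t \<omega>) \<longlonglongrightarrow> 0"
        by (rule Lim_null_comparison[rotated]) (use close in \<open>auto intro!: always_eventually\<close>)
      then have "(\<lambda>n. u n (N n)) \<longlonglongrightarrow> cap \<rho> t \<omega>" by (simp add: LIM_zero_iff)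
      then have "(\<lambda>n. X (u n (N n)) \<omega>) \<longlonglongrightarrow> X (cap \<rho> t \<omega>) \<omega>"
        by (rule continuous_on_tendsto_compose[OF cont[OF w]])
          (use u_nn cap_bounds(1)[OF t] in \<open>auto intro!: always_eventually\<close>)
      then show ?thesis using True Z by (simp add: Z'_def)
    qed
  qed
  \<comment> \<open>The increments left out of Z n, those after stopping, telescope from the
    overshoot of Z n to that of X t, and each has nonnegative mean.\<close>
  have over: "(\<integral>\<omega>. overshoot c (Z n \<omega>) \<partial>Q) \<le> (\<integral>\<omega>. overshoot c (X t \<omega>) \<partial>Q)" if c: "0 \<le> c" for n c
  proof -
    let ?S = "\<lambda>i \<omega>. if \<not> ennreal (u n i) < \<rho> \<omega> then overshoot c (X (u n (Suc i)) \<omega>) - overshoot c (X (u n i) \<omega>) else 0"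
    have Si: "integrable Q (?S i)" for i
    proof -
      have "integrable Q (\<lambda>\<omega>. (if \<not> ennreal (u n i) < \<rho> \<omega> then 1 else 0) * (overshoot c (X (u n (Suc i)) \<omega>) - overshoot c (X (u n i) \<omega>)))"
        by (rule integrable_bounded_mult[where B=1])
          (auto intro!: Bochner_Integration.integrable_diff integrable_overshoot Xi c)
      then show ?thesis by (rule Bochner_Integration.integrable_cong[OF refl, THEN iffD1, rotated]) auto
    qed
    have "0 \<le> (\<Sum>i<Suc n. \<integral>\<omega>. ?S i \<omega> \<partial>Q)"
      by (intro sum_nonneg martingale_overshoot_increment[OF X u_nn u_mono c] pred_intros_logic less) auto
    also have "\<dots> = (\<integral>\<omega>. (\<Sum>i<Suc n. ?S i \<omega>) \<partial>Q)"
      by (rule Bochner_Integration.integral_sum[symmetric]) (rule Si)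
    also have "\<dots> = (\<integral>\<omega>. overshoot c (X t \<omega>) - overshoot c (Z n \<omega>) \<partial>Q)"
      using Zstop[of n] by (intro Bochner_Integration.integral_cong refl) blast
    also have "\<dots> = (\<integral>\<omega>. overshoot c (X t \<omega>) \<partial>Q) - (\<integral>\<omega>. overshoot c (Z n \<omega>) \<partial>Q)"
      by (intro Bochner_Integration.integral_diff integrable_overshoot Zint c martingaleD(1)[OF X t])
    finally show ?thesis by simp
  qed
  have e0: "(\<lambda>k. \<integral>\<omega>. overshoot (real k) (X t \<omega>) \<partial>Q) \<longlonglongrightarrow> 0"
  proof -
    have "(\<lambda>k. \<integral>\<omega>. overshoot (real k) (X t \<omega>) \<partial>Q) \<longlonglongrightarrow> (\<integral>\<omega>. 0 \<partial>Q)"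
    proof (rule integral_dominated_convergence[where w="\<lambda>\<omega>. \<bar>X t \<omega>\<bar>"])
      have [measurable]: "X t \<in> borel_measurable Q" using martingaleD(3)[OF X t] .
      show "(\<lambda>\<omega>. overshoot (real k) (X t \<omega>)) \<in> borel_measurable Q" for k by measurable
      show "integrable Q (\<lambda>\<omega>. \<bar>X t \<omega>\<bar>)" using martingaleD(1)[OF X t] by simp
      show "AE \<omega> in Q. (\<lambda>k. overshoot (real k) (X t \<omega>)) \<longlonglongrightarrow> 0"
      proof (rule AE_I2)
        fix \<omega>
        obtain m :: nat where m: "\<bar>X t \<omega>\<bar> \<le> real m" using real_arch_simple by blast
        have "eventually (\<lambda>k. overshoot (real k) (X t \<omega>) = 0) sequentially"
          using eventually_ge_at_top[of m]
        proof eventually_elim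
          case (elim k)
          then have "real m \<le> real k" by simp
          with m show ?case by (simp add: overshoot_def)
        qed
        then show "(\<lambda>k. overshoot (real k) (X t \<omega>)) \<longlonglongrightarrow> 0" by (rule tendsto_eventually)
      qed
      show "AE \<omega> in Q. norm (overshoot (real k) (X t \<omega>)) \<le> \<bar>X t \<omega>\<bar>" for k
        by (auto simp: overshoot_def)
    qed auto
    then show ?thesis by simp
  qed
  have gQ: "g \<in> borel_measurable Q" using measurable_F_Q[OF g(1) st(1)] .
  note V = integral_tendsto_uniform_overshoot[where Z=Z and Z'=Z', OF Zint lim over e0 gQ g(2)]
  have D: "?D = (\<lambda>\<omega>. Z' \<omega> - X s \<omega>)" by (auto simp: Z'_def)
  have Xs: "integrable Q (X s)" using martingaleD(1)[OF X st(1)] .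
  show "integrable Q ?D" unfolding D using V(1) Xs by simp
  have gZ: "(\<integral>\<omega>. g \<omega> * Z n \<omega> \<partial>Q) = (\<integral>\<omega>. g \<omega> * X s \<omega> \<partial>Q)" for n
  proof -
    \<comment> \<open>Whether \<rho> lies beyond a grid point is known at that point, so multiplying
      g by this event gives a legitimate weight for the next increment.\<close>
    let ?h = "\<lambda>i \<omega>. if ennreal (u n i) < \<rho> \<omega> then g \<omega> else 0"
    have gm: "g \<in> borel_measurable (F (u n i))" for i
      by (rule measurable_F_mono[OF g(1) st(1)]) (use u_mono[of 0 i n] u0[of n] in simp)
    have h: "?h i \<in> borel_measurable (F (u n i))" for i
      using gm less by (intro measurable_If) auto
    have hb: "\<omega> \<in> space Q \<Longrightarrow> \<bar>?h i \<omega>\<bar> \<le> max B 0" for i \<omega> using g(2)[of \<omega>] by auto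
    note inc = martingale_increment[OF X u_nn u_mono h hb]
    have "(\<integral>\<omega>. g \<omega> * Z n \<omega> \<partial>Q) = (\<integral>\<omega>. g \<omega> * X s \<omega> + (\<Sum>i<Suc n. ?h i \<omega> * (X (u n (Suc i)) \<omega> - X (u n i) \<omega>)) \<partial>Q)"
      unfolding Z_def distrib_left sum_distrib_left
      by (intro Bochner_Integration.integral_cong arg_cong2[where f="(+)"] sum.cong refl) auto
    also have "\<dots> = (\<integral>\<omega>. g \<omega> * X s \<omega> \<partial>Q) + (\<Sum>i<Suc n. \<integral>\<omega>. ?h i \<omega> * (X (u n (Suc i)) \<omega> - X (u n i) \<omega>) \<partial>Q)"
      by (subst Bochner_Integration.integral_add)
        (auto intro!: integrable_bounded_mult[OF Xs gQ g(2)] Bochner_Integration.integrable_sum inc(1)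
          simp del: sum.lessThan_Suc intro: Bochner_Integration.integral_sum)
    also have "(\<Sum>i<Suc n. \<integral>\<omega>. ?h i \<omega> * (X (u n (Suc i)) \<omega> - X (u n i) \<omega>) \<partial>Q) = 0"
      by (intro sum.neutral ballI inc(2)) auto
    finally show ?thesis by simp
  qed
  have "(\<integral>\<omega>. g \<omega> * X s \<omega> \<partial>Q) = (\<integral>\<omega>. g \<omega> * Z' \<omega> \<partial>Q)"
    using V(2) unfolding gZ by (rule LIMSEQ_unique[OF tendsto_const])
  moreover have "(\<integral>\<omega>. g \<omega> * ?D \<omega> \<partial>Q) = (\<integral>\<omega>. g \<omega> * Z' \<omega> - g \<omega> * X s \<omega> \<partial>Q)"
    by (intro Bochner_Integration.integral_cong refl) (auto simp: Z'_def right_diff_distrib)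
  moreover have "\<dots> = (\<integral>\<omega>. g \<omega> * Z' \<omega> \<partial>Q) - (\<integral>\<omega>. g \<omega> * X s \<omega> \<partial>Q)"
    by (intro Bochner_Integration.integral_diff integrable_bounded_mult[OF V(1) gQ g(2)] integrable_bounded_mult[OF Xs gQ g(2)])
  ultimately show "(\<integral>\<omega>. g \<omega> * ?D \<omega> \<partial>Q) = 0" by simp
qed

text \<open>On the event s < \<rho> \<le> \<tau>, neither s nor the minimum of t and \<rho> lies
  beyond \<tau>, so the stopped process may be replaced by X itself at both times.\<close>

lemma optional_stopping_stopped:
  assumes X: "martingale Q F (stopped X \<tau>)" and st: "0 \<le> s" "s \<le> t"
    and cont: "\<And>\<omega>. \<omega> \<in> space Q \<Longrightarrow> continuous_on {0..} (\<lambda>t. X t \<omega>)"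
    and \<rho>: "ext_stopping_time F \<rho>" "\<And>\<omega>. \<rho> \<omega> \<le> \<tau> \<omega>"
    and g: "g \<in> borel_measurable (F s)" "\<And>\<omega>. \<omega> \<in> space Q \<Longrightarrow> \<bar>g \<omega>\<bar> \<le> B"
  shows "integrable Q (\<lambda>\<omega>. if ennreal s < \<rho> \<omega> then X (cap \<rho> t \<omega>) \<omega> - X s \<omega> else 0)"
    and "(\<integral>\<omega>. g \<omega> * (if ennreal s < \<rho> \<omega> then X (cap \<rho> t \<omega>) \<omega> - X s \<omega> else 0) \<partial>Q) = 0"
proof -
  have eq: "(if ennreal s < \<rho> \<omega> then stopped X \<tau> (cap \<rho> t \<omega>) \<omega> - stopped X \<tau> s \<omega> else 0)
    = (if ennreal s < \<rho> \<omega> then X (cap \<rho> t \<omega>) \<omega> - X s \<omega> else 0)" for \<omega>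
  proof (cases "ennreal s < \<rho> \<omega>")
    case True
    then have "cap \<tau> s \<omega> = s" using \<rho>(2)[of \<omega>] st(1) by (intro cap_eq) auto
    moreover have "cap \<tau> (cap \<rho> t \<omega>) \<omega> = cap \<rho> t \<omega>" using st \<rho>(2) by (intro cap_cap) auto
    ultimately show ?thesis unfolding stopped_def by metis
  qed simp
  note O = optional_stopping[OF X st continuous_on_stopped[OF cont] \<rho>(1) g, unfolded eq]
  show "integrable Q (\<lambda>\<omega>. if ennreal s < \<rho> \<omega> then X (cap \<rho> t \<omega>) \<omega> - X s \<omega> else 0)"
    by (rule O(1))
  show "(\<integral>\<omega>. g \<omega> * (if ennreal s < \<rho> \<omega> then X (cap \<rho> t \<omega>) \<omega> - X s \<omega> else 0) \<partial>Q) = 0"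
    by (rule O(2))
qed

end

section \<open>A smoothed power function\<close>

text \<open>\<open>smooth_power \<gamma> h\<close> is the function with second derivative \<open>(y + h) powr (-2*\<gamma>)\<close> which vanishes
  at \<open>0\<close> together with its first derivative \<open>smooth_power' \<gamma> h\<close>.\<close>

definition smooth_power :: "real \<Rightarrow> real \<Rightarrow> real \<Rightarrow> real" where
  "smooth_power \<gamma> h y = ((y + h) powr (2 - 2*\<gamma>) - h powr (2 - 2*\<gamma>)) / ((1 - 2*\<gamma>) * (2 - 2*\<gamma>))
     - h powr (1 - 2*\<gamma>) * y / (1 - 2*\<gamma>)"

definition smooth_power' :: "real \<Rightarrow> real \<Rightarrow> real \<Rightarrow> real" where
  "smooth_power' \<gamma> h y = ((y + h) powr (1 - 2*\<gamma>) - h powr (1 - 2*\<gamma>)) / (1 - 2*\<gamma>)"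

lemma smooth_power_0 [simp]: "smooth_power \<gamma> h 0 = 0"
  by (simp add: smooth_power_def)

lemma smooth_power'_nonneg: "0 < h \<Longrightarrow> \<gamma> < 1/2 \<Longrightarrow> 0 \<le> y \<Longrightarrow> 0 \<le> smooth_power' \<gamma> h y"
  unfolding smooth_power'_def by (intro divide_nonneg_nonneg) (auto intro!: powr_mono2)

lemma smooth_power'_le:
  assumes "0 < h" "\<gamma> < 1/2" "0 \<le> y" "y \<le> K"
  shows "smooth_power' \<gamma> h y \<le> (K + h) powr (1 - 2*\<gamma>) / (1 - 2*\<gamma>)"
proof -
  have "(y + h) powr (1 - 2*\<gamma>) \<le> (K + h) powr (1 - 2*\<gamma>)" "0 \<le> h powr (1 - 2*\<gamma>)"
    using assms by (auto intro!: powr_mono2)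
  then have "(y + h) powr (1 - 2*\<gamma>) - h powr (1 - 2*\<gamma>) \<le> (K + h) powr (1 - 2*\<gamma>)" by linarith
  then show ?thesis unfolding smooth_power'_def using assms by (intro divide_right_mono) auto
qed

text \<open>The shift by h > 0 provides two-sided derivatives at 0 as well, as Taylor's theorem
  requires. Of the intermediate point only an upper bound matters, because the second derivative
  will be used as a decreasing function.\<close>

lemma smooth_power_Taylor:
  assumes h: "0 < h" and \<gamma>: "\<gamma> < 1/2" and a: "0 \<le> a" and b: "0 \<le> b"
  obtains \<xi> where "0 \<le> \<xi>" "\<xi> \<le> max a b"
    "smooth_power \<gamma> h b = smooth_power \<gamma> h a + smooth_power' \<gamma> h a * (b - a) + (\<xi> + h) powr (-2*\<gamma>) / 2 * (b - a)\<^sup>2"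
proof (cases "a = b")
  case True
  then show ?thesis using that[of a] a by simp
next
  case False
  define D where "D m = (if m = 0 then smooth_power \<gamma> h else if m = 1 then smooth_power' \<gamma> h
    else (\<lambda>y. (y + h) powr (-2*\<gamma>)))" for m :: nat
  have d0: "(smooth_power \<gamma> h has_real_derivative smooth_power' \<gamma> h t) (at t)" if "0 \<le> t" for t
  proof -
    have *: "((\<lambda>y. ((y + h) powr p - c) / (r * p) - d * y / r) has_real_derivative ((t + h) powr (p - 1) - d) / r) (at t)"
      if "p \<noteq> 0" "r \<noteq> 0" for p r c d
      using that h \<open>0 \<le> t\<close>
      by (auto intro!: derivative_eq_intros simp: diff_divide_distrib)
    have "((\<lambda>y. smooth_power \<gamma> h y) has_real_derivative smooth_power' \<gamma> h t) (at t)"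
      unfolding smooth_power_def smooth_power'_def
      using *[of "2 - 2*\<gamma>" "1 - 2*\<gamma>" "h powr (2 - 2*\<gamma>)" "h powr (1 - 2*\<gamma>)"] \<gamma> by (simp add: algebra_simps)
    then show ?thesis .
  qed
  have d1: "(smooth_power' \<gamma> h has_real_derivative (t + h) powr (-2*\<gamma>)) (at t)" if "0 \<le> t" for t
  proof -
    have *: "((\<lambda>y. ((y + h) powr r - c) / r) has_real_derivative (t + h) powr (r - 1)) (at t)"
      if "r \<noteq> 0" for r c
      using that h \<open>0 \<le> t\<close> by (auto intro!: derivative_eq_intros)
    have "((\<lambda>y. smooth_power' \<gamma> h y) has_real_derivative (t + h) powr (-2*\<gamma>)) (at t)"
      unfolding smooth_power'_def
      using *[of "1 - 2*\<gamma>" "h powr (1 - 2*\<gamma>)"] \<gamma> by simp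
    then show ?thesis .
  qed
  have D: "\<forall>m t. m < 2 \<and> 0 \<le> t \<and> t \<le> max a b \<longrightarrow> DERIV (D m) t :> D (Suc m) t"
    using d0 d1 by (auto simp: D_def less_2_cases_iff)
  have "\<exists>t. (if b < a then b < t \<and> t < a else a < t \<and> t < b) \<and>
     smooth_power \<gamma> h b = (\<Sum>m<2. (D m a / fact m) * (b - a)^m) + (D 2 t / fact 2) * (b - a)^2"
    by (rule Taylor[OF _ _ D]) (use a b False in \<open>auto simp: D_def\<close>)
  then obtain t where t: "if b < a then b < t \<and> t < a else a < t \<and> t < b"
    "smooth_power \<gamma> h b = (\<Sum>m<2. (D m a / fact m) * (b - a)^m) + (D 2 t / fact 2) * (b - a)^2"
    by blast
  have "smooth_power \<gamma> h b = smooth_power \<gamma> h a + smooth_power' \<gamma> h a * (b - a) + (t + h) powr (-2*\<gamma>) / 2 * (b - a)\<^sup>2"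
    using t(2) by (simp add: D_def numeral_2_eq_2)
  then show ?thesis using that[of t] t(1) a b by (auto split: if_splits)
qed

lemma smooth_power_convex:
  assumes "0 < h" "\<gamma> < 1/2" "0 \<le> a" "0 \<le> b"
  shows "smooth_power \<gamma> h a + smooth_power' \<gamma> h a * (b - a) \<le> smooth_power \<gamma> h b"
  using smooth_power_Taylor[OF assms] by (smt (verit) zero_le_mult_iff zero_le_power2 powr_ge_zero divide_nonneg_nonneg)

text \<open>The second derivative decreases and the intermediate point is at most a + h, whence the
  argument a + 2 h; downward steps may have any size. The curvature is evaluated at the starting
  point a because as a weight it must be known before the step is made.\<close>

lemma smooth_power_strictly_convex:
  assumes h: "0 < h" and \<gamma>: "0 < \<gamma>" "\<gamma> < 1/2" and a: "0 \<le> a" and b: "0 \<le> b" "b \<le> a + h"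
  shows "smooth_power \<gamma> h a + smooth_power' \<gamma> h a * (b - a) + (a + 2*h) powr (-2*\<gamma>) / 2 * (b - a)\<^sup>2 \<le> smooth_power \<gamma> h b"
proof -
  obtain \<xi> where x: "0 \<le> \<xi>" "\<xi> \<le> max a b"
    "smooth_power \<gamma> h b = smooth_power \<gamma> h a + smooth_power' \<gamma> h a * (b - a) + (\<xi> + h) powr (-2*\<gamma>) / 2 * (b - a)\<^sup>2"
    using smooth_power_Taylor[OF h \<gamma>(2) a b(1)] by blast
  have "(a + 2*h) powr (-2*\<gamma>) \<le> (\<xi> + h) powr (-2*\<gamma>)"
    using x(1,2) b h \<gamma> by (intro powr_mono2') auto
  then have "(a + 2*h) powr (-2*\<gamma>) / 2 * (b - a)\<^sup>2 \<le> (\<xi> + h) powr (-2*\<gamma>) / 2 * (b - a)\<^sup>2"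
    by (intro mult_right_mono) auto
  then show ?thesis using x(3) by simp
qed

text \<open>The tangent at y, evaluated at 0, lies below the value 0 there. This linear bound is
  what lets the mean of V, hence \<delta> t, control the mean of the smoothed power.\<close>

lemma smooth_power_le:
  assumes "0 < h" "\<gamma> < 1/2" "0 \<le> y" "y \<le> K"
  shows "smooth_power \<gamma> h y \<le> (K + h) powr (1 - 2*\<gamma>) / (1 - 2*\<gamma>) * y"
proof -
  have "smooth_power \<gamma> h y \<le> smooth_power' \<gamma> h y * y"
    using smooth_power_convex[OF assms(1-3), of 0] by simp
  also have "\<dots> \<le> (K + h) powr (1 - 2*\<gamma>) / (1 - 2*\<gamma>) * y"
    by (intro mult_right_mono smooth_power'_le assms)
  finally show ?thesis .
qed

text \<open>\<open>V\<close> and \<open>A\<close> play the roles of the coordinate process and of \<open>\<langle>M\<rangle>\<close>, modified on a null set so that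
  the pathwise properties hold everywhere; \<open>T\<close> is the hitting time of the level \<open>K\<close>.\<close>

locale degenerate_sde = filtered_prob Q F for Q :: "'a measure" and F +
  fixes V A :: "real \<Rightarrow> 'a \<Rightarrow> real" and \<tau>1 \<tau>2 T :: "'a \<Rightarrow> ennreal" and \<gamma> \<delta> K :: real
  assumes \<gamma>: "0 < \<gamma>" "\<gamma> < 1/2" and \<delta>: "0 < \<delta>" and K: "0 < K"
    and V_adapted: "0 \<le> t \<Longrightarrow> V t \<in> borel_measurable (F t)"
    and V_cont: "\<omega> \<in> space Q \<Longrightarrow> continuous_on {0..} (\<lambda>t. V t \<omega>)"
    and V_nonneg: "\<omega> \<in> space Q \<Longrightarrow> 0 \<le> t \<Longrightarrow> 0 \<le> V t \<omega>"
    and V_0: "\<omega> \<in> space Q \<Longrightarrow> V 0 \<omega> = 0"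
    and A_cont: "\<omega> \<in> space Q \<Longrightarrow> continuous_on {0..} (\<lambda>t. A t \<omega>)"
    and A_increment: "\<omega> \<in> space Q \<Longrightarrow> 0 \<le> s \<Longrightarrow> s \<le> t \<Longrightarrow>
      1/2 * (LINT u:{s..t}|lborel. V u \<omega> powr (2*\<gamma>)) \<le> A t \<omega> - A s \<omega>"
    and \<tau>1: "ext_stopping_time F \<tau>1" and \<tau>2: "ext_stopping_time F \<tau>2"
    and T: "ext_stopping_time F T"
    and T_iff: "\<omega> \<in> space Q \<Longrightarrow> 0 \<le> t \<Longrightarrow> T \<omega> \<le> ennreal t \<longleftrightarrow> (\<exists>s\<in>{0..t}. K \<le> V s \<omega>)"
    and mart_M: "martingale Q F (stopped (\<lambda>t \<omega>. V t \<omega> - \<delta> * t) \<tau>1)"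
    and mart_W: "martingale Q F (stopped (\<lambda>t \<omega>. (V t \<omega> - \<delta> * t)\<^sup>2 - A t \<omega>) \<tau>2)"
begin

text \<open>Up to this one time the path stays below K and both localizations are in force, so the
  increments of M and of M^2 - A can be stopped together.\<close>

definition \<rho> :: "'a \<Rightarrow> ennreal" where
  "\<rho> \<omega> = min (T \<omega>) (min (\<tau>1 \<omega>) (\<tau>2 \<omega>))"

lemma rho_stopping: "ext_stopping_time F \<rho>"
  using T \<tau>1 \<tau>2 unfolding ext_stopping_time_def \<rho>_def min_le_iff_disj
  by (intro allI impI pred_intros_logic) auto

text \<open>Strictly before the hitting time the path is below K, and at that time it is so by left
  limits. The time 0 has no left neighbourhood and uses the starting value.\<close>

lemma V_le_K:
  assumes w: "\<omega> \<in> space Q" and u: "0 \<le> u" "ennreal u \<le> \<rho> \<omega>"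
  shows "V u \<omega> \<le> K"
proof (cases "u = 0")
  case True then show ?thesis using V_0[OF w] K by simp
next
  case False
  have "V s \<omega> \<le> K" if s: "0 \<le> s" "s < u" for s
  proof -
    have "ennreal s < ennreal u" using s by (simp add: ennreal_less_iff)
    also have "\<dots> \<le> T \<omega>" using u(2) by (simp add: \<rho>_def)
    finally have "\<not> T \<omega> \<le> ennreal s" by simp
    then show ?thesis using T_iff[OF w s(1)] s(1) by force
  qed
  moreover have "((\<lambda>s. V s \<omega>) \<longlongrightarrow> V u \<omega>) (at_left u)"
    by (rule continuous_on_Icc_at_leftD[OF continuous_on_subset[OF V_cont[OF w]], of 0]) (use False u(1) in auto)
  moreover have "eventually (\<lambda>s. 0 \<le> s \<and> s < u) (at_left u)"
    using eventually_at_left_field[of _ u] False u(1) by (auto intro!: exI[of _ 0])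
  ultimately show ?thesis
    by (intro tendsto_upperbound[of "\<lambda>s. V s \<omega>" _ "at_left u"]) (auto elim: eventually_mono)
qed

section \<open>Increments stopped at the common time\<close>

abbreviation M :: "real \<Rightarrow> 'a \<Rightarrow> real" where "M t \<omega> \<equiv> V t \<omega> - \<delta> * t"

text \<open>The increment of the process stopped at \<rho>, as \<open>inc_cap\<close> confirms. In
  this form the event s < \<rho> is visible, which is what optional stopping delivers and what is
  known at time s.\<close>

definition inc :: "(real \<Rightarrow> 'a \<Rightarrow> real) \<Rightarrow> real \<Rightarrow> real \<Rightarrow> 'a \<Rightarrow> real" where
  "inc X s t \<omega> = (if ennreal s < \<rho> \<omega> then X (cap \<rho> t \<omega>) \<omega> - X s \<omega> else 0)"

lemma M_cont: "\<omega> \<in> space Q \<Longrightarrow> continuous_on {0..} (\<lambda>t. M t \<omega>)"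
  by (intro continuous_intros V_cont)

lemma cap_le_rho: "0 \<le> t \<Longrightarrow> ennreal (cap \<rho> t \<omega>) \<le> \<rho> \<omega>"
  by (cases rule: cap_cases[of t \<rho> \<omega>]) auto

lemma M_bound:
  assumes w: "\<omega> \<in> space Q" and u: "0 \<le> u" "u \<le> t" "ennreal u \<le> \<rho> \<omega>"
  shows "\<bar>M u \<omega>\<bar> \<le> K + \<delta> * t"
proof -
  have "0 \<le> \<delta> * u" "\<delta> * u \<le> \<delta> * t" using u \<delta> by auto
  then show ?thesis using V_nonneg[OF w u(1)] V_le_K[OF w u(1,3)] K by linarith
qed

lemma inc_M_bound:
  assumes w: "\<omega> \<in> space Q" and st: "0 \<le> s" "s \<le> t"
  shows "\<bar>inc M s t \<omega>\<bar> \<le> 2 * (K + \<delta> * t)"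
proof (cases "ennreal s < \<rho> \<omega>")
  case True
  have t: "0 \<le> t" using st by simp
  have "\<bar>M s \<omega>\<bar> \<le> K + \<delta> * t" by (rule M_bound[OF w st]) (use True in simp)
  moreover have "\<bar>M (cap \<rho> t \<omega>) \<omega>\<bar> \<le> K + \<delta> * t"
    by (rule M_bound[OF w cap_bounds(1)[OF t, of \<rho> \<omega>] cap_bounds(2)[OF t, of \<rho> \<omega>] cap_le_rho[OF t]])
  ultimately have "\<bar>M (cap \<rho> t \<omega>) \<omega> - M s \<omega>\<bar> \<le> (K + \<delta> * t) + (K + \<delta> * t)"
    by (rule order_trans[OF abs_triangle_ineq4 add_mono, rotated])
  then show ?thesis unfolding inc_def if_P[OF True] mult_2 .
next
  case False
  then show ?thesis using st \<delta> K by (simp add: inc_def)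
qed

lemma inc_M:
  assumes st: "0 \<le> s" "s \<le> t"
  shows "integrable Q (inc M s t)"
    and "g \<in> borel_measurable (F s) \<Longrightarrow> (\<And>\<omega>. \<omega> \<in> space Q \<Longrightarrow> \<bar>g \<omega>\<bar> \<le> B)
      \<Longrightarrow> (\<integral>\<omega>. g \<omega> * inc M s t \<omega> \<partial>Q) = 0"
  unfolding inc_def
proof -
  have r: "\<rho> \<omega> \<le> \<tau>1 \<omega>" for \<omega> by (auto simp: \<rho>_def min_le_iff_disj)
  note O = optional_stopping_stopped[OF mart_M st M_cont rho_stopping r]
  show "integrable Q (\<lambda>\<omega>. if ennreal s < \<rho> \<omega> then M (cap \<rho> t \<omega>) \<omega> - M s \<omega> else 0)"
    \<comment> \<open>Integrability does not involve a weight, but the rule carries the assumptions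
      on g; the zero weight discharges them.\<close>
    by (rule O(1)[of "\<lambda>_. 0" 0]) auto
  show "(\<integral>\<omega>. g \<omega> * (if ennreal s < \<rho> \<omega> then M (cap \<rho> t \<omega>) \<omega> - M s \<omega> else 0) \<partial>Q) = 0"
    if "g \<in> borel_measurable (F s)" "\<And>\<omega>. \<omega> \<in> space Q \<Longrightarrow> \<bar>g \<omega>\<bar> \<le> B"
    by (rule O(2)[of g B]) (use that in auto)
qed

lemma inc_M_sq_integrable:
  assumes st: "0 \<le> s" "s \<le> t"
  shows "integrable Q (\<lambda>\<omega>. (inc M s t \<omega>)\<^sup>2)"
proof (rule integrable_const_bound[where B="(2 * (K + \<delta> * t))\<^sup>2"])
  have [measurable]: "inc M s t \<in> borel_measurable Q" using inc_M(1)[OF st] by auto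
  show "(\<lambda>\<omega>. (inc M s t \<omega>)\<^sup>2) \<in> borel_measurable Q" by measurable
  show "AE \<omega> in Q. norm ((inc M s t \<omega>)\<^sup>2) \<le> (2 * (K + \<delta> * t))\<^sup>2"
    using power_mono[OF inc_M_bound[OF _ st] abs_ge_zero, of _ 2] by (intro AE_I2) simp
qed

text \<open>The conditional variance identity. On s < \<rho> the increment of A equals the squared
  increment of M, plus twice M s times the increment of M, minus the increment of M^2 - A; the last
  two terms have mean zero against past weights. The same identity makes the possibly unbounded
  increment of A integrable.\<close>

lemma inc_A:
  assumes st: "0 \<le> s" "s \<le> t"
  shows "integrable Q (inc A s t)"
    and "g \<in> borel_measurable (F s) \<Longrightarrow> (\<And>\<omega>. \<omega> \<in> space Q \<Longrightarrow> \<bar>g \<omega>\<bar> \<le> B)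
      \<Longrightarrow> (\<integral>\<omega>. g \<omega> * (inc M s t \<omega>)\<^sup>2 \<partial>Q) = (\<integral>\<omega>. g \<omega> * inc A s t \<omega> \<partial>Q)"
proof -
  let ?W = "\<lambda>t \<omega>. (M t \<omega>)\<^sup>2 - A t \<omega>"
  have r: "\<rho> \<omega> \<le> \<tau>2 \<omega>" for \<omega> by (auto simp: \<rho>_def min_le_iff_disj)
  have "\<omega> \<in> space Q \<Longrightarrow> continuous_on {0..} (\<lambda>t. ?W t \<omega>)" for \<omega>
    by (intro continuous_intros M_cont A_cont V_cont)
  note O = optional_stopping_stopped[OF mart_W st this rho_stopping r]
  have W: "integrable Q (inc ?W s t)" unfolding inc_def by (rule O(1)[of "\<lambda>_. 0" 0]) auto
  \<comment> \<open>M s is known to be bounded only before \<rho>; cutting it off elsewhere makes it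
    a bounded weight and leaves the product with \<open>inc M s t\<close> unchanged.\<close>
  define m where "m \<omega> = (if ennreal s < \<rho> \<omega> then M s \<omega> else 0)" for \<omega>
  have [measurable]: "V s \<in> borel_measurable (F s)" "Measurable.pred (F s) (\<lambda>\<omega>. ennreal s < \<rho> \<omega>)"
    using V_adapted st stopping_time_less[OF rho_stopping] by auto
  have m[measurable]: "m \<in> borel_measurable (F s)" unfolding m_def by measurable
  have mQ[measurable]: "m \<in> borel_measurable Q" using measurable_F_Q[OF m st(1)] .
  have mb: "\<bar>m \<omega>\<bar> \<le> K + \<delta> * t" if "\<omega> \<in> space Q" for \<omega>
    using M_bound[OF that st] K \<delta> st by (auto simp: m_def)
  have dec: "inc A s t \<omega> = (inc M s t \<omega>)\<^sup>2 + 2 * (m \<omega> * inc M s t \<omega>) - inc ?W s t \<omega>" for \<omega>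
    unfolding inc_def m_def by (simp add: power2_eq_square algebra_simps)
  have mi: "integrable Q (\<lambda>\<omega>. m \<omega> * inc M s t \<omega>)"
    by (rule integrable_bounded_mult[OF inc_M(1)[OF st] mQ mb])
  have "integrable Q (\<lambda>\<omega>. (inc M s t \<omega>)\<^sup>2 + 2 * (m \<omega> * inc M s t \<omega>) - inc ?W s t \<omega>)"
    using mi inc_M_sq_integrable[OF st] W by auto
  then show Aint: "integrable Q (inc A s t)"
    by (rule Bochner_Integration.integrable_cong[OF refl, THEN iffD1, rotated]) (rule dec[symmetric])
  assume g: "g \<in> borel_measurable (F s)" "\<And>\<omega>. \<omega> \<in> space Q \<Longrightarrow> \<bar>g \<omega>\<bar> \<le> B"
  have gQ: "g \<in> borel_measurable Q" using measurable_F_Q[OF g(1) st(1)] .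
  have gm: "(\<integral>\<omega>. (g \<omega> * m \<omega>) * inc M s t \<omega> \<partial>Q) = 0"
  proof (rule inc_M(2)[OF st])
    show "(\<lambda>\<omega>. g \<omega> * m \<omega>) \<in> borel_measurable (F s)" using g(1) m by measurable
    show "\<bar>g \<omega> * m \<omega>\<bar> \<le> \<bar>B\<bar> * (K + \<delta> * t)" if "\<omega> \<in> space Q" for \<omega>
      using g(2)[OF that] mb[OF that] by (auto simp: abs_mult intro!: mult_mono)
  qed
  note ib = integrable_bounded_mult[OF _ gQ g(2)]
  have "(\<integral>\<omega>. g \<omega> * inc A s t \<omega> \<partial>Q)
      = (\<integral>\<omega>. g \<omega> * (inc M s t \<omega>)\<^sup>2 + 2 * (g \<omega> * (m \<omega> * inc M s t \<omega>)) - g \<omega> * inc ?W s t \<omega> \<partial>Q)"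
    unfolding dec by (intro Bochner_Integration.integral_cong refl) (simp add: algebra_simps)
  also have "\<dots> = (\<integral>\<omega>. g \<omega> * (inc M s t \<omega>)\<^sup>2 \<partial>Q) + 2 * (\<integral>\<omega>. g \<omega> * (m \<omega> * inc M s t \<omega>) \<partial>Q) - (\<integral>\<omega>. g \<omega> * inc ?W s t \<omega> \<partial>Q)"
    using ib[OF inc_M_sq_integrable[OF st]] ib[OF mi] ib[OF W] by simp
  also have "(\<integral>\<omega>. g \<omega> * (m \<omega> * inc M s t \<omega>) \<partial>Q) = 0" using gm by (simp add: mult.assoc)
  also have "(\<integral>\<omega>. g \<omega> * inc ?W s t \<omega> \<partial>Q) = 0" unfolding inc_def by (rule O(2)[OF _ g])
  finally show "(\<integral>\<omega>. g \<omega> * (inc M s t \<omega>)\<^sup>2 \<partial>Q) = (\<integral>\<omega>. g \<omega> * inc A s t \<omega> \<partial>Q)" by simp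
qed

section \<open>Taylor expansion along a grid\<close>


definition grid :: "real \<Rightarrow> nat \<Rightarrow> nat \<Rightarrow> real" where
  "grid t n i = t * real i / real (Suc n)"

lemma grid_0 [simp]: "grid t n 0 = 0" and grid_Suc_n [simp]: "grid t n (Suc n) = t"
  by (simp_all add: grid_def)

lemma grid_mono: "0 \<le> t \<Longrightarrow> i \<le> j \<Longrightarrow> grid t n i \<le> grid t n j"
  unfolding grid_def by (intro divide_right_mono mult_left_mono) auto

lemma grid_nonneg: "0 \<le> t \<Longrightarrow> 0 \<le> grid t n i"
  by (simp add: grid_def)

lemma grid_step: "grid t n (Suc i) - grid t n i = t / real (Suc n)"
  by (simp add: grid_def field_simps del: of_nat_Suc) (simp add: algebra_simps)

lemma grid_le: "0 \<le> t \<Longrightarrow> i \<le> Suc n \<Longrightarrow> grid t n i \<le> t"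
  using grid_mono[of t i "Suc n" n] by simp

text \<open>Stopping the sum over the grid at the first increment exceeding \<open>h\<close> leaves at most one such
  increment, so the quadratic lower bound for \<open>smooth_power\<close> is lost at most once.\<close>

definition calm :: "real \<Rightarrow> real \<Rightarrow> nat \<Rightarrow> nat \<Rightarrow> 'a \<Rightarrow> bool" where
  "calm h t n i \<omega> \<longleftrightarrow> ennreal (grid t n i) < \<rho> \<omega> \<and>
     (\<forall>j<i. \<bar>V (grid t n (Suc j)) \<omega> - V (grid t n j) \<omega>\<bar> \<le> h)"

text \<open>The event on which a step too large for the quadratic lower bound occurs. It disappears
  path by path as the mesh shrinks.\<close>

definition jump :: "real \<Rightarrow> real \<Rightarrow> nat \<Rightarrow> 'a \<Rightarrow> bool" where
  "jump h t n \<omega> \<longleftrightarrow> (\<exists>i<Suc n. calm h t n i \<omega> \<and> h < \<bar>inc V (grid t n i) (grid t n (Suc i)) \<omega>\<bar>)"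

lemma calm_antimono:
  assumes "0 \<le> t" "i \<le> j" "calm h t n j \<omega>"
  shows "calm h t n i \<omega>"
  using assms le_less_trans[OF ennreal_leI[OF grid_mono[OF assms(1,2), of n]]]
  by (auto simp: calm_def)

text \<open>The condition looks only at steps completed by grid point i. The step from i to i + 1
  may itself be large, which is why one such step has to be tolerated.\<close>

lemma calm_measurable:
  assumes t: "0 \<le> t"
  shows "Measurable.pred (F (grid t n i)) (calm h t n i)"
proof -
  have V: "V (grid t n j) \<in> borel_measurable (F (grid t n i))" if "j \<le> i" for j
    by (rule measurable_F_mono[OF V_adapted]) (use grid_mono[OF t that] grid_nonneg[OF t] in auto)
  have "Measurable.pred (F (grid t n i)) (\<lambda>\<omega>. \<bar>V (grid t n (Suc j)) \<omega> - V (grid t n j) \<omega>\<bar> \<le> h)" if "j < i" for j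
  proof -
    have [measurable]: "V (grid t n (Suc j)) \<in> borel_measurable (F (grid t n i))"
      "V (grid t n j) \<in> borel_measurable (F (grid t n i))"
      using that by (auto intro!: V)
    show ?thesis by measurable
  qed
  then have [measurable]: "Measurable.pred (F (grid t n i)) (\<lambda>\<omega>. \<forall>j\<in>{..<i}. \<bar>V (grid t n (Suc j)) \<omega> - V (grid t n j) \<omega>\<bar> \<le> h)"
    by (intro pred_intros_finite) auto
  have [measurable]: "Measurable.pred (F (grid t n i)) (\<lambda>\<omega>. ennreal (grid t n i) < \<rho> \<omega>)"
    by (rule stopping_time_less[OF rho_stopping grid_nonneg[OF t]])
  have "calm h t n i = (\<lambda>\<omega>. ennreal (grid t n i) < \<rho> \<omega> \<and> (\<forall>j\<in>{..<i}. \<bar>V (grid t n (Suc j)) \<omega> - V (grid t n j) \<omega>\<bar> \<le> h))"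
    by (auto simp: calm_def)
  then show ?thesis by simp
qed

lemma inc_cap:
  assumes "0 \<le> s" "s \<le> t"
  shows "inc X s t \<omega> = X (cap \<rho> t \<omega>) \<omega> - X (cap \<rho> s \<omega>) \<omega>"
proof (cases "ennreal s < \<rho> \<omega>")
  case True
  then have "cap \<rho> s \<omega> = s" using assms by (intro cap_eq) auto
  then show ?thesis using True unfolding inc_def by simp
next
  case False
  then have "\<rho> \<omega> \<le> ennreal s" "\<rho> \<omega> \<le> ennreal t"
    using order_trans[OF _ ennreal_leI[OF assms(2)]] by auto
  then have "cap \<rho> t \<omega> = cap \<rho> s \<omega>" by (simp add: min_absorb2)
  then show ?thesis using False unfolding inc_def by simp
qed

lemma inc_V:
  assumes "0 \<le> s" "s \<le> t"
  shows "inc V s t \<omega> = inc M s t \<omega> + \<delta> * (cap \<rho> t \<omega> - cap \<rho> s \<omega>)"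
  using inc_cap[OF assms, of V \<omega>] inc_cap[OF assms, of M \<omega>] by (simp add: algebra_simps)

lemma inc_V_measurable: "0 \<le> s \<Longrightarrow> s \<le> t \<Longrightarrow> inc V s t \<in> borel_measurable Q"
proof -
  assume st: "0 \<le> s" "s \<le> t"
  note [measurable] = stopping_time_measurable[OF rho_stopping]
  have [measurable]: "inc M s t \<in> borel_measurable Q" using inc_M(1)[OF st] by auto
  show "inc V s t \<in> borel_measurable Q"
    using inc_V[OF st] by (subst measurable_cong[where g="\<lambda>\<omega>. inc M s t \<omega> + \<delta> * (cap \<rho> t \<omega> - cap \<rho> s \<omega>)"]) auto
qed

text \<open>Taylor's expansion rewritten in terms of M, so that expectations can be taken. In the
  first-order term the drift only helps, since the derivative is nonnegative. In the second-order
  term it costs the factor 1 - h and an error of the order of the squared time step. After a large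
  step only convexity is available, and the missing quadratic term is bounded through K.\<close>

lemma smooth_power_step:
  assumes w: "\<omega> \<in> space Q" and st: "0 \<le> s" "s \<le> t" and r: "ennreal s < \<rho> \<omega>"
    and h: "0 < h" "h < 1" and d: "t - s \<le> d"
  shows "smooth_power \<gamma> h (V (cap \<rho> t \<omega>) \<omega>) - smooth_power \<gamma> h (V s \<omega>) \<ge>
    smooth_power' \<gamma> h (V s \<omega>) * inc M s t \<omega>
    + (1 - h) / 2 * ((V s \<omega> + 2*h) powr (-2*\<gamma>) * (inc M s t \<omega>)\<^sup>2)
    - (2*h) powr (-2*\<gamma>) * \<delta>\<^sup>2 * d\<^sup>2 / (2 * h)
    - (2*h) powr (-2*\<gamma>) * K\<^sup>2 / 2 * of_bool (h < \<bar>inc V s t \<omega>\<bar>)"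
proof -
  let ?a = "V s \<omega>" and ?b = "V (cap \<rho> t \<omega>) \<omega>" and ?x = "inc M s t \<omega>"
  define e where "e = cap \<rho> t \<omega> - cap \<rho> s \<omega>"
  define c where "c = (?a + 2*h) powr (-2*\<gamma>)"
  define C where "C = (2*h) powr (-2*\<gamma>)"
  have t: "0 \<le> t" using st by simp
  have e: "0 \<le> e" "e \<le> d" using cap_mono[OF st, of \<rho> \<omega>] d by (auto simp: e_def)
  have ab: "0 \<le> ?a" "0 \<le> ?b" using V_nonneg[OF w] st cap_bounds(1)[OF t] by auto
  have aK: "?a \<le> K" by (rule V_le_K[OF w st(1)]) (use r in simp)
  have bK: "?b \<le> K" by (rule V_le_K[OF w cap_bounds(1)[OF t, of \<rho> \<omega>] cap_le_rho[OF t]])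
  have V: "inc V s t \<omega> = ?b - ?a" using r by (simp add: inc_def)
  then have ba: "?b - ?a = ?x + \<delta> * e" using inc_V[OF st, of \<omega>] by (simp add: e_def)
  have c: "0 \<le> c" "c \<le> C" unfolding c_def C_def using h ab \<gamma> by (auto intro!: powr_mono2')
  have f1: "0 \<le> smooth_power' \<gamma> h ?a" by (rule smooth_power'_nonneg) (use h \<gamma> ab in auto)
  have f1x: "smooth_power' \<gamma> h ?a * ?x \<le> smooth_power' \<gamma> h ?a * (?b - ?a)"
    using f1 e \<delta> unfolding ba by (intro mult_left_mono) auto
  \<comment> \<open>AM-GM for the cross term between martingale increment and drift\<close>
  have sq: "(1 - h) * ?x\<^sup>2 \<le> (?b - ?a)\<^sup>2 + (\<delta> * e)\<^sup>2 / h"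
  proof -
    have "0 \<le> (h * ?x + \<delta> * e)\<^sup>2 / h" using h by simp
    also have "\<dots> = h * ?x\<^sup>2 + 2 * ?x * (\<delta> * e) + (\<delta> * e)\<^sup>2 / h"
      using h by (simp add: power2_eq_square field_simps)
    finally show ?thesis unfolding ba by (simp add: power2_sum algebra_simps add_increasing2)
  qed
  have "(\<delta> * e)\<^sup>2 / h \<le> (\<delta> * d)\<^sup>2 / h"
    using e \<delta> h by (intro divide_right_mono power_mono mult_left_mono) auto
  then have sq': "(1 - h) * ?x\<^sup>2 \<le> (?b - ?a)\<^sup>2 + (\<delta> * d)\<^sup>2 / h" using sq by linarith
  have "c / 2 * ((1 - h) * ?x\<^sup>2) \<le> c / 2 * ((?b - ?a)\<^sup>2 + (\<delta> * d)\<^sup>2 / h)"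
    using sq' c(1) by (intro mult_left_mono) auto
  also have "\<dots> \<le> c / 2 * (?b - ?a)\<^sup>2 + C / 2 * ((\<delta> * d)\<^sup>2 / h)"
    using c h unfolding distrib_left by (intro add_left_mono mult_right_mono) auto
  finally have main: "(1 - h) / 2 * (c * ?x\<^sup>2) - C * \<delta>\<^sup>2 * d\<^sup>2 / (2 * h) \<le> c / 2 * (?b - ?a)\<^sup>2"
    by (simp add: power_mult_distrib field_simps)
  show ?thesis
  proof (cases "h < \<bar>inc V s t \<omega>\<bar>")
    case False
    then have "?b \<le> ?a + h" using V by auto
    then have "smooth_power \<gamma> h ?a + smooth_power' \<gamma> h ?a * (?b - ?a) + c / 2 * (?b - ?a)\<^sup>2 \<le> smooth_power \<gamma> h ?b"
      unfolding c_def by (intro smooth_power_strictly_convex h \<gamma> ab)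
    then show ?thesis using main f1x False unfolding c_def C_def by simp
  next
    case True
    have "smooth_power \<gamma> h ?a + smooth_power' \<gamma> h ?a * (?b - ?a) \<le> smooth_power \<gamma> h ?b"
      by (intro smooth_power_convex h \<gamma> ab)
    moreover have "\<bar>?b - ?a\<bar> \<le> K" using ab aK bK by auto
    then have "(?b - ?a)\<^sup>2 \<le> K\<^sup>2" using K by (metis abs_le_square_iff abs_of_pos)
    then have "c / 2 * (?b - ?a)\<^sup>2 \<le> C / 2 * K\<^sup>2" using c by (intro mult_mono) auto
    ultimately show ?thesis using main f1x True unfolding c_def C_def by simp
  qed
qed

text \<open>A Riemann-Stieltjes sum, over the calm steps, for the integral against dA of (V + 2h) to
  the power -2 \<gamma> up to \<rho>: the smoothed counterpart of the second-order term in Ito's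
  formula.\<close>

definition energy :: "real \<Rightarrow> real \<Rightarrow> nat \<Rightarrow> 'a \<Rightarrow> real" where
  "energy h t n \<omega> = (\<Sum>i<Suc n. (if calm h t n i \<omega> then (V (grid t n i) \<omega> + 2*h) powr (-2*\<gamma>) else 0)
     * inc A (grid t n i) (grid t n (Suc i)) \<omega>)"

text \<open>A large step excludes calmness at every later index: if the next index were calm, \<rho>
  would lie beyond it, so the stopped step would be a full step, which calmness bounds by h.\<close>

lemma jump_count:
  assumes t: "0 \<le> t"
  shows "(\<Sum>i<Suc n. if calm h t n i \<omega> then of_bool (h < \<bar>inc V (grid t n i) (grid t n (Suc i)) \<omega>\<bar>) else 0)
    \<le> (of_bool (jump h t n \<omega>) :: real)"
proof (cases "jump h t n \<omega>")
  case False
  then show ?thesis unfolding jump_def by (intro order_trans[OF sum_nonpos]) auto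
next
  case True
  have uniq: "i = j" if "calm h t n i \<omega>" "h < \<bar>inc V (grid t n i) (grid t n (Suc i)) \<omega>\<bar>"
    "calm h t n j \<omega>" "h < \<bar>inc V (grid t n j) (grid t n (Suc j)) \<omega>\<bar>" for i j
  proof -
    have False if ij: "i < j" "calm h t n j \<omega>" "calm h t n i \<omega>" "h < \<bar>inc V (grid t n i) (grid t n (Suc i)) \<omega>\<bar>" for i j
    proof -
      have "calm h t n (Suc i) \<omega>" using calm_antimono[OF t _ ij(2)] ij(1) by simp
      then have "\<bar>V (grid t n (Suc i)) \<omega> - V (grid t n i) \<omega>\<bar> \<le> h" "cap \<rho> (grid t n (Suc i)) \<omega> = grid t n (Suc i)"
        using cap_eq[OF grid_nonneg[OF t], of n "Suc i" \<rho> \<omega>] unfolding calm_def by auto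
      then show False using ij(3,4) unfolding inc_def calm_def by simp
    qed
    then show ?thesis using that by (metis linorder_neqE_nat)
  qed
  obtain i where i: "i < Suc n" "calm h t n i \<omega>" "h < \<bar>inc V (grid t n i) (grid t n (Suc i)) \<omega>\<bar>"
    using True unfolding jump_def by blast
  have "(\<Sum>j<Suc n. if calm h t n j \<omega> then of_bool (h < \<bar>inc V (grid t n j) (grid t n (Suc j)) \<omega>\<bar>) else 0)
     = (\<Sum>j<Suc n. if j = i then 1 else (0::real))"
    by (rule sum.cong) (use uniq i in auto)
  also have "\<dots> = 1" using i(1) by (simp del: sum.lessThan_Suc)
  finally show ?thesis using True by simp
qed

text \<open>The telescoped left side ends in a value of the smoothed power, at most L times the
  stopped path, and the path is at most its martingale increments plus \<delta> t. Moving the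
  martingale part across gives the weight derivative minus L, so that all linear terms form one sum
  of mean zero.\<close>

lemma smooth_power_sum:
  assumes w: "\<omega> \<in> space Q" and t: "0 < t" and h: "0 < h" "h < 1"
  defines "L \<equiv> (K + h) powr (1 - 2*\<gamma>) / (1 - 2*\<gamma>)"
    and "C \<equiv> (2*h) powr (-2*\<gamma>)"
  shows "(1 - h) / 2 * (\<Sum>i<Suc n. (if calm h t n i \<omega> then (V (grid t n i) \<omega> + 2*h) powr (-2*\<gamma>) else 0)
           * (inc M (grid t n i) (grid t n (Suc i)) \<omega>)\<^sup>2)
      + (\<Sum>i<Suc n. (if calm h t n i \<omega> then smooth_power' \<gamma> h (V (grid t n i) \<omega>) - L else 0) * inc M (grid t n i) (grid t n (Suc i)) \<omega>)
    \<le> L * \<delta> * t + C * \<delta>\<^sup>2 * t\<^sup>2 / (2 * h * real (Suc n)) + C * K\<^sup>2 / 2 * of_bool (jump h t n \<omega>)"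
proof -
  have t0: "0 \<le> t" using t by simp
  define u where "u = grid t n"
  define G where "G i \<longleftrightarrow> calm h t n i \<omega>" for i
  define v where "v i = V (cap \<rho> (u i) \<omega>) \<omega>" for i
  have un: "0 \<le> u i" "u i \<le> u (Suc i)" for i using grid_nonneg[OF t0] grid_mono[OF t0, of i "Suc i"] by (auto simp: u_def)
  have Gr: "ennreal (u i) < \<rho> \<omega>" if "G i" for i using that by (simp add: G_def calm_def u_def)
  have v: "v i = V (u i) \<omega>" if "G i" for i
    using cap_eq[OF un(1), of i \<rho> \<omega>] Gr[OF that] by (simp add: v_def)
  have "\<And>i j. i \<le> j \<Longrightarrow> G j \<Longrightarrow> G i" using calm_antimono[OF t0] by (auto simp: G_def)
  then have "\<exists>N\<le>Suc n. (\<forall>i<Suc n. G i \<longleftrightarrow> i < N) \<and>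
     (\<forall>\<phi> :: nat \<Rightarrow> real. (\<Sum>i<Suc n. if G i then \<phi> (Suc i) - \<phi> i else 0) = \<phi> N - \<phi> 0)"
    by (rule telescope_prefix)
  then obtain N where N: "N \<le> Suc n"
    and tel': "\<forall>\<phi> :: nat \<Rightarrow> real. (\<Sum>i<Suc n. if G i then \<phi> (Suc i) - \<phi> i else 0) = \<phi> N - \<phi> 0"
    by (elim exE conjE) (rule that)
  note tel = tel'[rule_format]
  have v0: "v 0 = 0" using V_0[OF w] by (simp add: v_def u_def)
  have vb: "0 \<le> v i" "v i \<le> K" for i
    unfolding v_def
    by (rule V_nonneg[OF w cap_bounds(1)[OF un(1)[of i], of \<rho> \<omega>]],
      rule V_le_K[OF w cap_bounds(1)[OF un(1)[of i], of \<rho> \<omega>] cap_le_rho[OF un(1)[of i]]])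
  have L: "0 \<le> L" unfolding L_def using \<gamma> by simp
  have "v N = (\<Sum>i<Suc n. if G i then v (Suc i) - v i else 0)" using tel[of v] v0 by (simp del: sum.lessThan_Suc)
  also have "\<dots> \<le> (\<Sum>i<Suc n. if G i then inc M (u i) (u (Suc i)) \<omega> else 0) + (\<Sum>i<Suc n. \<delta> * (u (Suc i) - u i))"
  proof (subst sum.distrib[symmetric], rule sum_mono)
    fix i
    have "v (Suc i) - v i = inc M (u i) (u (Suc i)) \<omega> + \<delta> * (cap \<rho> (u (Suc i)) \<omega> - cap \<rho> (u i) \<omega>)"
      using inc_V[OF un, of i \<omega>] inc_cap[OF un, of V i \<omega>] by (simp add: v_def)
    moreover have "\<delta> * (cap \<rho> (u (Suc i)) \<omega> - cap \<rho> (u i) \<omega>) \<le> \<delta> * (u (Suc i) - u i)"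
      using cap_mono(2)[OF un, of i \<rho> \<omega>] \<delta> by (intro mult_left_mono) auto
    moreover have "0 \<le> \<delta> * (u (Suc i) - u i)" using un \<delta> by simp
    ultimately show "(if G i then v (Suc i) - v i else 0) \<le> (if G i then inc M (u i) (u (Suc i)) \<omega> else 0) + \<delta> * (u (Suc i) - u i)"
      by (cases "G i") simp_all
  qed
  also have "(\<Sum>i<Suc n. \<delta> * (u (Suc i) - u i)) = \<delta> * t"
    unfolding sum_distrib_left[symmetric] sum_lessThan_telescope[of u] by (simp add: u_def)
  finally have vN: "v N \<le> (\<Sum>i<Suc n. if G i then inc M (u i) (u (Suc i)) \<omega> else 0) + \<delta> * t" .
  have "(\<Sum>i<Suc n. if G i then smooth_power \<gamma> h (v (Suc i)) - smooth_power \<gamma> h (v i) else 0) = smooth_power \<gamma> h (v N)"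
    using tel[of "\<lambda>i. smooth_power \<gamma> h (v i)"] v0 by (simp del: sum.lessThan_Suc)
  also have "\<dots> \<le> L * v N" unfolding L_def by (intro smooth_power_le h \<gamma> vb)
  also have "\<dots> \<le> L * ((\<Sum>i<Suc n. if G i then inc M (u i) (u (Suc i)) \<omega> else 0) + \<delta> * t)"
    by (rule mult_left_mono[OF vN L])
  finally have upper: "(\<Sum>i<Suc n. if G i then smooth_power \<gamma> h (v (Suc i)) - smooth_power \<gamma> h (v i) else 0)
      \<le> L * ((\<Sum>i<Suc n. if G i then inc M (u i) (u (Suc i)) \<omega> else 0) + \<delta> * t)" .
  let ?x = "\<lambda>i. inc M (u i) (u (Suc i)) \<omega>"
  let ?d = "t / real (Suc n)"
  let ?c = "\<lambda>i. (V (u i) \<omega> + 2*h) powr (-2*\<gamma>)"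
  let ?j = "\<lambda>i. of_bool (h < \<bar>inc V (u i) (u (Suc i)) \<omega>\<bar>) :: real"
  have C0: "0 \<le> C" by (simp add: C_def)
  have "(\<Sum>i<Suc n. (if G i then smooth_power' \<gamma> h (V (u i) \<omega>) * ?x i else 0)
       + (1 - h) / 2 * ((if G i then ?c i else 0) * (?x i)\<^sup>2)
       - C * \<delta>\<^sup>2 * ?d\<^sup>2 / (2 * h) - C * K\<^sup>2 / 2 * (if G i then ?j i else 0))
    \<le> (\<Sum>i<Suc n. if G i then smooth_power \<gamma> h (v (Suc i)) - smooth_power \<gamma> h (v i) else 0)"
  proof (rule sum_mono)
    fix i
    show "(if G i then smooth_power' \<gamma> h (V (u i) \<omega>) * ?x i else 0)
       + (1 - h) / 2 * ((if G i then ?c i else 0) * (?x i)\<^sup>2)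
       - C * \<delta>\<^sup>2 * ?d\<^sup>2 / (2 * h) - C * K\<^sup>2 / 2 * (if G i then ?j i else 0)
      \<le> (if G i then smooth_power \<gamma> h (v (Suc i)) - smooth_power \<gamma> h (v i) else 0)"
    proof (cases "G i")
      case True
      have "u (Suc i) - u i \<le> ?d" using grid_step[of t n i] by (simp add: u_def)
      from smooth_power_step[OF w un Gr[OF True] h this] show ?thesis
        using True v[OF True] unfolding C_def by (simp add: v_def)
    next
      case False
      \<comment> \<open>The drift error is charged to the steps that are not calm too, which makes
        its total a deterministic quantity.\<close>
      have "0 \<le> C * \<delta>\<^sup>2 * ?d\<^sup>2 / (2 * h)" using C0 h by simp
      then show ?thesis using False by simp
    qed
  qed
  note le = order_trans[OF this upper]
  have "(\<Sum>i<Suc n. C * \<delta>\<^sup>2 * ?d\<^sup>2 / (2 * h)) = C * \<delta>\<^sup>2 * t\<^sup>2 / (2 * h * real (Suc n))"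
    using h by (simp add: power_divide power2_eq_square mult.commute mult.left_commute del: of_nat_Suc)
  moreover have "C * K\<^sup>2 / 2 * (\<Sum>i<Suc n. if G i then ?j i else 0) \<le> C * K\<^sup>2 / 2 * of_bool (jump h t n \<omega>)"
    using jump_count[OF t0, of h n \<omega>] C0 unfolding G_def u_def by (intro mult_left_mono) auto
  moreover have "(\<Sum>i<Suc n. (if G i then smooth_power' \<gamma> h (V (u i) \<omega>) - L else 0) * ?x i)
     = (\<Sum>i<Suc n. if G i then smooth_power' \<gamma> h (V (u i) \<omega>) * ?x i else 0) - L * (\<Sum>i<Suc n. if G i then ?x i else 0)"
    unfolding sum_distrib_left sum_subtractf[symmetric] by (rule sum.cong) (auto simp: left_diff_distrib)
  ultimately show ?thesis
    using le unfolding sum.distrib sum_subtractf sum_distrib_left[symmetric] distrib_left G_def u_def by (simp only: mult.assoc)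
qed

end

section \<open>Passage to the limit in the mesh\<close>

lemma set_integrable_continuous:
  fixes f :: "real \<Rightarrow> real"
  assumes "continuous_on {0..} f" "0 \<le> a"
  shows "set_integrable lborel {a..b} f"
  using continuous_on_subset[OF assms(1), of "{a..b}"] assms(2) by (intro borel_integrable_atLeastAtMost') auto

lemma set_integral_combine:
  fixes f :: "real \<Rightarrow> real"
  assumes f: "continuous_on {0..} f" and ab: "0 \<le> a" "a \<le> b" "b \<le> c"
  shows "(LINT s:{a..b}|lborel. f s) + (LINT s:{b..c}|lborel. f s) = (LINT s:{a..c}|lborel. f s)"
proof -
  have eq: "(LINT s:{x..y}|lborel. f s) = integral {x..y} f" if "0 \<le> x" for x y
    using set_borel_integral_eq_integral(2)[OF set_integrable_continuous[OF f that]] .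
  have "f integrable_on {a..c}"
    using set_borel_integral_eq_integral(1)[OF set_integrable_continuous[OF f ab(1)]] .
  then show ?thesis using Henstock_Kurzweil_Integration.integral_combine[OF ab(2,3)] ab by (simp add: eq)
qed

context degenerate_sde begin

lemma path_powr_cont:
  "\<omega> \<in> space Q \<Longrightarrow> continuous_on {0..} (\<lambda>u. V u \<omega> powr (2*\<gamma>))"
  by (intro continuous_on_powr' V_cont continuous_intros) (use V_nonneg \<gamma> in auto)

lemma A_mono:
  assumes "\<omega> \<in> space Q" "0 \<le> s" "s \<le> t"
  shows "A s \<omega> \<le> A t \<omega>"
proof -
  have "0 \<le> (LINT u:{s..t}|lborel. V u \<omega> powr (2*\<gamma>))"
    unfolding set_lebesgue_integral_def by (rule Bochner_Integration.integral_nonneg) auto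
  then show ?thesis using A_increment[OF assms] by simp
qed

lemma energy_nonneg:
  assumes "\<omega> \<in> space Q" "0 \<le> t"
  shows "0 \<le> energy h t n \<omega>"
  unfolding energy_def
proof (intro sum_nonneg mult_nonneg_nonneg)
  fix i
  have un: "0 \<le> grid t n i" "grid t n i \<le> grid t n (Suc i)"
    using grid_nonneg grid_mono assms by auto
  show "0 \<le> inc A (grid t n i) (grid t n (Suc i)) \<omega>"
    unfolding inc_cap[OF un]
    using A_mono[OF assms(1) cap_bounds(1)[OF un(1), of \<rho> \<omega>] cap_mono(1)[OF un, of \<rho> \<omega>]] by simp
qed auto

lemma jump_measurable:
  assumes t: "0 \<le> t"
  shows "Measurable.pred Q (jump h t n)"
proof -
  have "Measurable.pred Q (\<lambda>\<omega>. \<exists>i\<in>{..<Suc n}. calm h t n i \<omega> \<and> h < \<bar>inc V (grid t n i) (grid t n (Suc i)) \<omega>\<bar>)"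
  proof (intro pred_intros_finite)
    fix i
    have [measurable]: "Measurable.pred Q (calm h t n i)"
      using measurable_F_Q[OF calm_measurable[OF t] grid_nonneg[OF t]] .
    have [measurable]: "inc V (grid t n i) (grid t n (Suc i)) \<in> borel_measurable Q"
      by (rule inc_V_measurable) (use grid_nonneg[OF t] grid_mono[OF t] in auto)
    show "Measurable.pred Q (\<lambda>\<omega>. calm h t n i \<omega> \<and> h < \<bar>inc V (grid t n i) (grid t n (Suc i)) \<omega>\<bar>)"
      by measurable
  qed auto
  moreover have "jump h t n = (\<lambda>\<omega>. \<exists>i\<in>{..<Suc n}. calm h t n i \<omega> \<and> h < \<bar>inc V (grid t n i) (grid t n (Suc i)) \<omega>\<bar>)"
    by (rule ext) (simp only: jump_def Bex_def lessThan_iff)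
  ultimately show ?thesis by simp
qed

text \<open>In expectation the linear sum vanishes, its weights being known at the left grid points
  and bounded by L (the derivative lies between 0 and L), and squared increments of M turn into
  increments of A by \<open>inc_A\<close>.\<close>

lemma energy_bound:
  assumes t: "0 < t" and h: "0 < h" "h < 1"
  defines "L \<equiv> (K + h) powr (1 - 2*\<gamma>) / (1 - 2*\<gamma>)"
    and "C \<equiv> (2*h) powr (-2*\<gamma>)"
  shows "integrable Q (energy h t n)"
    and "(1 - h) / 2 * (\<integral>\<omega>. energy h t n \<omega> \<partial>Q) \<le>
      L * \<delta> * t + C * \<delta>\<^sup>2 * t\<^sup>2 / (2 * h * real (Suc n)) + C * K\<^sup>2 / 2 * (\<integral>\<omega>. of_bool (jump h t n \<omega>) \<partial>Q)"
proof -
  have t0: "0 \<le> t" using t by simp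
  have un: "0 \<le> grid t n i" "grid t n i \<le> grid t n (Suc i)" for i
    using grid_nonneg grid_mono t0 by auto
  define g where "g i \<omega> = (if calm h t n i \<omega> then (V (grid t n i) \<omega> + 2*h) powr (-2*\<gamma>) else 0)" for i \<omega>
  define g' where "g' i \<omega> = (if calm h t n i \<omega> then smooth_power' \<gamma> h (V (grid t n i) \<omega>) - L else 0)" for i \<omega>
  let ?M = "\<lambda>i. inc M (grid t n i) (grid t n (Suc i))"
  let ?A = "\<lambda>i. inc A (grid t n i) (grid t n (Suc i))"
  have [measurable]: "V (grid t n i) \<in> borel_measurable (F (grid t n i))" for i by (rule V_adapted[OF un(1)])
  note [measurable] = calm_measurable[OF t0]
  have gm: "g i \<in> borel_measurable (F (grid t n i))" for i unfolding g_def by measurable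
  have g'm: "g' i \<in> borel_measurable (F (grid t n i))" for i unfolding g'_def smooth_power'_def by measurable
  have gb: "\<bar>g i \<omega>\<bar> \<le> C" if "\<omega> \<in> space Q" for i \<omega>
  proof -
    have "(V (grid t n i) \<omega> + 2*h) powr (-2*\<gamma>) \<le> C"
      unfolding C_def using V_nonneg[OF that un(1)] h \<gamma> by (intro powr_mono2') auto
    then show ?thesis by (auto simp: g_def C_def)
  qed
  have g'b: "\<bar>g' i \<omega>\<bar> \<le> L" if w: "\<omega> \<in> space Q" for i \<omega>
  proof (cases "calm h t n i \<omega>")
    case True
    have v: "0 \<le> V (grid t n i) \<omega>" "V (grid t n i) \<omega> \<le> K"
      using V_nonneg[OF w un(1)] V_le_K[OF w un(1)] True by (auto simp: calm_def)
    have "0 \<le> smooth_power' \<gamma> h (V (grid t n i) \<omega>)" "smooth_power' \<gamma> h (V (grid t n i) \<omega>) \<le> L"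
      unfolding L_def using h \<gamma> v by (auto intro!: smooth_power'_nonneg smooth_power'_le)
    then show ?thesis using True by (simp add: g'_def)
  next
    case False
    then show ?thesis using \<gamma> by (simp add: g'_def L_def)
  qed
  have gQ: "g i \<in> borel_measurable Q" "g' i \<in> borel_measurable Q" for i
    using measurable_F_Q[OF gm un(1)] measurable_F_Q[OF g'm un(1)] by auto
  have iA: "integrable Q (\<lambda>\<omega>. g i \<omega> * ?A i \<omega>)" for i
    by (rule integrable_bounded_mult[OF inc_A(1)[OF un] gQ(1) gb])
  have iM2: "integrable Q (\<lambda>\<omega>. g i \<omega> * (?M i \<omega>)\<^sup>2)" for i
    by (rule integrable_bounded_mult[OF inc_M_sq_integrable[OF un] gQ(1) gb])
  have iM: "integrable Q (\<lambda>\<omega>. g' i \<omega> * ?M i \<omega>)" for i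
    by (rule integrable_bounded_mult[OF inc_M(1)[OF un] gQ(2) g'b])
  have en: "energy h t n = (\<lambda>\<omega>. \<Sum>i<Suc n. g i \<omega> * ?A i \<omega>)"
    unfolding energy_def g_def ..
  show "integrable Q (energy h t n)" unfolding en by (intro Bochner_Integration.integrable_sum iA)
  note [measurable] = jump_measurable[OF t0]
  have ij: "integrable Q (\<lambda>\<omega>. of_bool (jump h t n \<omega>) :: real)"
    by (rule integrable_const_bound[where B=1]) auto
  have "(\<integral>\<omega>. (1 - h) / 2 * (\<Sum>i<Suc n. g i \<omega> * (?M i \<omega>)\<^sup>2) + (\<Sum>i<Suc n. g' i \<omega> * ?M i \<omega>) \<partial>Q)
    \<le> (\<integral>\<omega>. L * \<delta> * t + C * \<delta>\<^sup>2 * t\<^sup>2 / (2 * h * real (Suc n)) + C * K\<^sup>2 / 2 * of_bool (jump h t n \<omega>) \<partial>Q)"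
  proof (rule integral_mono)
    show "integrable Q (\<lambda>\<omega>. (1 - h) / 2 * (\<Sum>i<Suc n. g i \<omega> * (?M i \<omega>)\<^sup>2) + (\<Sum>i<Suc n. g' i \<omega> * ?M i \<omega>))"
      by (intro Bochner_Integration.integrable_add integrable_mult_right Bochner_Integration.integrable_sum iM iM2)
    show "integrable Q (\<lambda>\<omega>. L * \<delta> * t + C * \<delta>\<^sup>2 * t\<^sup>2 / (2 * h * real (Suc n)) + C * K\<^sup>2 / 2 * of_bool (jump h t n \<omega>))"
      using ij by (intro Bochner_Integration.integrable_add integrable_mult_right) auto
    show "(1 - h) / 2 * (\<Sum>i<Suc n. g i \<omega> * (?M i \<omega>)\<^sup>2) + (\<Sum>i<Suc n. g' i \<omega> * ?M i \<omega>)
      \<le> L * \<delta> * t + C * \<delta>\<^sup>2 * t\<^sup>2 / (2 * h * real (Suc n)) + C * K\<^sup>2 / 2 * of_bool (jump h t n \<omega>)"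
      if "\<omega> \<in> space Q" for \<omega>
      using smooth_power_sum[OF that t h, of n] unfolding g_def g'_def L_def C_def .
  qed
  also have "(\<integral>\<omega>. (1 - h) / 2 * (\<Sum>i<Suc n. g i \<omega> * (?M i \<omega>)\<^sup>2) + (\<Sum>i<Suc n. g' i \<omega> * ?M i \<omega>) \<partial>Q)
     = (1 - h) / 2 * (\<Sum>i<Suc n. \<integral>\<omega>. g i \<omega> * (?M i \<omega>)\<^sup>2 \<partial>Q) + (\<Sum>i<Suc n. \<integral>\<omega>. g' i \<omega> * ?M i \<omega> \<partial>Q)"
    using iM iM2
    by (simp only: Bochner_Integration.integral_add integrable_mult_right Bochner_Integration.integrable_sum
      Bochner_Integration.integral_sum integral_mult_right_zero)
  also have "(\<Sum>i<Suc n. \<integral>\<omega>. g' i \<omega> * ?M i \<omega> \<partial>Q) = 0"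
    by (intro sum.neutral ballI inc_M(2)[OF un g'm g'b])
  also have "(\<Sum>i<Suc n. \<integral>\<omega>. g i \<omega> * (?M i \<omega>)\<^sup>2 \<partial>Q) = (\<Sum>i<Suc n. \<integral>\<omega>. g i \<omega> * ?A i \<omega> \<partial>Q)"
    by (intro sum.cong refl inc_A(2)[OF un gm gb])
  also have "\<dots> = (\<integral>\<omega>. energy h t n \<omega> \<partial>Q)"
    unfolding en by (rule Bochner_Integration.integral_sum[symmetric]) (rule iA)
  also have "(\<integral>\<omega>. L * \<delta> * t + C * \<delta>\<^sup>2 * t\<^sup>2 / (2 * h * real (Suc n)) + C * K\<^sup>2 / 2 * of_bool (jump h t n \<omega>) \<partial>Q)
     = L * \<delta> * t + C * \<delta>\<^sup>2 * t\<^sup>2 / (2 * h * real (Suc n)) + C * K\<^sup>2 / 2 * (\<integral>\<omega>. of_bool (jump h t n \<omega>) \<partial>Q)"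
    using ij by (simp add: prob_space)
  finally show "(1 - h) / 2 * (\<integral>\<omega>. energy h t n \<omega> \<partial>Q) \<le>
      L * \<delta> * t + C * \<delta>\<^sup>2 * t\<^sup>2 / (2 * h * real (Suc n)) + C * K\<^sup>2 / 2 * (\<integral>\<omega>. of_bool (jump h t n \<omega>) \<partial>Q)"
    by simp
qed

section \<open>Behaviour of a fixed path on fine grids\<close>

lemma mesh_oscillation:
  assumes w: "\<omega> \<in> space Q" and t: "0 < t" and h: "0 < h"
  shows "\<exists>n0. \<forall>n\<ge>n0. \<forall>r\<in>{0..t}. \<forall>s\<in>{0..t}. \<bar>r - s\<bar> \<le> t / real (Suc n) \<longrightarrow> \<bar>V r \<omega> - V s \<omega>\<bar> \<le> h"
proof -
  have "uniformly_continuous_on {0..t} (\<lambda>s. V s \<omega>)"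
    by (intro compact_uniformly_continuous continuous_on_subset[OF V_cont[OF w]]) auto
  then obtain d where d: "d > 0" "\<And>r s. r \<in> {0..t} \<Longrightarrow> s \<in> {0..t} \<Longrightarrow> dist r s < d \<Longrightarrow> dist (V r \<omega>) (V s \<omega>) < h"
    using h unfolding uniformly_continuous_on_def by metis
  obtain n0 where n0: "t / d < real n0" using reals_Archimedean2 by blast
  have "t / real (Suc n) < d" if "n \<ge> n0" for n
  proof -
    have "t / d < real (Suc n)" using n0 that by simp
    then show ?thesis using d(1) by (simp add: field_simps del: of_nat_Suc)
  qed
  then have "\<bar>V r \<omega> - V s \<omega>\<bar> \<le> h"
    if "n \<ge> n0" "r \<in> {0..t}" "s \<in> {0..t}" "\<bar>r - s\<bar> \<le> t / real (Suc n)" for n r s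
    using d(2)[OF that(2,3)] le_less_trans[OF that(4)] that(1) unfolding dist_real_def by (meson less_imp_le)
  then show ?thesis by blast
qed

text \<open>Capping at \<rho> does not lengthen a time step, so uniform continuity on [0, t] also
  bounds the stopped increments. The threshold depends on the path; expectations follow by dominated
  convergence.\<close>

lemma eventually_not_jump:
  assumes w: "\<omega> \<in> space Q" and t: "0 < t" and h: "0 < h"
  shows "eventually (\<lambda>n. \<not> jump h t n \<omega>) sequentially"
proof -
  obtain n0 where n0: "\<And>n r s. n \<ge> n0 \<Longrightarrow> r \<in> {0..t} \<Longrightarrow> s \<in> {0..t} \<Longrightarrow> \<bar>r - s\<bar> \<le> t / real (Suc n) \<Longrightarrow> \<bar>V r \<omega> - V s \<omega>\<bar> \<le> h"
    using mesh_oscillation[OF w t h] by blast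
  have t0: "0 \<le> t" using t by simp
  have "\<not> jump h t n \<omega>" if n: "n \<ge> n0" for n
  proof -
    have "\<bar>inc V (grid t n i) (grid t n (Suc i)) \<omega>\<bar> \<le> h" if i: "i < Suc n" for i
    proof -
      have un: "0 \<le> grid t n i" "grid t n i \<le> grid t n (Suc i)" "0 \<le> grid t n (Suc i)" "grid t n (Suc i) \<le> t" "grid t n i \<le> t"
        using grid_nonneg[OF t0] grid_mono[OF t0] grid_le[OF t0] i by auto
      show ?thesis unfolding inc_cap[OF un(1,2)]
      proof (rule n0[OF n])
        show "cap \<rho> (grid t n (Suc i)) \<omega> \<in> {0..t}" "cap \<rho> (grid t n i) \<omega> \<in> {0..t}"
          using cap_bounds[OF un(1), of \<rho> \<omega>] cap_bounds[OF un(3), of \<rho> \<omega>] un by auto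
        show "\<bar>cap \<rho> (grid t n (Suc i)) \<omega> - cap \<rho> (grid t n i) \<omega>\<bar> \<le> t / real (Suc n)"
          using cap_mono[OF un(1,2), of \<rho> \<omega>] grid_step[of t n i] by auto
      qed
    qed
    then show ?thesis unfolding jump_def by (meson not_less)
  qed
  then show ?thesis by (auto simp: eventually_sequentially)
qed

text \<open>A lower bound for the energy density: within a fine cell the left endpoint value plus 2h
  is at most V s + 3h. As h decreases to 0 the weight increases to the indicator of v > 0.\<close>

definition weight :: "real \<Rightarrow> real \<Rightarrow> real" where
  "weight h v = (v + 3*h) powr (-2*\<gamma>) * v powr (2*\<gamma>)"

lemma weight_cont:
  assumes "\<omega> \<in> space Q" "0 < h"
  shows "continuous_on {0..} (\<lambda>s. weight h (V s \<omega>))"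
  unfolding weight_def
proof (intro continuous_on_mult path_powr_cont assms)
  have "V s \<omega> + 3*h \<noteq> 0" if "s \<in> {0..}" for s using V_nonneg[OF assms(1), of s] that assms(2) by auto
  then show "continuous_on {0..} (\<lambda>s. (V s \<omega> + 3*h) powr (-2*\<gamma>))"
    by (intro continuous_on_powr continuous_intros V_cont[OF assms(1)]) auto
qed

text \<open>If \<rho> lies beyond t and the mesh is fine for this path, every step is calm and none
  is cut by \<rho>, so the energy sees the full increments of A, which \<open>A_increment\<close>
  bounds below cell by cell.\<close>

lemma energy_ge:
  assumes w: "\<omega> \<in> space Q" and t: "0 < t" and h: "0 < h" and r: "ennreal t < \<rho> \<omega>"
  shows "eventually (\<lambda>n. 1/2 * (LINT s:{0..t}|lborel. weight h (V s \<omega>)) \<le> energy h t n \<omega>) sequentially"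
proof -
  obtain n0 where n0: "\<And>n r s. n \<ge> n0 \<Longrightarrow> r \<in> {0..t} \<Longrightarrow> s \<in> {0..t} \<Longrightarrow> \<bar>r - s\<bar> \<le> t / real (Suc n) \<Longrightarrow> \<bar>V r \<omega> - V s \<omega>\<bar> \<le> h"
    using mesh_oscillation[OF w t h] by blast
  have t0: "0 \<le> t" using t by simp
  have "1/2 * (LINT s:{0..t}|lborel. weight h (V s \<omega>)) \<le> energy h t n \<omega>" if n: "n \<ge> n0" for n
  proof -
    let ?u = "grid t n"
    have un: "0 \<le> ?u i" "?u i \<le> ?u (Suc i)" for i
      using grid_nonneg[OF t0] grid_mono[OF t0] by auto
    have ur: "ennreal (?u i) < \<rho> \<omega>" if "i \<le> Suc n" for i
      using ennreal_leI[OF grid_le[OF t0 that]] r by order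
    have calm: "calm h t n i \<omega>" if i: "i < Suc n" for i
    proof -
      have "\<bar>V (?u (Suc j)) \<omega> - V (?u j) \<omega>\<bar> \<le> h" if "j < i" for j
        using grid_step[of t n j] t that i
        by (intro n0[OF n]) (auto intro!: grid_nonneg grid_le simp del: of_nat_Suc)
      then show ?thesis using ur[of i] i by (auto simp: calm_def)
    qed
    have piece: "1/2 * (LINT s:{?u i..?u (Suc i)}|lborel. weight h (V s \<omega>))
      \<le> (if calm h t n i \<omega> then (V (?u i) \<omega> + 2*h) powr (-2*\<gamma>) else 0) * inc A (?u i) (?u (Suc i)) \<omega>" if i: "i < Suc n" for i
    proof -
      let ?c = "(V (?u i) \<omega> + 2*h) powr (-2*\<gamma>)"
      have "(LINT s:{?u i..?u (Suc i)}|lborel. weight h (V s \<omega>)) \<le> (LINT s:{?u i..?u (Suc i)}|lborel. ?c * V s \<omega> powr (2*\<gamma>))"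
      proof (rule set_integral_mono)
        show "set_integrable lborel {?u i..?u (Suc i)} (\<lambda>s. weight h (V s \<omega>))"
          by (rule set_integrable_continuous[OF weight_cont[OF w h] un(1)])
        show "set_integrable lborel {?u i..?u (Suc i)} (\<lambda>s. ?c * V s \<omega> powr (2*\<gamma>))"
          by (rule set_integrable_continuous[OF _ un(1)]) (intro continuous_on_mult path_powr_cont[OF w] continuous_on_const)
        fix s assume s: "s \<in> {?u i..?u (Suc i)}"
        then have s': "0 \<le> s" "s \<le> t" using un(1)[of i] grid_le[OF t0, of "Suc i" n] i by auto
        have "\<bar>V (?u i) \<omega> - V s \<omega>\<bar> \<le> h"
          using s s' grid_step[of t n i] grid_le[OF t0, of i n] un(1)[of i] i
          by (intro n0[OF n]) (auto simp del: of_nat_Suc)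
        then have "(V s \<omega> + 3*h) powr (-2*\<gamma>) \<le> ?c"
          using V_nonneg[OF w un(1)] h \<gamma> by (intro powr_mono2') (auto simp: add_nonneg_pos)
        then show "weight h (V s \<omega>) \<le> ?c * V s \<omega> powr (2*\<gamma>)"
          unfolding weight_def by (intro mult_right_mono) auto
      qed
      also have "\<dots> = ?c * (LINT s:{?u i..?u (Suc i)}|lborel. V s \<omega> powr (2*\<gamma>))" by simp
      finally have "1/2 * (LINT s:{?u i..?u (Suc i)}|lborel. weight h (V s \<omega>))
        \<le> ?c * (1/2 * (LINT s:{?u i..?u (Suc i)}|lborel. V s \<omega> powr (2*\<gamma>)))" by simp
      also have "\<dots> \<le> ?c * (A (?u (Suc i)) \<omega> - A (?u i) \<omega>)"
        by (intro mult_left_mono A_increment[OF w un]) auto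
      also have "A (?u (Suc i)) \<omega> - A (?u i) \<omega> = inc A (?u i) (?u (Suc i)) \<omega>"
        using ur[of "Suc i"] ur[of i] i cap_eq[OF un(1), of "Suc i" \<rho> \<omega>] unfolding inc_def by simp
      finally show ?thesis using calm[OF i] by simp
    qed
    have "(LINT s:{0..?u m}|lborel. weight h (V s \<omega>)) = (\<Sum>i<m. LINT s:{?u i..?u (Suc i)}|lborel. weight h (V s \<omega>))" for m
    proof (induction m)
      case 0
      show ?case
        using set_borel_integral_eq_integral(2)[OF set_integrable_continuous[OF weight_cont[OF w h], of 0 0]] by simp
    next
      case (Suc m)
      then show ?case
        using set_integral_combine[OF weight_cont[OF w h] order_refl un(1)[of m] un(2)[of m]] by simp
    qed
    from this[of "Suc n"] have "(LINT s:{0..t}|lborel. weight h (V s \<omega>))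
        = (\<Sum>i<Suc n. LINT s:{?u i..?u (Suc i)}|lborel. weight h (V s \<omega>))"
      by (simp only: grid_Suc_n)
    then have "1/2 * (LINT s:{0..t}|lborel. weight h (V s \<omega>))
        = (\<Sum>i<Suc n. 1/2 * (LINT s:{?u i..?u (Suc i)}|lborel. weight h (V s \<omega>)))"
      by (simp only: sum_distrib_left)
    also have "\<dots> \<le> energy h t n \<omega>" unfolding energy_def by (intro sum_mono piece) auto
    finally show ?thesis .
  qed
  then show ?thesis by (auto simp: eventually_sequentially)
qed

text \<open>Fatou's lemma copes with the path-dependent index from which \<open>energy_ge\<close>
  holds. The drift error and the probability of a large step vanish with the mesh. The 4 collects
  the half of Taylor's formula and the half in \<open>A_increment\<close>.\<close>

lemma weight_integral_bound:
  assumes t: "0 < t" and h: "0 < h" "h < 1"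
  shows "(\<integral>\<^sup>+\<omega>. (if ennreal t < \<rho> \<omega> then ennreal (LINT s:{0..t}|lborel. weight h (V s \<omega>)) else 0) \<partial>Q)
    \<le> ennreal (4 / (1 - h) * ((K + h) powr (1 - 2*\<gamma>) / (1 - 2*\<gamma>) * \<delta> * t))"
proof -
  have t0: "0 \<le> t" using t by simp
  define L where "L = (K + h) powr (1 - 2*\<gamma>) / (1 - 2*\<gamma>)"
  define C where "C = (2*h) powr (-2*\<gamma>)"
  define b where "b n = L * \<delta> * t + C * \<delta>\<^sup>2 * t\<^sup>2 / (2 * h * real (Suc n))
      + C * K\<^sup>2 / 2 * (\<integral>\<omega>. of_bool (jump h t n \<omega>) \<partial>Q)" for n
  have [measurable]: "energy h t n \<in> borel_measurable Q" for n
    using energy_bound(1)[OF t h] by auto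
  note [measurable] = jump_measurable[OF t0]
  have "(\<integral>\<^sup>+\<omega>. (if ennreal t < \<rho> \<omega> then ennreal (LINT s:{0..t}|lborel. weight h (V s \<omega>)) else 0) \<partial>Q)
     \<le> (\<integral>\<^sup>+\<omega>. liminf (\<lambda>n. ennreal (2 * energy h t n \<omega>)) \<partial>Q)"
  proof (rule nn_integral_mono)
    fix \<omega> assume w: "\<omega> \<in> space Q"
    show "(if ennreal t < \<rho> \<omega> then ennreal (LINT s:{0..t}|lborel. weight h (V s \<omega>)) else 0)
      \<le> liminf (\<lambda>n. ennreal (2 * energy h t n \<omega>))"
    proof (cases "ennreal t < \<rho> \<omega>")
      case True
      have "eventually (\<lambda>n. ennreal (LINT s:{0..t}|lborel. weight h (V s \<omega>)) \<le> ennreal (2 * energy h t n \<omega>)) sequentially"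
        using energy_ge[OF w t h(1) True] by eventually_elim (rule ennreal_leI, simp)
      then show ?thesis using True by (simp add: Liminf_bounded)
    qed simp
  qed
  also have "\<dots> \<le> liminf (\<lambda>n. \<integral>\<^sup>+\<omega>. ennreal (2 * energy h t n \<omega>) \<partial>Q)"
    by (rule nn_integral_liminf) measurable
  also have "\<dots> \<le> liminf (\<lambda>n. ennreal (4 / (1 - h) * b n))"
  proof (intro Liminf_mono always_eventually allI)
    fix n
    have "(\<integral>\<^sup>+\<omega>. ennreal (2 * energy h t n \<omega>) \<partial>Q) = ennreal (\<integral>\<omega>. 2 * energy h t n \<omega> \<partial>Q)"
      by (rule nn_integral_eq_integral) (use energy_bound(1)[OF t h] energy_nonneg[OF _ t0] in auto)
    also have "\<dots> \<le> ennreal (4 / (1 - h) * b n)"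
    proof (rule ennreal_leI)
      have "(1 - h) / 2 * (\<integral>\<omega>. energy h t n \<omega> \<partial>Q) \<le> b n"
        using energy_bound(2)[OF t h, of n] unfolding b_def L_def C_def .
      then have "4 / (1 - h) * ((1 - h) / 2 * (\<integral>\<omega>. energy h t n \<omega> \<partial>Q)) \<le> 4 / (1 - h) * b n"
        using h by (intro mult_left_mono) auto
      moreover have "4 / (1 - h) * ((1 - h) / 2 * x) = 2 * x" for x using h by simp
      ultimately show "(\<integral>\<omega>. 2 * energy h t n \<omega> \<partial>Q) \<le> 4 / (1 - h) * b n" by simp
    qed
    finally show "(\<integral>\<^sup>+\<omega>. ennreal (2 * energy h t n \<omega>) \<partial>Q) \<le> ennreal (4 / (1 - h) * b n)" .
  qed
  also have "\<dots> = ennreal (4 / (1 - h) * (L * \<delta> * t + C * \<delta>\<^sup>2 * t\<^sup>2 / (2 * h) * 0 + C * K\<^sup>2 / 2 * 0))"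
  proof (rule lim_imp_Liminf)
    have "(\<lambda>n. \<integral>\<omega>. of_bool (jump h t n \<omega>) \<partial>Q) \<longlonglongrightarrow> (\<integral>\<omega>. (0::real) \<partial>Q)"
    proof (rule integral_dominated_convergence[where w="\<lambda>_. 1"])
      show "AE \<omega> in Q. (\<lambda>n. of_bool (jump h t n \<omega>)) \<longlonglongrightarrow> (0::real)"
        by (intro AE_I2 tendsto_eventually) (use eventually_not_jump[OF _ t h(1)] in \<open>auto elim: eventually_mono\<close>)
    qed auto
    then have "(\<lambda>n. \<integral>\<omega>. of_bool (jump h t n \<omega>) \<partial>Q) \<longlonglongrightarrow> (0::real)" by simp
    moreover have "C * \<delta>\<^sup>2 * t\<^sup>2 / (2 * h * real (Suc n)) = C * \<delta>\<^sup>2 * t\<^sup>2 / (2 * h) * inverse (real (Suc n))" for n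
      by (simp only: divide_inverse inverse_mult_distrib mult.assoc)
    ultimately show "(\<lambda>n. ennreal (4 / (1 - h) * b n)) \<longlonglongrightarrow> ennreal (4 / (1 - h) * (L * \<delta> * t + C * \<delta>\<^sup>2 * t\<^sup>2 / (2 * h) * 0 + C * K\<^sup>2 / 2 * 0))"
      unfolding b_def by (simp only:) (intro tendsto_ennrealI tendsto_intros LIMSEQ_inverse_real_of_nat)
  qed simp
  finally show ?thesis by (simp add: L_def)
qed

section \<open>Occupation of the positive half-line\<close>


text \<open>Sampling at multiples of 1/(n+1) uses countably many coordinates, and continuity gives
  the limit. Negative times are sent to 0 on both sides, by \<open>nat\<close> and by
  \<open>max\<close>.\<close>

lemma path_jointly_measurable: "(\<lambda>(\<omega>, s). V (max 0 s) \<omega>) \<in> borel_measurable (Q \<Otimes>\<^sub>M lborel)"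
proof (rule borel_measurable_LIMSEQ_real)
  let ?g = "\<lambda>n (s::real). nat \<lfloor>real (Suc n) * s\<rfloor>"
  show "(\<lambda>(\<omega>, s). V (real (?g n s) / real (Suc n)) \<omega>) \<in> borel_measurable (Q \<Otimes>\<^sub>M lborel)" for n
  proof -
    have "(\<lambda>x. V (real (?g n (snd x)) / real (Suc n)) (fst x)) \<in> borel_measurable (Q \<Otimes>\<^sub>M lborel)"
    proof (rule measurable_compose_countable[where f="\<lambda>k x. V (real k / real (Suc n)) (fst x)"])
      fix k
      have [measurable]: "V (real k / real (Suc n)) \<in> borel_measurable Q"
        by (rule measurable_F_Q[OF V_adapted]) auto
      show "(\<lambda>x. V (real k / real (Suc n)) (fst x)) \<in> borel_measurable (Q \<Otimes>\<^sub>M lborel)" by measurable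
    qed measurable
    then show ?thesis by (simp add: case_prod_beta)
  qed
  fix x :: "'a \<times> real" assume "x \<in> space (Q \<Otimes>\<^sub>M lborel)"
  then obtain \<omega> s where x: "x = (\<omega>, s)" and w: "\<omega> \<in> space Q" by (auto simp: space_pair_measure)
  have "(\<lambda>n. real (?g n s) / real (Suc n)) \<longlonglongrightarrow> max 0 s"
  proof (rule LIMSEQ_I)
    fix r :: real assume "r > 0"
    then obtain n0 where n0: "inverse (real (Suc n0)) < r" using reals_Archimedean by blast
    have "\<bar>real (?g n s) / real (Suc n) - max 0 s\<bar> < r" if "n \<ge> n0" for n
    proof -
      have "\<bar>real (?g n s) - real (Suc n) * max 0 s\<bar> \<le> 1"
      proof (cases "0 \<le> s")
        case True
        then have "0 \<le> real (Suc n) * s" by simp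
        then have "real (?g n s) = real_of_int \<lfloor>real (Suc n) * s\<rfloor>" by (simp del: of_nat_Suc)
        then show ?thesis using True by (simp add: max_def del: of_nat_Suc) linarith
      next
        case False
        then have "real (Suc n) * s < 0" by (simp add: mult_pos_neg del: of_nat_Suc)
        then have "?g n s = 0" by (simp del: of_nat_Suc)
        then show ?thesis using False by (simp add: max_def)
      qed
      then have "\<bar>real (?g n s) - real (Suc n) * max 0 s\<bar> / real (Suc n) \<le> 1 / real (Suc n)"
        by (intro divide_right_mono) auto
      moreover have "\<bar>real (?g n s) / real (Suc n) - max 0 s\<bar> = \<bar>real (?g n s) - real (Suc n) * max 0 s\<bar> / real (Suc n)"
      proof -
        have "\<bar>a / c - b\<bar> = \<bar>a - c * b\<bar> / c" if "0 < c" for a b c :: real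
        proof -
          have "a / c - b = (a - c * b) / c" using that by (simp add: field_simps)
          then show ?thesis using that by (simp add: abs_divide)
        qed
        then show ?thesis by (simp del: of_nat_Suc)
      qed
      moreover have "1 / real (Suc n) \<le> inverse (real (Suc n0))"
        using that by (simp add: inverse_eq_divide frac_le)
      ultimately show ?thesis using n0 by linarith
    qed
    then show "\<exists>no. \<forall>n\<ge>no. norm (real (?g n s) / real (Suc n) - max 0 s) < r" by auto
  qed
  then show "(\<lambda>n. (\<lambda>(\<omega>, s). V (real (?g n s) / real (Suc n)) \<omega>) x) \<longlonglongrightarrow> (\<lambda>(\<omega>, s). V (max 0 s) \<omega>) x"
    unfolding x prod.case by (intro continuous_on_tendsto_compose[OF V_cont[OF w]]) auto
qed

lemma weight_integral_measurable:
  "(\<lambda>\<omega>. LINT s:{0..t}|lborel. weight h (V s \<omega>)) \<in> borel_measurable Q"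
proof -
  have [measurable]: "(\<lambda>x. V (max 0 (snd x)) (fst x)) \<in> borel_measurable (Q \<Otimes>\<^sub>M lborel)"
    using path_jointly_measurable by (simp add: case_prod_beta)
  have "(\<lambda>\<omega>. LINT s|lborel. indicator {0..t} s * weight h (V (max 0 s) \<omega>)) \<in> borel_measurable Q"
    unfolding weight_def by (rule lborel.borel_measurable_lebesgue_integral) (simp add: case_prod_beta)
  moreover have "(LINT s:{0..t}|lborel. weight h (V s \<omega>)) = (LINT s|lborel. indicator {0..t} s * weight h (V (max 0 s) \<omega>))" for \<omega>
    unfolding set_lebesgue_integral_def
    by (intro Bochner_Integration.integral_cong refl) (auto simp: indicator_def)
  ultimately show ?thesis by simp
qed

text \<open>Dominated convergence with bound 1: the two powers cancel in the limit when v > 0, while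
  at v = 0 the weight is 0 for every h because \<open>0 powr (2*\<gamma>)\<close> is 0.\<close>

lemma weight_integral_tendsto:
  assumes w: "\<omega> \<in> space Q" and h: "h \<longlonglongrightarrow> 0" "\<And>k. 0 < h k"
  shows "(\<lambda>k. LINT s:{0..t}|lborel. weight (h k) (V s \<omega>)) \<longlonglongrightarrow> measure lborel {s\<in>{0..t}. V s \<omega> \<noteq> 0}"
proof -
  have lim: "(\<lambda>k. weight (h k) v) \<longlonglongrightarrow> indicator {0<..} v" if v: "0 \<le> v" for v
  proof (cases "v = 0")
    case True then show ?thesis using \<gamma> by (simp add: weight_def)
  next
    case False
    then have "(\<lambda>k. weight (h k) v) \<longlonglongrightarrow> (v + 3*0) powr (-2*\<gamma>) * v powr (2*\<gamma>)"
      unfolding weight_def using v by (intro tendsto_intros h) auto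
    also have "(v + 3*0) powr (-2*\<gamma>) * v powr (2*\<gamma>) = indicator {0<..} v"
      using False v by (simp add: powr_add[symmetric])
    finally show ?thesis .
  qed
  have le: "\<bar>weight (h k) v\<bar> \<le> 1" if v: "0 \<le> v" for v k
  proof (cases "v = 0")
    case True then show ?thesis using \<gamma> by (simp add: weight_def)
  next
    case False
    have "(v + 3 * h k) powr (-2*\<gamma>) \<le> v powr (-2*\<gamma>)"
      using False v h(2)[of k] \<gamma> by (intro powr_mono2') auto
    then have "weight (h k) v \<le> v powr (-2*\<gamma>) * v powr (2*\<gamma>)" unfolding weight_def by (intro mult_right_mono) auto
    then show ?thesis using False v by (simp add: powr_add[symmetric] weight_def)
  qed
  have [measurable]: "(\<lambda>s. indicator {0..t} s * V s \<omega>) \<in> borel_measurable borel"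
    using borel_measurable_continuous_on_indicator[of "{0..t}" "\<lambda>s. V s \<omega>"] continuous_on_subset[OF V_cont[OF w], of "{0..t}"]
    by simp
  have S: "{s\<in>{0..t}. V s \<omega> \<noteq> 0} = {s. indicator {0..t} s * V s \<omega> \<noteq> 0}" by (auto simp: indicator_def)
  have Sm[measurable]: "{s\<in>{0..t}. V s \<omega> \<noteq> 0} \<in> sets borel" unfolding S by measurable
  have "(\<lambda>k. LINT s|lborel. indicator {0..t} s * weight (h k) (V s \<omega>)) \<longlonglongrightarrow> (LINT s|lborel. indicator {s\<in>{0..t}. V s \<omega> \<noteq> 0} s)"
  proof (rule integral_dominated_convergence[where w="\<lambda>s. indicator {0..t} s :: real"])
    show "integrable lborel (\<lambda>s. indicator {0..t} s :: real)"
      by (rule integrable_real_indicator) (auto simp: emeasure_lborel_Icc_eq)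
    show "AE s in lborel. (\<lambda>k. indicator {0..t} s * weight (h k) (V s \<omega>)) \<longlonglongrightarrow> indicator {s\<in>{0..t}. V s \<omega> \<noteq> 0} s"
    proof (rule AE_I2)
      fix s
      show "(\<lambda>k. indicator {0..t} s * weight (h k) (V s \<omega>)) \<longlonglongrightarrow> indicator {s\<in>{0..t}. V s \<omega> \<noteq> 0} s"
      proof (cases "s \<in> {0..t}")
        case True
        then show ?thesis using lim[OF V_nonneg[OF w, of s]] V_nonneg[OF w, of s] by (auto simp: indicator_def less_le)
      qed (auto simp: indicator_def)
    qed
    show "AE s in lborel. norm (indicator {0..t} s * weight (h k) (V s \<omega>)) \<le> indicator {0..t} s" for k
      using le V_nonneg[OF w] by (auto simp: indicator_def intro!: AE_I2)
    show "(\<lambda>s. indicator {0..t} s * weight (h k) (V s \<omega>)) \<in> borel_measurable lborel" for k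
      using borel_measurable_integrable[OF set_integrable_continuous[OF weight_cont[OF w h(2)[of k]] order_refl, of t, unfolded set_integrable_def]]
      by simp
    show "(indicator {s\<in>{0..t}. V s \<omega> \<noteq> 0} :: real \<Rightarrow> real) \<in> borel_measurable lborel"
      by (rule borel_measurable_indicator) (simp only: Sm sets_lborel)
  qed
  moreover have "(LINT s|lborel. indicator {s\<in>{0..t}. V s \<omega> \<noteq> 0} s) = measure lborel {s\<in>{0..t}. V s \<omega> \<noteq> 0}" by simp
  ultimately show ?thesis unfolding set_lebesgue_integral_def by simp
qed

lemma occupation_measurable:
  "(\<lambda>\<omega>. measure lborel {s\<in>{0..t}. V s \<omega> \<noteq> 0}) \<in> borel_measurable Q"
proof (rule borel_measurable_LIMSEQ_real[OF _ weight_integral_measurable])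
  show "(\<lambda>k. LINT s:{0..t}|lborel. weight (inverse (real (Suc k))) (V s \<omega>))
    \<longlonglongrightarrow> measure lborel {s\<in>{0..t}. V s \<omega> \<noteq> 0}" if "\<omega> \<in> space Q" for \<omega>
    by (rule weight_integral_tendsto[OF that LIMSEQ_inverse_real_of_nat]) simp
qed

lemma occupation_bound:
  assumes t: "0 < t"
  shows "(\<integral>\<^sup>+\<omega>. (if ennreal t < \<rho> \<omega> then ennreal (measure lborel {s\<in>{0..t}. V s \<omega> \<noteq> 0}) else 0) \<partial>Q)
    \<le> ennreal (4 * (K powr (1 - 2*\<gamma>) / (1 - 2*\<gamma>)) * \<delta> * t)"
proof -
  \<comment> \<open>The sequence starts at 1/2 because the estimates require h < 1.\<close>
  define h where "h k = inverse (real (Suc (Suc k)))" for k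
  have h: "h \<longlonglongrightarrow> 0" unfolding h_def using LIMSEQ_inverse_real_of_nat by (rule LIMSEQ_Suc)
  have hb: "0 < h k" "h k < 1" for k by (auto simp: h_def field_simps)
  note [measurable] = weight_integral_measurable stopping_time_measurable[OF rho_stopping]
  let ?X = "\<lambda>k \<omega>. if ennreal t < \<rho> \<omega> then ennreal (LINT s:{0..t}|lborel. weight (h k) (V s \<omega>)) else 0"
  have "(\<integral>\<^sup>+\<omega>. (if ennreal t < \<rho> \<omega> then ennreal (measure lborel {s\<in>{0..t}. V s \<omega> \<noteq> 0}) else 0) \<partial>Q)
    = (\<integral>\<^sup>+\<omega>. liminf (\<lambda>k. ?X k \<omega>) \<partial>Q)"
  proof (rule nn_integral_cong)
    fix \<omega> assume w: "\<omega> \<in> space Q"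
    have "(\<lambda>k. ?X k \<omega>) \<longlonglongrightarrow> (if ennreal t < \<rho> \<omega> then ennreal (measure lborel {s\<in>{0..t}. V s \<omega> \<noteq> 0}) else 0)"
      using tendsto_ennrealI[OF weight_integral_tendsto[OF w h hb(1)]] by auto
    then show "(if ennreal t < \<rho> \<omega> then ennreal (measure lborel {s\<in>{0..t}. V s \<omega> \<noteq> 0}) else 0) = liminf (\<lambda>k. ?X k \<omega>)"
      by (rule lim_imp_Liminf[symmetric, rotated]) simp
  qed
  also have "\<dots> \<le> liminf (\<lambda>k. \<integral>\<^sup>+\<omega>. ?X k \<omega> \<partial>Q)"
    by (rule nn_integral_liminf) measurable
  also have "\<dots> \<le> liminf (\<lambda>k. ennreal (4 / (1 - h k) * ((K + h k) powr (1 - 2*\<gamma>) / (1 - 2*\<gamma>) * \<delta> * t)))"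
    by (intro Liminf_mono always_eventually allI weight_integral_bound[OF t hb])
  also have "\<dots> = ennreal (4 / (1 - 0) * ((K + 0) powr (1 - 2*\<gamma>) / (1 - 2*\<gamma>) * \<delta> * t))"
  proof (rule lim_imp_Liminf)
    show "(\<lambda>k. ennreal (4 / (1 - h k) * ((K + h k) powr (1 - 2*\<gamma>) / (1 - 2*\<gamma>) * \<delta> * t)))
      \<longlonglongrightarrow> ennreal (4 / (1 - 0) * ((K + 0) powr (1 - 2*\<gamma>) / (1 - 2*\<gamma>) * \<delta> * t))"
      by (intro tendsto_ennrealI tendsto_intros h) (use K \<gamma> in auto)
  qed simp
  finally show ?thesis by (simp add: mult.assoc)
qed

text \<open>Markov's inequality for the stopped path, whose mean is at most \<delta> t by optional
  stopping. The comparisons with \<tau>1 and \<tau>2 ensure that \<rho> is the hitting time itself,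
  where the path has reached K.\<close>

lemma hitting_bound:
  assumes t: "0 < t"
  shows "measure Q {\<omega>\<in>space Q. T \<omega> \<le> ennreal t \<and> T \<omega> \<le> \<tau>1 \<omega> \<and> T \<omega> \<le> \<tau>2 \<omega>} \<le> \<delta> * t / K" (is "measure Q ?E \<le> _")
proof -
  have t0: "(0::real) \<le> 0" "0 \<le> t" using t by auto
  have Mi: "integrable Q (\<lambda>\<omega>. inc M 0 t \<omega> + \<delta> * t)" using inc_M(1)[OF t0] by simp
  have pt: "K * indicator ?E \<omega> \<le> inc M 0 t \<omega> + \<delta> * t" if w: "\<omega> \<in> space Q" for \<omega>
  proof -
    have c0: "cap \<rho> 0 \<omega> = 0" by simp
    have "inc V 0 t \<omega> = V (cap \<rho> t \<omega>) \<omega>" using inc_cap[OF t0, of V \<omega>] V_0[OF w] c0 by simp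
    moreover have "\<delta> * (cap \<rho> t \<omega> - cap \<rho> 0 \<omega>) \<le> \<delta> * t"
      using cap_bounds(2)[OF t0(2), of \<rho> \<omega>] c0 \<delta> by (intro mult_left_mono) auto
    ultimately have le: "V (cap \<rho> t \<omega>) \<omega> \<le> inc M 0 t \<omega> + \<delta> * t" using inc_V[OF t0, of \<omega>] by linarith
    show ?thesis
    proof (cases "\<omega> \<in> ?E")
      case False
      then show ?thesis using le V_nonneg[OF w cap_bounds(1)[OF t0(2), of \<rho> \<omega>]] by simp
    next
      case True
      then obtain r where r: "T \<omega> = ennreal r" "0 \<le> r" "r \<le> t"
        using t0 by (cases "T \<omega>") (auto simp: top_unique)
      have rr: "\<rho> \<omega> = ennreal r" using True r unfolding \<rho>_def by (auto simp: min_def)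
      then have "cap \<rho> t \<omega> = r" using r t0 by (simp add: min_absorb2)
      moreover obtain s where s: "s \<in> {0..r}" "K \<le> V s \<omega>" using T_iff[OF w r(2)] r(1) by auto
      \<comment> \<open>The level is reached at some s \<le> r, and then T \<le> s; since T = r, the
        time s is r.\<close>
      have "T \<omega> \<le> ennreal s" using T_iff[OF w, of s] s by auto
      then have "s = r" using r(1) s(1) by simp
      ultimately show ?thesis using le s(2) True by simp
    qed
  qed
  show ?thesis
  proof (cases "?E \<in> sets Q")
    case False
    then show ?thesis using \<delta> t K by (simp add: measure_notin_sets)
  next
    case True
    have ind: "integrable Q (indicat_real ?E)"
      using True by (intro integrable_real_indicator) (auto simp: emeasure_eq_measure)
    have "K * measure Q ?E = (\<integral>\<omega>. K * indicator ?E \<omega> \<partial>Q)" using True by simp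
    also have "\<dots> \<le> (\<integral>\<omega>. inc M 0 t \<omega> + \<delta> * t \<partial>Q)"
      by (intro integral_mono Mi pt integrable_mult_right ind)
    also have "\<dots> = (\<integral>\<omega>. 1 * inc M 0 t \<omega> \<partial>Q) + \<delta> * t" using inc_M(1)[OF t0] by (simp add: prob_space)
    also have "(\<integral>\<omega>. 1 * inc M 0 t \<omega> \<partial>Q) = 0" by (rule inc_M(2)[OF t0, of _ 1]) auto
    finally show ?thesis using K by (simp add: field_simps)
  qed
qed

text \<open>Too little time at zero means more than 2 \<epsilon> t away from it. Then a localizing
  time occurs by t, or the level K is reached by t before both of them, or \<rho> lies beyond t and
  the occupation bound applies.\<close>

lemma zero_time_bound:
  assumes t: "0 < t" and \<epsilon>: "0 < \<epsilon>"
  shows "measure Q {\<omega>\<in>space Q. measure lborel {s\<in>{0..t}. V s \<omega> = 0} < (1 - 2*\<epsilon>) * t}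
    \<le> \<delta> * t / K + 2 * (K powr (1 - 2*\<gamma>) / (1 - 2*\<gamma>)) * \<delta> / \<epsilon>
      + measure Q {\<omega>\<in>space Q. \<tau>1 \<omega> \<le> ennreal t} + measure Q {\<omega>\<in>space Q. \<tau>2 \<omega> \<le> ennreal t}"
proof -
  have t0: "0 \<le> t" using t by simp
  let ?Z = "\<lambda>\<omega>. measure lborel {s\<in>{0..t}. V s \<omega> = 0}"
  let ?N = "\<lambda>\<omega>. measure lborel {s\<in>{0..t}. V s \<omega> \<noteq> 0}"
  let ?E = "{\<omega>\<in>space Q. ?Z \<omega> < (1 - 2*\<epsilon>) * t}"
  let ?H = "{\<omega>\<in>space Q. T \<omega> \<le> ennreal t \<and> T \<omega> \<le> \<tau>1 \<omega> \<and> T \<omega> \<le> \<tau>2 \<omega>}"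
  let ?A1 = "{\<omega>\<in>space Q. \<tau>1 \<omega> \<le> ennreal t}" and ?A2 = "{\<omega>\<in>space Q. \<tau>2 \<omega> \<le> ennreal t}"
  let ?B = "{\<omega>\<in>space Q. ennreal t < \<rho> \<omega> \<and> 2*\<epsilon>*t < ?N \<omega>}"
  note [measurable] = occupation_measurable stopping_time_measurable[OF rho_stopping]
  have B: "?B \<in> sets Q" by measurable
  have A: "?A1 \<in> sets Q" "?A2 \<in> sets Q" using stopping_time_event \<tau>1 \<tau>2 t0 by auto
  let ?T = "{\<omega>\<in>space Q. T \<omega> \<le> ennreal t}"
  have ZN: "?Z \<omega> + ?N \<omega> = t" if w: "\<omega> \<in> space Q" for \<omega>
  proof -
    have "closed {s\<in>{0..t}. V s \<omega> = 0}"
      by (intro continuous_closed_preimage_constant continuous_on_subset[OF V_cont[OF w]]) auto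
    then have Zm: "{s\<in>{0..t}. V s \<omega> = 0} \<in> sets lborel" by simp
    have "{s\<in>{0..t}. V s \<omega> \<noteq> 0} = {0..t} - {s\<in>{0..t}. V s \<omega> = 0}" by auto
    moreover have "measure lborel ({0..t} - {s\<in>{0..t}. V s \<omega> = 0}) = measure lborel {0..t} - ?Z \<omega>"
      using Zm by (intro measure_Diff) (auto simp: t0)
    ultimately show ?thesis using t0 by simp
  qed
  have Hsub: "?E \<subseteq> ?A1 \<union> ?A2 \<union> ?B \<union> (?T - ?A1 - ?A2)"
  proof
    fix \<omega> assume w: "\<omega> \<in> ?E"
    then have "2*\<epsilon>*t < ?N \<omega>" using ZN[of \<omega>] by (auto simp: algebra_simps)
    then show "\<omega> \<in> ?A1 \<union> ?A2 \<union> ?B \<union> (?T - ?A1 - ?A2)"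
      using w by (auto simp: \<rho>_def not_le)
  qed
  have TA: "?T - ?A1 - ?A2 \<in> sets Q" using A stopping_time_event[OF T t0] by auto
  have "measure Q ?E \<le> measure Q (?A1 \<union> ?A2 \<union> ?B \<union> (?T - ?A1 - ?A2))"
    by (intro finite_measure_mono[OF Hsub] sets.Un A B TA)
  also have "\<dots> \<le> measure Q ?A1 + measure Q ?A2 + measure Q ?B + measure Q (?T - ?A1 - ?A2)"
  proof -
    have "measure Q (?A1 \<union> ?A2 \<union> ?B \<union> (?T - ?A1 - ?A2)) \<le> measure Q (?A1 \<union> ?A2 \<union> ?B) + measure Q (?T - ?A1 - ?A2)"
      by (intro measure_Un_le sets.Un A B TA)
    moreover have "measure Q (?A1 \<union> ?A2 \<union> ?B) \<le> measure Q (?A1 \<union> ?A2) + measure Q ?B"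
      by (intro measure_Un_le sets.Un A B TA)
    moreover have "measure Q (?A1 \<union> ?A2) \<le> measure Q ?A1 + measure Q ?A2"
      by (intro measure_Un_le sets.Un A B TA)
    ultimately show ?thesis by linarith
  qed
  also have "measure Q (?T - ?A1 - ?A2) \<le> \<delta> * t / K"
  proof -
    have Hm: "?H \<in> sets Q"
    proof -
      note [measurable] = stopping_time_measurable[OF T] stopping_time_measurable[OF \<tau>1] stopping_time_measurable[OF \<tau>2]
      show ?thesis by measurable
    qed
    have "?T - ?A1 - ?A2 \<subseteq> ?H" by auto
    from finite_measure_mono[OF this Hm] show ?thesis using hitting_bound[OF t] by linarith
  qed
  \<comment> \<open>Markov's inequality at the level 2 \<epsilon> t; the factor t cancels, so this
    term can be made small through K alone.\<close>
  also have "measure Q ?B \<le> 2 * (K powr (1 - 2*\<gamma>) / (1 - 2*\<gamma>)) * \<delta> / \<epsilon>"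
  proof -
    define c where "c = 2*\<epsilon>*t"
    define k where "k = 4 * (K powr (1 - 2*\<gamma>) / (1 - 2*\<gamma>)) * \<delta> * t"
    define N where "N = ?N"
    have c0: "0 \<le> c" using \<epsilon> t by (simp add: c_def)
    have k0: "0 \<le> k" using t \<delta> \<gamma> by (simp add: k_def)
    have BN: "?B = {\<omega>\<in>space Q. ennreal t < \<rho> \<omega> \<and> c < N \<omega>}" by (simp only: c_def N_def)
    have "ennreal (c * measure Q ?B) = ennreal c * emeasure Q ?B"
      using ennreal_mult'[OF c0, of "measure Q ?B"] by (simp only: emeasure_eq_measure)
    also have "\<dots> = (\<integral>\<^sup>+\<omega>. ennreal c * indicator ?B \<omega> \<partial>Q)"
      by (rule nn_integral_cmult_indicator[OF B, symmetric])
    also have "\<dots> \<le> (\<integral>\<^sup>+\<omega>. (if ennreal t < \<rho> \<omega> then ennreal (N \<omega>) else 0) \<partial>Q)"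
      unfolding BN by (rule nn_integral_mono) (auto simp: indicator_def intro!: ennreal_leI)
    also have "\<dots> \<le> ennreal k" using occupation_bound[OF t] unfolding N_def k_def .
    finally have "c * measure Q ?B \<le> k" using k0 by (simp only: ennreal_le_iff)
    then have "2*\<epsilon>*t * measure Q ?B \<le> 4 * (K powr (1 - 2*\<gamma>) / (1 - 2*\<gamma>)) * \<delta> * t"
      unfolding c_def k_def .
    then have "t * (2*\<epsilon> * measure Q ?B) \<le> t * (4 * (K powr (1 - 2*\<gamma>) / (1 - 2*\<gamma>)) * \<delta>)"
      by (simp only: mult.assoc mult.commute mult.left_commute)
    then have "2*\<epsilon> * measure Q ?B \<le> 4 * (K powr (1 - 2*\<gamma>) / (1 - 2*\<gamma>)) * \<delta>"
      by (rule mult_left_le_imp_le[OF _ t])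
    moreover have "m \<le> 2 * l * \<delta> / \<epsilon>" if "2*\<epsilon> * m \<le> 4 * l * \<delta>" for m l
      using that \<epsilon> by (simp add: pos_le_divide_eq algebra_simps)
    ultimately show ?thesis by blast
  qed
  finally show ?thesis by simp
qed

end

section \<open>Transfer to path space\<close>

text \<open>In \<open>ennreal\<close> the infimum of the empty set is infinite, so a path that never
  reaches K has an infinite hitting time.\<close>

definition hitting_time :: "(real \<Rightarrow> 'a \<Rightarrow> real) \<Rightarrow> real \<Rightarrow> 'a \<Rightarrow> ennreal" where
  "hitting_time V K \<omega> = Inf (ennreal ` {s. 0 \<le> s \<and> K \<le> V s \<omega>})"

text \<open>The set of times with value at least K is closed by continuity, so its infimum is
  attained as soon as it is nonempty.\<close>

lemma hitting_time_le_iff: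
  assumes cont: "continuous_on {0..} (\<lambda>t. V t \<omega>)" and t: "0 \<le> t"
  shows "hitting_time V K \<omega> \<le> ennreal t \<longleftrightarrow> (\<exists>s\<in>{0..t}. K \<le> V s \<omega>)"
proof
  assume "\<exists>s\<in>{0..t}. K \<le> V s \<omega>"
  then obtain s where "0 \<le> s" "s \<le> t" "K \<le> V s \<omega>" by auto
  then have "hitting_time V K \<omega> \<le> ennreal s" unfolding hitting_time_def by (intro Inf_lower) auto
  also have "\<dots> \<le> ennreal t" using \<open>s \<le> t\<close> by (rule ennreal_leI)
  finally show "hitting_time V K \<omega> \<le> ennreal t" .
next
  let ?S = "{s. 0 \<le> s \<and> K \<le> V s \<omega>}"
  assume le: "hitting_time V K \<omega> \<le> ennreal t"
  have ne: "?S \<noteq> {}"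
  proof
    assume "?S = {}"
    then have "hitting_time V K \<omega> = top" unfolding hitting_time_def by (simp only: image_empty Inf_empty)
    then show False using le by (simp add: top_unique)
  qed
  have "closed {s\<in>{0..}. K \<le> V s \<omega>}"
    by (intro continuous_on_closed_Collect_le continuous_intros cont closed_atLeast)
  moreover have S: "{s\<in>{0..}. K \<le> V s \<omega>} = ?S" by auto
  ultimately have cl: "closed ?S" by simp
  have bdd: "bdd_below ?S" by (rule bdd_belowI[of _ 0]) auto
  have in_S: "Inf ?S \<in> ?S" by (rule closed_contains_Inf[OF ne bdd cl])
  have "ennreal (Inf ?S) \<le> hitting_time V K \<omega>"
    unfolding hitting_time_def by (intro Inf_greatest) (auto intro!: ennreal_leI cInf_lower bdd)
  then have "ennreal (Inf ?S) \<le> ennreal t" using le by order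
  then have "Inf ?S \<le> t" using t by (simp add: ennreal_le_iff)
  then show "\<exists>s\<in>{0..t}. K \<le> V s \<omega>" using in_S by (intro bexI[of _ "Inf ?S"]) auto
qed

section \<open>Modification on null sets, localization and hitting times\<close>

context filtered_prob begin

text \<open>Completeness of the filtration enters through the assumption that all subsets of N are
  measurable: what f' does on N is then irrelevant.\<close>

lemma borel_measurable_modification:
  fixes f f' :: "'a \<Rightarrow> real"
  assumes f: "f \<in> borel_measurable (F t)" and t: "0 \<le> t"
    and N: "\<And>S. S \<subseteq> N \<Longrightarrow> S \<in> sets (F t)" and eq: "\<And>\<omega>. \<omega> \<notin> N \<Longrightarrow> f' \<omega> = f \<omega>"
  shows "f' \<in> borel_measurable (F t)"
proof (rule measurableI)
  fix B :: "real set" assume B: "B \<in> sets borel"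
  have "f' -` B \<inter> space (F t) = (f -` B \<inter> space (F t) - N) \<union> (f' -` B \<inter> space (F t) \<inter> N)"
    using eq by auto
  also have "\<dots> \<in> sets (F t)"
    by (intro sets.Un[OF sets.Diff[OF measurable_sets[OF f B] N[OF order_refl]] N[OF Int_lower2]])
  finally show "f' -` B \<inter> space (F t) \<in> sets (F t)" .
qed simp

text \<open>One exceptional set serves all times, and conditional expectations do not see null sets.
  Hence processes may be corrected to have good paths everywhere.\<close>

lemma martingale_modification:
  assumes X: "martingale Q F X" and N: "N \<in> null_sets Q" "\<And>S t. S \<subseteq> N \<Longrightarrow> 0 \<le> t \<Longrightarrow> S \<in> sets (F t)"
    and eq: "\<And>\<omega> t. \<omega> \<notin> N \<Longrightarrow> 0 \<le> t \<Longrightarrow> X' t \<omega> = X t \<omega>"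
  shows "martingale Q F X'"
  unfolding martingale_def adapted_def
proof (intro conjI allI impI)
  fix t :: real assume t: "0 \<le> t"
  show "subalgebra Q (F t)" by (rule subalg[OF t])
  show X't: "X' t \<in> borel_measurable (F t)"
    by (rule borel_measurable_modification[OF martingaleD(2)[OF X t] t N(2)[OF _ t] eq[OF _ t]])
  have "AE \<omega> in Q. X t \<omega> = X' t \<omega>"
    by (rule AE_I'[OF N(1)]) (use eq[OF _ t] in force)
  then show "integrable Q (X' t)"
    using martingaleD(1,3)[OF X t] measurable_F_Q[OF X't t]
    by (subst integrable_cong_AE[of _ _ "X t"]) auto
next
  fix s t :: real assume st: "0 \<le> s" "s \<le> t"
  then have t: "0 \<le> t" by simp
  interpret S: finite_measure_subalgebra Q "F s" by unfold_locales (rule subalg[OF st(1)])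
  have AEeq: "AE \<omega> in Q. X' u \<omega> = X u \<omega>" if "0 \<le> u" for u
    by (rule AE_I'[OF N(1)]) (use eq[OF _ that] in force)
  have mt: "X' t \<in> borel_measurable Q"
    by (rule measurable_F_Q[OF borel_measurable_modification[OF martingaleD(2)[OF X t] t N(2)[OF _ t] eq[OF _ t]] t])
  have "AE \<omega> in Q. real_cond_exp Q (F s) (X' t) \<omega> = real_cond_exp Q (F s) (X t) \<omega>"
    by (rule S.real_cond_exp_cong[OF AEeq[OF t] mt martingaleD(3)[OF X t]])
  moreover have "AE \<omega> in Q. real_cond_exp Q (F s) (X t) \<omega> = X s \<omega>"
    using X st unfolding martingale_def by auto
  ultimately show "AE \<omega> in Q. real_cond_exp Q (F s) (X' t) \<omega> = X' s \<omega>"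
    using AEeq[OF st(1)] by eventually_elim simp
qed

text \<open>Makes the price paid for localization in \<open>zero_time_bound\<close> vanish.\<close>

lemma localizing_tendsto:
  assumes \<tau>: "\<And>n. ext_stopping_time F (\<tau> n)" and lim: "AE \<omega> in Q. (\<lambda>n. \<tau> n \<omega>) \<longlonglongrightarrow> \<infinity>" and t: "0 \<le> t"
  shows "(\<lambda>n. measure Q {\<omega>\<in>space Q. \<tau> n \<omega> \<le> ennreal t}) \<longlonglongrightarrow> 0"
proof -
  let ?E = "\<lambda>n. {\<omega>\<in>space Q. \<tau> n \<omega> \<le> ennreal t}"
  have E: "?E n \<in> sets Q" for n by (rule stopping_time_event[OF \<tau> t])
  have "(\<lambda>n. \<integral>\<omega>. indicator (?E n) \<omega> \<partial>Q) \<longlonglongrightarrow> (\<integral>\<omega>. (0::real) \<partial>Q)"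
  proof (rule integral_dominated_convergence[where w="\<lambda>_. 1"])
    show "(\<lambda>\<omega>. indicator (?E n) \<omega> :: real) \<in> borel_measurable Q" for n
      by (rule borel_measurable_indicator[OF E])
    show "AE \<omega> in Q. (\<lambda>n. indicator (?E n) \<omega> :: real) \<longlonglongrightarrow> 0"
      using lim
    proof eventually_elim
      case (elim \<omega>)
      then have "eventually (\<lambda>n. ennreal t < \<tau> n \<omega>) sequentially"
        by (rule order_tendstoD) simp
      then show ?case by (intro tendsto_eventually) (auto elim!: eventually_mono simp: indicator_def)
    qed
  qed (auto simp: indicator_def)
  then show ?thesis using E by simp
qed

text \<open>Reaching K during [0, t] is an uncountable union of events. As the maximum over [0, t]
  is attained and the path is continuous, it suffices that each level K - 1/(k+1) is exceeded
  somewhere on a countable dense set; the set used is t times the rationals clamped to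
  [0, 1].\<close>

lemma hitting_time_stopping:
  assumes V: "\<And>t. 0 \<le> t \<Longrightarrow> V t \<in> borel_measurable (F t)"
    and cont: "\<And>\<omega>. \<omega> \<in> space Q \<Longrightarrow> continuous_on {0..} (\<lambda>t. V t \<omega>)"
  shows "ext_stopping_time F (hitting_time V K)"
  unfolding ext_stopping_time_def
proof (intro allI impI)
  fix t :: real assume t: "0 \<le> t"
  define c where "c q = t * max 0 (min 1 (real_of_rat q))" for q
  have c: "0 \<le> c q" "c q \<le> t" for q
    using t mult_left_mono[of "max 0 (min 1 (real_of_rat q))" 1 t] by (auto simp: c_def)
  have [measurable]: "V (c q) \<in> borel_measurable (F t)" for q
    by (rule measurable_F_mono[OF V[OF c(1)] c(1) c(2)])
  have m: "Measurable.pred (F t) (\<lambda>\<omega>. \<forall>k::nat. \<exists>q::rat. K - 1 / real (Suc k) < V (c q) \<omega>)"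
    by measurable
  have eq: "hitting_time V K \<omega> \<le> ennreal t \<longleftrightarrow> (\<forall>k::nat. \<exists>q::rat. K - 1 / real (Suc k) < V (c q) \<omega>)"
    if w: "\<omega> \<in> space (F t)" for \<omega>
  proof -
    have wQ: "\<omega> \<in> space Q" using w space_F[OF t] by simp
    note cw = cont[OF wQ]
    show ?thesis unfolding hitting_time_le_iff[of V \<omega> t K, OF cw t]
    proof (intro iffI allI)
      fix k :: nat assume "\<exists>s\<in>{0..t}. K \<le> V s \<omega>"
      then obtain s where s: "0 \<le> s" "s \<le> t" "K \<le> V s \<omega>" by auto
      define g where "g x = V (t * max 0 (min 1 x)) \<omega>" for x
      have "continuous_on UNIV g"
        unfolding g_def by (rule continuous_on_compose2[OF cw]) (auto intro!: continuous_intros mult_nonneg_nonneg t)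
      then have op: "open {x. K - 1 / real (Suc k) < g x}"
        by (intro open_Collect_less continuous_on_const)
      \<comment> \<open>For t = 0 all sampling points are 0, so any x serves; the case split avoids
        dividing by 0.\<close>
      define x where "x = (if t = 0 then 0 else s / t)"
      have "t * max 0 (min 1 x) = s" using s t by (auto simp: x_def max_def min_def)
      then have "x \<in> {x. K - 1 / real (Suc k) < g x}" using s(3) by (simp add: g_def less_le_trans[of _ K] del: of_nat_Suc)
      then obtain e where e: "e > 0" "\<And>y. dist y x < e \<Longrightarrow> K - 1 / real (Suc k) < g y"
        using op unfolding open_dist by blast
      obtain q where "x < real_of_rat q" "real_of_rat q < x + e" using of_rat_dense[of x "x + e"] e(1) by auto
      then have "K - 1 / real (Suc k) < g (real_of_rat q)" by (intro e(2)) (auto simp: dist_real_def)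
      then show "\<exists>q. K - 1 / real (Suc k) < V (c q) \<omega>" by (auto simp: g_def c_def)
    next
      assume all: "\<forall>k::nat. \<exists>q. K - 1 / real (Suc k) < V (c q) \<omega>"
      have "\<exists>s\<in>{0..t}. \<forall>y\<in>{0..t}. V y \<omega> \<le> V s \<omega>"
        using t by (intro continuous_attains_sup continuous_on_subset[OF cw]) auto
      then obtain s where s: "s \<in> {0..t}" "\<And>y. y \<in> {0..t} \<Longrightarrow> V y \<omega> \<le> V s \<omega>" by blast
      have "K \<le> V s \<omega> + e" if e: "e > 0" for e
      proof -
        obtain k where k: "inverse (real (Suc k)) < e" using reals_Archimedean[OF e] by blast
        obtain q where "K - 1 / real (Suc k) < V (c q) \<omega>" using all by blast
        then show ?thesis using k s(2)[of "c q"] c[of q] by (simp add: inverse_eq_divide del: of_nat_Suc)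
      qed
      then have "K \<le> V s \<omega>" by (rule field_le_epsilon)
      then show "\<exists>s\<in>{0..t}. K \<le> V s \<omega>" using s(1) by blast
    qed
  qed
  show "Measurable.pred (F t) (\<lambda>\<omega>. hitting_time V K \<omega> \<le> ennreal t)"
    by (rule measurable_cong[THEN iffD2, OF eq m])
qed

end

section \<open>The completed right-continuous filtration and the coordinate process\<close>

lemma space_usual_filtration [simp]: "space (usual_filtration P t) = UNIV"
  by (simp add: usual_filtration_def)

lemma sets_usual_filtrationI:
  assumes "\<And>u. t < u \<Longrightarrow> S \<in> sets (completed_filtration P u)"
  shows "S \<in> sets (usual_filtration P t)"
  unfolding usual_filtration_def using assms by (auto intro!: sigma_sets.Basic)

lemma sets_usual_filtration_mono:
  assumes "s \<le> t"
  shows "sets (usual_filtration P s) \<subseteq> sets (usual_filtration P t)"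
  unfolding usual_filtration_def using assms
  by (auto simp: sets_measure_of intro!: sigma_sets_mono' INF_superset_mono elim!: subsetD[OF sigma_sets_mono', rotated])

lemma null_set_usual_filtration: "S \<in> null_sets (completion P) \<Longrightarrow> S \<in> sets (usual_filtration P t)"
  by (rule sets_usual_filtrationI) (auto simp: completed_filtration_def intro!: sigma_sets.Basic)

lemma Y_usual_filtration:
  assumes "0 \<le> t"
  shows "Y t \<in> borel_measurable (usual_filtration P t)"
proof (rule measurableI)
  fix B :: "real set" assume B: "B \<in> sets borel"
  have "Y t -` B \<in> sets (usual_filtration P t)"
  proof (rule sets_usual_filtrationI)
    fix u assume "t < u"
    then have "t \<in> {0..u}" using assms by simp
    then show "Y t -` B \<in> sets (completed_filtration P u)"
      using B unfolding completed_filtration_def by (auto intro!: sigma_sets.Basic)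
  qed
  then show "Y t -` B \<inter> space (usual_filtration P t) \<in> sets (usual_filtration P t)" by simp
qed simp

lemma I_proc_increment:
  assumes nn: "\<And>u. 0 \<le> u \<Longrightarrow> 0 \<le> Y u \<omega>" and st: "0 \<le> s" "s \<le> t" and \<gamma>: "0 < \<gamma>"
  shows "I_proc \<gamma> t \<omega> - I_proc \<gamma> s \<omega> = 1/2 * (LINT u:{s..t}|lborel. Y u \<omega> powr (2*\<gamma>))"
proof -
  have I: "I_proc \<gamma> r \<omega> = 1/2 * (LINT u:{0..r}|lborel. Y u \<omega> powr (2*\<gamma>))" for r
  proof -
    have "(if Y u \<omega> < 0 then 0 else Y u \<omega> powr (2*\<gamma>)) = Y u \<omega> powr (2*\<gamma>)" if "u \<in> {0..r}" for u
      using nn[of u] that by simp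
    then show ?thesis unfolding I_proc_def
      by (intro arg_cong2[where f="(*)"] refl set_lebesgue_integral_cong) auto
  qed
  have "continuous_on {0..} (\<lambda>u. Y u \<omega> powr (2*\<gamma>))"
    by (intro continuous_on_powr' continuous_on_path continuous_intros) (use nn \<gamma> in auto)
  from set_integral_combine[OF this order_refl st] show ?thesis unfolding I by simp
qed

text \<open>All almost sure properties are gathered outside one null set N, on which path and
  bracket are replaced by 0; the completed filtration tolerates this. For each n the localized bound
  then holds with the same main terms, and n tends to infinity.\<close>

lemma zero_time_estimate:
  assumes \<gamma>: "0 < \<gamma>" "\<gamma> < 1/2" and \<delta>: "0 < \<delta>" and K: "0 < K" and t: "0 < t" and \<epsilon>: "0 < \<epsilon>"
    and P: "P \<in> M_class_from \<gamma> \<delta> 0"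
  shows "measure P {\<omega>. measure lborel (zero_set t \<omega>) < (1 - 2*\<epsilon>) * t}
    \<le> \<delta> * t / K + 2 * (K powr (1 - 2*\<gamma>) / (1 - 2*\<gamma>)) * \<delta> / \<epsilon>"
proof -
  let ?Q = "completion P" and ?F = "usual_filtration P"
  have sP: "sets P = sets borel" and pP: "prob_space P" and nnP: "AE \<omega> in P. \<forall>t\<ge>0. Y t \<omega> \<ge> 0" and 
    lmM: "local_martingale ?Q ?F (M_proc \<delta>)" and Y0P: "AE \<omega> in P. Y 0 \<omega> = 0"
    using P unfolding M_class_from_def M_class_def continuous_local_martingale_def by auto
  obtain A where qv: "quadratic_variation ?Q ?F (M_proc \<delta>) A" and AI: "AE \<omega> in ?Q. \<forall>s t. 0 \<le> s \<longrightarrow> s \<le> t \<longrightarrow>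
           A t \<omega> - A s \<omega> \<ge> I_proc \<gamma> t \<omega> - I_proc \<gamma> s \<omega>"
    using P unfolding M_class_from_def M_class_def by auto
  have A_adapted: "adapted ?F A" and A_path: "AE \<omega> in ?Q. A 0 \<omega> = 0 \<and> mono_on {0..} (\<lambda>t. A t \<omega>) \<and> continuous_on {0..} (\<lambda>t. A t \<omega>)"
    and lmW: "local_martingale ?Q ?F (\<lambda>t \<omega>. (M_proc \<delta> t \<omega>)\<^sup>2 - A t \<omega>)"
    using qv unfolding quadratic_variation_def by auto
  have spP: "space P = UNIV" using sets_eq_imp_space_eq[OF sP] by simp
  obtain \<tau>1 where \<tau>1: "\<And>n. ext_stopping_time ?F (\<tau>1 n)"
    and \<tau>1_lim: "AE \<omega> in ?Q. incseq (\<lambda>n. \<tau>1 n \<omega>) \<and> (\<lambda>n. \<tau>1 n \<omega>) \<longlonglongrightarrow> \<infinity>"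
    and \<tau>1_mart: "\<And>n. martingale ?Q ?F (\<lambda>t \<omega>. stopped (M_proc \<delta>) (\<tau>1 n) t \<omega> - M_proc \<delta> 0 \<omega>)"
    using lmM unfolding local_martingale_def by blast
  obtain \<tau>2 where \<tau>2: "\<And>n. ext_stopping_time ?F (\<tau>2 n)"
    and \<tau>2_lim: "AE \<omega> in ?Q. incseq (\<lambda>n. \<tau>2 n \<omega>) \<and> (\<lambda>n. \<tau>2 n \<omega>) \<longlonglongrightarrow> \<infinity>"
    and \<tau>2_mart: "\<And>n. martingale ?Q ?F (\<lambda>t \<omega>. stopped (\<lambda>t \<omega>. (M_proc \<delta> t \<omega>)\<^sup>2 - A t \<omega>) (\<tau>2 n) t \<omega> - ((M_proc \<delta> 0 \<omega>)\<^sup>2 - A 0 \<omega>))"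
    using lmW unfolding local_martingale_def by blast
  interpret Q: prob_space ?Q
  by (rule prob_spaceI) (use prob_space.emeasure_space_1[OF pP] in simp)
  interpret filtered_prob ?Q ?F
  proof
    \<comment> \<open>That the filtration consists of measurable events is part of the definition of
      a martingale, so it is read off from a localized one.\<close>
    show "subalgebra ?Q (?F u)" if "0 \<le> u" for u
      using \<tau>1_mart[of 0] that unfolding martingale_def by auto
    show "sets (?F s) \<subseteq> sets (?F u)" if "0 \<le> s" "s \<le> u" for s u
      using sets_usual_filtration_mono[OF that(2)] .
  qed
  have "AE \<omega> in ?Q. (\<forall>t\<ge>0. Y t \<omega> \<ge> 0) \<and> Y 0 \<omega> = 0 \<and> A 0 \<omega> = 0 \<and> continuous_on {0..} (\<lambda>t. A t \<omega>) \<and>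
      (\<forall>s t. 0 \<le> s \<longrightarrow> s \<le> t \<longrightarrow> A t \<omega> - A s \<omega> \<ge> I_proc \<gamma> t \<omega> - I_proc \<gamma> s \<omega>)"
    using AE_completion[OF nnP] AE_completion[OF Y0P] A_path AI by eventually_elim auto
  then obtain N where N: "N \<in> null_sets ?Q" and good: "\<And>\<omega>. \<omega> \<notin> N \<Longrightarrow> (\<forall>t\<ge>0. Y t \<omega> \<ge> 0) \<and> Y 0 \<omega> = 0 \<and> A 0 \<omega> = 0 \<and>
      continuous_on {0..} (\<lambda>t. A t \<omega>) \<and> (\<forall>s t. 0 \<le> s \<longrightarrow> s \<le> t \<longrightarrow> A t \<omega> - A s \<omega> \<ge> I_proc \<gamma> t \<omega> - I_proc \<gamma> s \<omega>)"
    by (elim AE_E3) (use spP in auto)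
  have N_sub: "S \<in> sets (?F u)" if "S \<subseteq> N" for S u
    by (rule null_set_usual_filtration) (rule null_sets_completion_subset[OF that N])
  define V where "V u \<omega> = (if \<omega> \<in> N then 0 else Y u \<omega>)" for u \<omega>
  define A' where "A' u \<omega> = (if \<omega> \<in> N then 0 else A u \<omega>)" for u \<omega>
  have V_ad: "V u \<in> borel_measurable (?F u)" if "0 \<le> u" for u
    by (rule borel_measurable_modification[OF Y_usual_filtration[OF that] that N_sub]) (auto simp: V_def)
  have V_cont: "continuous_on {0..} (\<lambda>u. V u \<omega>)" for \<omega>
    by (cases "\<omega> \<in> N") (auto simp: V_def continuous_on_path)
  \<comment> \<open>Off N the path and A start at 0, so the initial values subtracted in
    \<open>M_proc\<close> and in \<open>local_martingale\<close> vanish.\<close>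
  have mM: "martingale ?Q ?F (stopped (\<lambda>u \<omega>. V u \<omega> - \<delta> * u) (\<tau>1 n))" for n
    by (rule martingale_modification[OF \<tau>1_mart[of n] N N_sub])
      (auto simp: stopped_def V_def M_proc_def good)
  have mW: "martingale ?Q ?F (stopped (\<lambda>u \<omega>. (V u \<omega> - \<delta> * u)\<^sup>2 - A' u \<omega>) (\<tau>2 n))" for n
    by (rule martingale_modification[OF \<tau>2_mart[of n] N N_sub])
      (auto simp: stopped_def V_def A'_def M_proc_def good)
  have sde: "degenerate_sde ?Q ?F V A' (\<tau>1 n) (\<tau>2 n) (hitting_time V K) \<gamma> \<delta> K" for n
  proof
    show "1/2 * (LINT u:{s..t}|lborel. V u \<omega> powr (2*\<gamma>)) \<le> A' t \<omega> - A' s \<omega>"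
      if "0 \<le> s" "s \<le> t" for s t \<omega>
    proof (cases "\<omega> \<in> N")
      case True
      then show ?thesis using \<gamma> by (simp add: V_def A'_def)
    next
      case False
      then have "I_proc \<gamma> t \<omega> - I_proc \<gamma> s \<omega> \<le> A t \<omega> - A s \<omega>" using good that by blast
      moreover have "I_proc \<gamma> t \<omega> - I_proc \<gamma> s \<omega> = 1/2 * (LINT u:{s..t}|lborel. Y u \<omega> powr (2*\<gamma>))"
        by (rule I_proc_increment) (use good[OF False] that \<gamma> in auto)
      ultimately show ?thesis using False by (simp add: V_def A'_def)
    qed
    show "continuous_on {0..} (\<lambda>u. A' u \<omega>)" for \<omega>
      using good[of \<omega>] by (cases "\<omega> \<in> N") (auto simp: A'_def)
    show "ext_stopping_time ?F (hitting_time V K)"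
      by (rule hitting_time_stopping[OF V_ad V_cont])
    show "hitting_time V K \<omega> \<le> ennreal u \<longleftrightarrow> (\<exists>s\<in>{0..u}. K \<le> V s \<omega>)" if "0 \<le> u" for u \<omega>
      by (rule hitting_time_le_iff[OF V_cont that])
  qed (use \<gamma> \<delta> K V_ad V_cont \<tau>1 \<tau>2 mM mW good in \<open>auto simp: V_def\<close>)
  let ?E = "{\<omega>. measure lborel (zero_set t \<omega>) < (1 - 2*\<epsilon>) * t}"
  let ?E' = "{\<omega>\<in>space ?Q. measure lborel {s\<in>{0..t}. V s \<omega> = 0} < (1 - 2*\<epsilon>) * t}"
  have E: "?E \<in> sets P" unfolding sP using open_measure_zero_set_less by (rule borel_open)
  then have EQ: "?E \<in> sets ?Q" by simp
  have iff: "\<omega> \<in> ?E \<longleftrightarrow> \<omega> \<in> ?E'" if "\<omega> \<notin> N" for \<omega>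
    using that spP by (simp add: V_def zero_set_def)
  have E'Q: "?E' \<in> sets ?Q"
  proof -
    have dec: "?E' = (?E - N) \<union> (?E' \<inter> N)" using iff spP by auto
    have null: "?E' \<inter> N \<in> null_sets ?Q" by (rule null_sets_completion_subset[OF _ N]) auto
    have "?E - N \<in> sets ?Q" using EQ N by auto
    then show ?thesis by (subst dec) (rule sets.Un[OF _ null_setsD2[OF null]])
  qed
  have "measure P ?E = measure ?Q ?E" using E by simp
  also have "\<dots> = measure ?Q ?E'"
    by (rule measure_eq_AE[OF _ EQ E'Q], rule AE_I'[OF N]) (use iff in blast)
  finally have eq: "measure P ?E = measure ?Q ?E'" .
  let ?b = "\<delta> * t / K + 2 * (K powr (1 - 2*\<gamma>) / (1 - 2*\<gamma>)) * \<delta> / \<epsilon>"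
  have le: "measure P ?E \<le> ?b + measure ?Q {\<omega>\<in>space ?Q. \<tau>1 n \<omega> \<le> ennreal t} + measure ?Q {\<omega>\<in>space ?Q. \<tau>2 n \<omega> \<le> ennreal t}" for n
    unfolding eq by (rule degenerate_sde.zero_time_bound[OF sde t \<epsilon>])
  have lim: "AE \<omega> in ?Q. (\<lambda>n. \<tau>1 n \<omega>) \<longlonglongrightarrow> \<infinity>" "AE \<omega> in ?Q. (\<lambda>n. \<tau>2 n \<omega>) \<longlonglongrightarrow> \<infinity>"
    using \<tau>1_lim \<tau>2_lim by (eventually_elim, blast)+
  have "(\<lambda>n. measure ?Q {\<omega>\<in>space ?Q. \<tau>1 n \<omega> \<le> ennreal t}) \<longlonglongrightarrow> 0"
    "(\<lambda>n. measure ?Q {\<omega>\<in>space ?Q. \<tau>2 n \<omega> \<le> ennreal t}) \<longlonglongrightarrow> 0"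
    using t by (intro localizing_tendsto[OF \<tau>1 lim(1)] localizing_tendsto[OF \<tau>2 lim(2)]; simp)+
  then have "(\<lambda>n. ?b + measure ?Q {\<omega>\<in>space ?Q. \<tau>1 n \<omega> \<le> ennreal t} + measure ?Q {\<omega>\<in>space ?Q. \<tau>2 n \<omega> \<le> ennreal t}) \<longlonglongrightarrow> ?b + 0 + 0"
    by (intro tendsto_add tendsto_const)
  from LIMSEQ_le_const[OF this] have "measure P ?E \<le> ?b + 0 + 0" using le by blast
  then show ?thesis by simp
qed

section \<open>Choice of the level and the time\<close>

lemma zero_set_measure_mono:
  assumes "s \<le> t"
  shows "measure lborel (zero_set s \<omega>) \<le> measure lborel (zero_set t \<omega>)"
proof -
  have cl: "closed (zero_set r \<omega>)" for r
    unfolding zero_set_def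
    by (intro continuous_closed_preimage_constant continuous_on_subset[OF continuous_on_path]) auto
  have sub: "zero_set r \<omega> \<subseteq> {0..r}" for r by (auto simp: zero_set_def)
  have "emeasure lborel (zero_set t \<omega>) < top"
    using emeasure_mono[OF sub, of t lborel] by (auto simp: emeasure_lborel_Icc_eq elim!: le_less_trans split: if_splits)
  moreover have "zero_set s \<omega> \<subseteq> zero_set t \<omega>" using assms by (auto simp: zero_set_def)
  ultimately show ?thesis
    unfolding measure_def using cl[of t] by (intro enn2real_mono emeasure_mono) auto
qed

theorem theorem6p1:
  fixes \<gamma> :: real
  assumes "0 < \<gamma>" and "\<gamma> < 1/2"
  shows "(\<forall>t \<epsilon>. t > 0 \<longrightarrow> \<epsilon> > 0 \<longrightarrow>
            (\<exists>\<delta>\<^sub>0>0. \<forall>\<delta>. 0 < \<delta> \<and> \<delta> < \<delta>\<^sub>0 \<longrightarrow>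
               (\<forall>P \<in> M_class_from \<gamma> \<delta> 0.
                  measure P {\<omega>. measure lborel (zero_set t \<omega>) < (1 - 2 * \<epsilon>) * t} < \<epsilon>)))
       \<and> (\<forall>t \<delta>. t > 0 \<longrightarrow> \<delta> > 0 \<longrightarrow>
            (\<forall>P \<in> M_class_from \<gamma> \<delta> 0. AE \<omega> in P. measure lborel (zero_set t \<omega>) > 0))"
proof (intro conjI allI impI)
  fix t \<epsilon> :: real assume t: "t > 0" and \<epsilon>: "\<epsilon> > 0"
  \<comment> \<open>With K = 1 the estimate equals \<delta> c, so \<delta> < \<epsilon> / c is the
    smallness required.\<close>
  define c where "c = t + 2 * (1 / (1 - 2*\<gamma>)) / \<epsilon>"
  have c: "c > 0" unfolding c_def using t \<epsilon> assms by (intro add_pos_pos) auto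
  show "\<exists>\<delta>\<^sub>0>0. \<forall>\<delta>. 0 < \<delta> \<and> \<delta> < \<delta>\<^sub>0 \<longrightarrow>
               (\<forall>P \<in> M_class_from \<gamma> \<delta> 0.
                  measure P {\<omega>. measure lborel (zero_set t \<omega>) < (1 - 2 * \<epsilon>) * t} < \<epsilon>)"
  proof (intro exI[of _ "\<epsilon> / c"] conjI allI impI ballI)
    show "\<epsilon> / c > 0" using c \<epsilon> by simp
    fix \<delta> P assume \<delta>: "0 < \<delta> \<and> \<delta> < \<epsilon> / c" and P: "P \<in> M_class_from \<gamma> \<delta> 0"
    have "measure P {\<omega>. measure lborel (zero_set t \<omega>) < (1 - 2 * \<epsilon>) * t}
      \<le> \<delta> * t / 1 + 2 * (1 powr (1 - 2*\<gamma>) / (1 - 2*\<gamma>)) * \<delta> / \<epsilon>"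
      by (rule zero_time_estimate) (use assms \<delta> t \<epsilon> P in auto)
    also have "\<dots> = \<delta> * c" by (simp add: c_def algebra_simps)
    also have "\<dots> < \<epsilon>" using \<delta> c by (simp add: pos_less_divide_eq)
    finally show "measure P {\<omega>. measure lborel (zero_set t \<omega>) < (1 - 2 * \<epsilon>) * t} < \<epsilon>" .
  qed
next
  fix t \<delta> :: real assume t: "t > 0" and \<delta>: "\<delta> > 0"
  show "\<forall>P \<in> M_class_from \<gamma> \<delta> 0. AE \<omega> in P. measure lborel (zero_set t \<omega>) > 0"
  proof
    fix P assume P: "P \<in> M_class_from \<gamma> \<delta> 0"
    then have pP: "prob_space P" and sP: "sets P = sets borel"
      unfolding M_class_from_def M_class_def by auto
    interpret prob_space P by (rule pP)
    have spP: "space P = UNIV" using sets_eq_imp_space_eq[OF sP] by simp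
    define q where "q = 1 - 2*\<gamma>"
    have q: "0 < q" using assms by (simp add: q_def)
    let ?B = "{\<omega>. measure lborel (zero_set t \<omega>) \<le> 0}"
    have small: "{\<omega>. measure lborel (zero_set s \<omega>) < r} \<in> sets P" for s r
      unfolding sP using open_measure_zero_set_less by (rule borel_open)
    \<comment> \<open>Only strict sublevel sets are known to be open, so this event is written as a
      countable intersection of them.\<close>
    have "?B = (\<Inter>n. {\<omega>. measure lborel (zero_set t \<omega>) < inverse (real (Suc n))})"
    proof -
      have "x \<le> 0" if "\<And>n. x < inverse (real (Suc n))" for x :: real
        using that reals_Archimedean[of x] by (meson less_asym not_le)
      then show ?thesis by (auto intro: le_less_trans)
    qed
    also have "\<dots> \<in> sets P" by (intro sets.countable_INT) (use small in blast)+
    finally have B: "?B \<in> sets P" .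
    have "measure P ?B \<le> 0 + e" if e: "e > 0" for e
    proof -
      \<comment> \<open>Chosen so that the occupation term, which for \<epsilon> = 1/4 is 8 \<delta>
        K^q / q, equals e/2.\<close>
      define K where "K = (e * q / (16 * \<delta>)) powr (1 / q)"
      have K: "0 < K" using e q \<delta> by (simp add: K_def)
      have Kq: "K powr q = e * q / (16 * \<delta>)" unfolding K_def powr_powr using e q \<delta> by simp
      \<comment> \<open>With K fixed, this time makes the hitting term \<delta> s / K at most
        e/2.\<close>
      define s where "s = min t (e * K / (2 * \<delta>))"
      have s: "0 < s" "s \<le> t" "s \<le> e * K / (2 * \<delta>)" using t e K \<delta> by (auto simp: s_def)
      \<comment> \<open>Taking \<epsilon> = 1/4 leaves the positive threshold s/2, so a zero set of
        measure 0 falls below it.\<close>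
      have "?B \<subseteq> {\<omega>. measure lborel (zero_set s \<omega>) < (1 - 2 * (1/4)) * s}"
      proof
        fix \<omega> assume "\<omega> \<in> ?B"
        then have "measure lborel (zero_set s \<omega>) \<le> 0"
          using zero_set_measure_mono[OF s(2), of \<omega>] by simp
        then show "\<omega> \<in> {\<omega>. measure lborel (zero_set s \<omega>) < (1 - 2 * (1/4)) * s}"
          using s(1) by simp
      qed
      then have "measure P ?B \<le> measure P {\<omega>. measure lborel (zero_set s \<omega>) < (1 - 2 * (1/4)) * s}"
        by (rule finite_measure_mono[OF _ small])
      also have "\<dots> \<le> \<delta> * s / K + 2 * (K powr (1 - 2*\<gamma>) / (1 - 2*\<gamma>)) * \<delta> / (1/4)"
        by (rule zero_time_estimate) (use assms \<delta> K s P in auto)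
      also have "2 * (K powr (1 - 2*\<gamma>) / (1 - 2*\<gamma>)) * \<delta> / (1/4) = e / 2"
        unfolding q_def[symmetric] Kq using q \<delta> by simp
      also have "\<delta> * s / K \<le> e / 2" using s(3) K \<delta> by (simp add: field_simps)
      finally show ?thesis by simp
    qed
    then have "measure P ?B \<le> 0" by (rule field_le_epsilon)
    then have "measure P ?B = 0" using measure_nonneg[of P ?B] by linarith
    then have "emeasure P ?B = 0" by (simp add: emeasure_eq_measure)
    then show "AE \<omega> in P. measure lborel (zero_set t \<omega>) > 0"
      using B spP by (intro AE_I[of _ _ ?B]) (auto simp: not_less)
  qed
qed

end
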